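(* Let $M$ be a plumbed $3$-manifold obtained from a unimodular ${\tt H}$-graph (with positive definite linking matrix; see the context). Then the $\hat{Z}$-invariant of $M$ has a representation of the shape $$\hat{Z}(\tau)=\int_{\tau}^{\tau+i\infty} \int_{\tau}^{w_1} \frac{\Theta_1(w_1,w_2)}{ \sqrt{i (w_1-\tau)} \sqrt{i (w_2-\tau)}}\,d w_2\, d w_1+ \Theta_2(\tau),$$ where $\Theta_1(w_1,w_2)$ is a linear combination of products of derivatives of unary theta functions in $w_1$ and $w_2$, and $\Theta_2(\tau)$ is a rank two theta function. Moreover, there is a completion of $\hat{Z}$ which transforms like a weight one modular form.
   Context: $\mathbb{H}$ is the complex upper half-plane, $\tau\in\mathbb{H}$ and $q=e^{2\pi i\tau}$. Square roots are principal values; the integrals are taken along the vertical path from $\tau$ to $i\infty$, with $w_2$ running along the part of this path from $\tau$ to $w_1$. The ${\tt H}$-graph is the tree with vertices $v_1,\dots,v_6$ and edges $v_1v_2$, $v_1v_3$, $v_1v_4$, $v_4v_5$, $v_4v_6$. As a plumbing graph its vertices are decorated with integers $m_{jj}$, $1\le j\le N:=6$. Its linking matrix $L=(m_{jk})_{1\le j,k\le N}$ has diagonal entries $m_{jj}$ and, for $j\neq k$, $m_{jk}=-1$ if $v_j$ and $v_k$ are joined by an edge and $m_{jk}=0$ otherwise. It is assumed that $L$ is positive definite. The graph is called unimodular if $L$ is unimodular (invertible over $\mathbb{Z}$); then $\mathrm{coker}(L)=0$ and there is only one $\hat Z$-invariant. Let $\bm\delta=(\delta_j)_{1\le j\le N}$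 with $\delta_j\equiv\deg(v_j)\pmod 2$, where $\deg(v_j)$ is the degree of $v_j$. The $\hat Z$-invariant of the plumbed $3$-manifold is $$\hat Z(\tau)=\hat{Z}(q) := \frac{q^{\frac{-3N+\mathrm{tr}(L)}{4}}}{(2\pi i)^N} \, \mathrm{P.V.} \int_{|w_1|=1}\cdots\int_{|w_N|=1}\prod_{j=1}^N \big(w_j - w_j^{-1}\big)^{2-\deg(v_j)} \,\Theta_{-L}(q;\bm w)\, \frac{dw_N}{w_N} \cdots \frac{dw_1}{w_1},$$ $$\Theta_{-L}(q;\bm w):=\sum_{\boldsymbol{\ell} \in 2 L \mathbb{Z}^N+\bm\delta } q^{\frac14\boldsymbol{\ell}^T L^{-1} \boldsymbol{\ell} }\, \prod_{j=1}^N w_j^{\ell_j},$$ where $\mathrm{P.V.}$ denotes the Cauchy principal value and the circles are oriented counterclockwise. For $m\in\mathbb{N}$ and $r\in\mathbb{Z}/2m\mathbb{Z}$ the unary theta functions are $\vartheta_{m,r}(z;\tau)=\sum_{n\in\mathbb{Z}+\frac{r}{2m}}q^{mn^2}e^{4\pi i mnz}$, and their derivatives (in $z$, at $z=0$) are $\vartheta_{m,r}^{[k]}(\tau)=\big[\big(\frac{1}{4\pi i m}\frac{\partial}{\partial z}\big)^k\vartheta_{m,r}(z;\tau)\big]_{z=0}$, so that $\vartheta_{m,r}^{[1]}(\tau)=\sum_{n\in\mathbb{Z}+\frac{r}{2m}}n\,q^{mn^2}$. A rank two theta function is a (linear combination of) theta series $\sum_{\bm n\in\mathbb{Z}^2+\bm\alpha}q^{Q(\bm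 n)}$ with $Q$ a positive definite binary quadratic form and $\bm\alpha\in\mathbb{Q}^2$. A (modular) completion of a function $f(\tau)$ is a function $\widehat f(\tau,w)$ of two complex variables $(\tau,w)\in\mathbb{H}\times\mathbb{H}\setminus\{\tau=w\}$ which transforms like a modular form under simultaneous modular transformations $(\tau,w)\mapsto\left(\frac{a\tau+b}{c\tau+d},\frac{aw+b}{cw+d}\right)$ and which reproduces $f$ through the limit $\lim_{w\to\tau+i\infty}\widehat f(\tau,w)=f(\tau)$.
   Formalization: Leaves of weight 1 are excluded (weights 3,1,1,4,1,1 give 2(q^{1/2}-q^{-1/2}), unbounded at i∞), and the representation and the completion are asserted for Ẑ divided by an explicit rational power of q, without which the claimed shape fails. *)

theory Defs
  imports "HOL-Complex_Analysis.Complex_Analysis" "HOL-Library.Numeral_Type"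
    "HOL-Number_Theory.Cong"
begin

abbreviation upper_half_plane :: "complex set" where
  "upper_half_plane \<equiv> {\<tau>. 0 < Im \<tau>}"

text \<open>\<open>qpow \<tau> x\<close> is \<open>q\<close> to the power \<open>x\<close>, where \<open>q = exp (2 \<pi> \<i> \<tau>)\<close>.\<close>

definition qpow :: "complex \<Rightarrow> real \<Rightarrow> complex" where
  "qpow \<tau> x = exp (2 * of_real pi * \<i> * \<tau> * of_real x)"

text \<open>
  Vertices are the elements of the type \<open>6\<close>, whose six elements are written \<open>1, 2, 3, 4, 5, 6\<close>
  (in this type \<open>6 = 0\<close>).
\<close>

definition H_edges :: "6 set set" where
  "H_edges = {{1, 2}, {1, 3}, {1, 4}, {4, 5}, {4, 6}}"

definition H_deg :: "6 \<Rightarrow> nat" where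
  "H_deg j = card {k. {j, k} \<in> H_edges}"

definition H_linking :: "(6 \<Rightarrow> int) \<Rightarrow> int^6^6" where
  "H_linking m = (\<chi> j k. if j = k then m j else if {j, k} \<in> H_edges then -1 else 0)"

definition real_vec :: "int^'n \<Rightarrow> real^'n" where
  "real_vec v = (\<chi> j. of_int (v $ j))"

definition real_mat :: "int^'n^'n \<Rightarrow> real^'n^'n" where
  "real_mat A = (\<chi> j k. of_int (A $ j $ k))"

definition pos_def_mat :: "real^'n^'n \<Rightarrow> bool" where
  "pos_def_mat A \<longleftrightarrow> (\<forall>x. x \<noteq> 0 \<longrightarrow> 0 < x \<bullet> (A *v x))"

definition Theta_L :: "int^6^6 \<Rightarrow> int^6 \<Rightarrow> complex \<Rightarrow> (6 \<Rightarrow> complex) \<Rightarrow> complex" where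
  "Theta_L L \<delta> \<tau> w =
     (\<Sum>\<^sub>\<infinity>l\<in>{l. \<exists>n. l = 2 *s (L *v n) + \<delta>}.
        qpow \<tau> ((1/4) * (real_vec l \<bullet> (matrix_inv (real_mat L) *v real_vec l)))
        * (\<Prod>j\<in>UNIV. w j powi (l $ j)))"

text \<open>
  \<open>cut_circle_integral \<epsilon> js F w\<close> is the iterated integral of \<open>F\<close> against \<open>dw\<^sub>j / w\<^sub>j\<close> over the
  counterclockwise unit circles for the variables \<open>j\<close> in the list \<open>js\<close> (the first one outermost).
  In the variables in which \<open>(w\<^sub>j - 1 / w\<^sub>j)\<close> occurs with a negative exponent \<open>2 - deg v\<^sub>j\<close>, the
  parts of the circle at distance less than \<open>\<epsilon>\<close> from the poles \<open>1\<close> and \<open>-1\<close> are left out.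
  The Cauchy principal value is the limit for \<open>\<epsilon> \<rightarrow> 0\<close>.
\<close>

fun cut_circle_integral ::
    "real \<Rightarrow> 6 list \<Rightarrow> ((6 \<Rightarrow> complex) \<Rightarrow> complex) \<Rightarrow> (6 \<Rightarrow> complex) \<Rightarrow> complex" where
  "cut_circle_integral \<epsilon> [] F w = F w"
| "cut_circle_integral \<epsilon> (j # js) F w =
     contour_integral (circlepath 0 1)
       (\<lambda>z. if H_deg j \<le> 2 \<or> (\<epsilon> \<le> dist z 1 \<and> \<epsilon> \<le> dist z (-1))
            then cut_circle_integral \<epsilon> js F (w(j := z)) / z else 0)"

definition PV_circle_integral :: "((6 \<Rightarrow> complex) \<Rightarrow> complex) \<Rightarrow> complex" where
  "PV_circle_integral F =
     Lim (at_right 0) (\<lambda>\<epsilon>. cut_circle_integral \<epsilon> [1, 2, 3, 4, 5, 6] F (\<lambda>_. 1))"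

definition Zhat :: "(6 \<Rightarrow> int) \<Rightarrow> int^6 \<Rightarrow> complex \<Rightarrow> complex" where
  "Zhat m \<delta> \<tau> =
     qpow \<tau> ((- 3 * 6 + of_int (trace (H_linking m))) / 4) / (2 * of_real pi * \<i>) ^ 6
     * PV_circle_integral (\<lambda>w.
         (\<Prod>j\<in>UNIV. (w j - inverse (w j)) powi (2 - int (H_deg j)))
         * Theta_L (H_linking m) \<delta> \<tau> w)"

text \<open>
  The overall power of \<open>q\<close> in the Z-hat invariant. Besides the explicit prefactor, it collects the
  part of \<open>l\<^sup>T L\<^sup>-\<^sup>1 l / 4\<close> which is constant on the \<open>l\<close> that survive the integration: there
  \<open>l\<^sub>j = \<plusminus>1\<close> for the leaves \<open>j\<close>, and with \<open>y\<^sub>1 = l\<^sub>1 + l\<^sub>2/m\<^sub>2 + l\<^sub>3/m\<^sub>3\<close>, \<open>y\<^sub>4 = l\<^sub>4 + l\<^sub>5/m\<^sub>5 + l\<^sub>6/m\<^sub>6\<close>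
  and \<open>S\<close> the block of \<open>L\<^sup>-\<^sup>1\<close> for the vertices \<open>1\<close> and \<open>4\<close>, completing squares gives
  \<open>l\<^sup>T L\<^sup>-\<^sup>1 l = y\<^sup>T S y + 1/m\<^sub>2 + 1/m\<^sub>3 + 1/m\<^sub>5 + 1/m\<^sub>6\<close>.

  If no leaf has weight \<open>1\<close>, unimodularity makes \<open>m\<^sub>2, m\<^sub>3\<close> and \<open>m\<^sub>5, m\<^sub>6\<close> coprime and \<open>y\<^sub>1, y\<^sub>4\<close> have the
  signs of \<open>l\<^sub>1, l\<^sub>4\<close>, so that \<open>q\<close> to the power \<open>- Zhat_exponent m\<close> times Z-hat is a rank two false
  theta function. A leaf of weight \<open>1\<close> can be blown down, and then the sum degenerates: weights
  \<open>3, 1, 1, 4, 1, 1\<close> give \<open>2 (q\<^bsup>1/2\<^esup> - q\<^bsup>-1/2\<^esup>)\<close>.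
\<close>

definition Zhat_exponent :: "(6 \<Rightarrow> int) \<Rightarrow> real" where
  "Zhat_exponent m =
     (- 3 * 6 + of_int (trace (H_linking m))) / 4
     + (\<Sum>j | H_deg j = 1. 1 / of_int (m j)) / 4"

definition unary_theta :: "nat \<Rightarrow> int \<Rightarrow> complex \<Rightarrow> complex \<Rightarrow> complex" where
  "unary_theta m r z \<tau> =
     (\<Sum>\<^sub>\<infinity>n\<in>{of_int j + of_int r / (2 * real m) | j :: int. True}.
        qpow \<tau> (real m * n\<^sup>2) * exp (4 * of_real pi * \<i> * of_nat m * of_real n * z))"

definition unary_theta_deriv :: "nat \<Rightarrow> nat \<Rightarrow> int \<Rightarrow> complex \<Rightarrow> complex" where
  "unary_theta_deriv k m r \<tau> =
     (1 / (4 * of_real pi * \<i> * of_nat m)) ^ k * (deriv ^^ k) (\<lambda>z. unary_theta m r z \<tau>) 0"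

definition comb_of_unary_theta_deriv_products :: "(complex \<Rightarrow> complex \<Rightarrow> complex) \<Rightarrow> bool" where
  "comb_of_unary_theta_deriv_products \<Theta> \<longleftrightarrow>
     (\<exists>(N :: nat) c k m r k' m' r'.
        (\<forall>i<N. 0 < k i \<and> 0 < m i \<and> 0 < k' i \<and> 0 < m' i) \<and>
        (\<forall>w1\<in>upper_half_plane. \<forall>w2\<in>upper_half_plane.
           \<Theta> w1 w2 = (\<Sum>i<N. c i * unary_theta_deriv (k i) (m i) (r i) w1
                             * unary_theta_deriv (k' i) (m' i) (r' i) w2)))"

text \<open>
  Integral coefficients are no restriction compared with rational ones: a series for a rational
  form is a finite sum of series for integral forms, after rescaling \<open>n\<close>.
\<close>

definition binary_form :: "int \<times> int \<times> int \<Rightarrow> real \<Rightarrow> real \<Rightarrow> real" where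
  "binary_form Q x y = (case Q of (a, b, c) \<Rightarrow> of_int a * x\<^sup>2 + of_int b * x * y + of_int c * y\<^sup>2)"

definition pos_def_form :: "int \<times> int \<times> int \<Rightarrow> bool" where
  "pos_def_form Q \<longleftrightarrow> (\<forall>x y. (x, y) \<noteq> (0, 0) \<longrightarrow> 0 < binary_form Q x y)"

definition theta_series2 :: "int \<times> int \<times> int \<Rightarrow> rat \<times> rat \<Rightarrow> complex \<Rightarrow> complex" where
  "theta_series2 Q \<alpha> \<tau> =
     (\<Sum>\<^sub>\<infinity>(i, j)\<in>(UNIV :: (int \<times> int) set).
        qpow \<tau> (binary_form Q (of_int i + of_rat (fst \<alpha>)) (of_int j + of_rat (snd \<alpha>))))"

definition rank_two_theta :: "(complex \<Rightarrow> complex) \<Rightarrow> bool" where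
  "rank_two_theta \<Theta> \<longleftrightarrow>
     (\<exists>(N :: nat) c Q \<alpha>. (\<forall>i<N. pos_def_form (Q i)) \<and>
        (\<forall>\<tau>\<in>upper_half_plane. \<Theta> \<tau> = (\<Sum>i<N. c i * theta_series2 (Q i) (\<alpha> i) \<tau>)))"

text \<open>
  \<open>has_iterated_integral g \<tau> I\<close>: the iterated integral of \<open>g w1 w2\<close>, with \<open>w1\<close> on the vertical
  path \<open>\<tau> + \<i> t\<close>, \<open>t > 0\<close>, from \<open>\<tau>\<close> to \<open>\<tau> + \<i>\<infinity>\<close> and \<open>w2\<close> on its part from \<open>\<tau>\<close> to \<open>w1\<close>, exists
  and is \<open>I\<close>; the factor \<open>\<i>\<close> comes from \<open>dw1 = \<i> dt\<close>.
\<close>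

definition has_iterated_integral ::
    "(complex \<Rightarrow> complex \<Rightarrow> complex) \<Rightarrow> complex \<Rightarrow> complex \<Rightarrow> bool" where
  "has_iterated_integral g \<tau> I \<longleftrightarrow>
     (\<forall>t>0. g (\<tau> + \<i> * of_real t) contour_integrable_on linepath \<tau> (\<tau> + \<i> * of_real t)) \<and>
     ((\<lambda>t. contour_integral (linepath \<tau> (\<tau> + \<i> * of_real t)) (g (\<tau> + \<i> * of_real t)) * \<i>)
        has_integral I) {0<..}"

text \<open>
  Being a modular form for some congruence subgroup, possibly with a multiplier that is trivial on
  a smaller congruence subgroup, amounts to the transformation law on some principal congruence
  subgroup \<open>\<Gamma>(K)\<close>. Holomorphy is required because without it a completion in this sense exists for
  every periodic \<open>f\<close>: put \<open>f \<tau>\<close> at \<open>(\<tau>, \<tau> + \<i> t)\<close> and extend equivariantly.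
\<close>

definition moebius :: "int \<Rightarrow> int \<Rightarrow> int \<Rightarrow> int \<Rightarrow> complex \<Rightarrow> complex" where
  "moebius a b c d \<tau> = (of_int a * \<tau> + of_int b) / (of_int c * \<tau> + of_int d)"

definition is_completion :: "int \<Rightarrow> (complex \<Rightarrow> complex) \<Rightarrow> (complex \<Rightarrow> complex \<Rightarrow> complex) \<Rightarrow> bool" where
  "is_completion k f F \<longleftrightarrow>
     (\<forall>w\<in>upper_half_plane. (\<lambda>\<tau>. F \<tau> w) holomorphic_on upper_half_plane - {w}) \<and>
     (\<forall>\<tau>\<in>upper_half_plane. F \<tau> holomorphic_on upper_half_plane - {\<tau>}) \<and>
     (\<exists>K>0. \<forall>a b c d :: int.
        a * d - b * c = 1 \<and> [a = 1] (mod K) \<and> [b = 0] (mod K) \<and> [c = 0] (mod K) \<and> [d = 1] (mod K) \<longrightarrow>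
        (\<forall>\<tau>\<in>upper_half_plane. \<forall>w\<in>upper_half_plane. \<tau> \<noteq> w \<longrightarrow>
           F (moebius a b c d \<tau>) (moebius a b c d w)
             = (of_int c * \<tau> + of_int d) powi k * F \<tau> w)) \<and>
     (\<forall>\<tau>\<in>upper_half_plane. ((\<lambda>t. F \<tau> (\<tau> + \<i> * of_real t)) \<longlongrightarrow> f \<tau>) at_top)"

end

theory Submission
  imports Defs "HOL-Real_Asymp.Real_Asymp"
begin

text \<open>
  Only the terms of the theta series whose leaf entries are \<open>\<plusminus>1\<close> and whose other entries are odd
  survive the principal value integral, a leaf contributing \<open>- 2 \<pi> \<i> l\<close> and a trivalent vertex
  \<open>\<pi> \<i> sgn l\<close>. Inverting \<open>L\<close> leaves a power of \<open>q\<close> times a combination of sums of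
  \<open>sgn u sgn v q\<close> to the power \<open>(B u\<^sup>2 / M + 2 u v + A v\<^sup>2 / P) / 4\<close>, with
  \<open>M = m\<^sub>2 m\<^sub>3\<close>, \<open>P = m\<^sub>5 m\<^sub>6\<close>, \<open>A = m\<^sub>1 M - m\<^sub>2 - m\<^sub>3\<close>, \<open>B = m\<^sub>4 P - m\<^sub>5 - m\<^sub>6\<close> and
  \<open>A B - M P = det L = 1\<close>.

  The double integral of \<open>a b exp (2 \<pi> \<i> (a\<^sup>2 w\<^sub>1 + b\<^sup>2 w\<^sub>2))\<close> is \<open>arctan (b / a) / \<pi>\<close> times \<open>q\<close> to the
  power \<open>a\<^sup>2 + b\<^sup>2\<close>. Completing the square in either variable turns products of unary theta
  derivatives into sums with such arctangents as coefficients, and an addition theorem expresses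
  \<open>sgn u sgn v\<close> by two of these arctangents and a constant. The constant accounts for the rank
  two theta function.

  For the completion only three properties of the series \<open>f\<close> matter: it is holomorphic, invariant
  under \<open>\<tau> \<mapsto> \<tau> + K\<close>, and bounded by a multiple of \<open>(1 + 1 / Im \<tau>)\<^sup>2\<close>. The sum of
  \<open>f (g \<tau>) / ((c \<tau> + d) (c w + d)\<^sup>1\<^sup>2)\<close> over the cosets \<open>g\<close> of the translations in \<open>\<Gamma>(K)\<close> has weight
  \<open>(1, 12)\<close> and tends to \<open>f \<tau>\<close> as \<open>w\<close> tends to \<open>\<i>\<infinity>\<close>. Dividing by the fourth power of a zero-free
  form of weight three in \<open>w\<close> brings the weight to \<open>(1, 0)\<close>. Such a form is
  the sum of \<open>(1/4 + m w + n)\<close> to the power \<open>-3\<close> over all integers \<open>m, n\<close>.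
\<close>

subsection \<open>Infinite sums and integrals\<close>

text \<open>A completion has weight one in tau, weight zero in w, and no differential equation in w
  is imposed. The second variable can therefore carry the convergence that weight one in tau does
  not give: f at a translate of tau may grow like the fourth power of |c| + |d|, and the twelve
  factors c w + d outweigh this. The surplus weight in w must then be removed without creating
  poles, hence the need for a form with no zeros at all. The lattice sum of exponent -3 is -1/2
  times the derivative of the Weierstrass function; its zeros are exactly known half periods, and
  the point 1/4 of order four avoids them.

  In the Eichler integral w2 stops at w1, so a triangle is covered instead of a quadrant. This is
  why an angle appears in place of a sign, and why two completions of the square are needed to
  reassemble a product of signs.

  In the principal value the pole kernel is bounded only by a multiple of 1/\<epsilon>^2, so no
  single majorant serves. Sum and integral are exchanged for fixed \<epsilon>; the limit is then
  taken with bounds on the integrals that do not depend on \<epsilon>.\<close>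

lemma has_sum_bound_nonneg:
  fixes f :: "'a \<Rightarrow> real"
  assumes "\<And>x. x \<in> S \<Longrightarrow> 0 \<le> f x" "\<And>x. x \<in> S \<Longrightarrow> f x \<le> g x" "g summable_on S"
  shows "f summable_on S"
  using summable_on_comparison_test[OF assms(3)] assms by blast

lemma summable_on_int_iff_nat:
  fixes f :: "int \<Rightarrow> real"
  assumes "summable (\<lambda>n. f (int n))" "summable (\<lambda>n. f (- int n))" "\<And>n. 0 \<le> f n"
  shows "f summable_on UNIV"
proof -
  have 1: "f summable_on range int"
    using summable_on_reindex[of int UNIV f] assms
    by (auto simp: o_def intro: summable_nonneg_imp_summable_on)
  have "f summable_on range (\<lambda>n. - int n)"
    using summable_on_reindex[of "\<lambda>n. - int n" UNIV f] assms
    by (auto simp: o_def inj_def intro: summable_nonneg_imp_summable_on)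
  with 1 have "f summable_on (range int \<union> range (\<lambda>n. - int n))"
    by (rule summable_on_union)
  moreover have "range int \<union> range (\<lambda>n. - int n) = UNIV"
    by (auto simp: image_iff) (metis int_cases2)
  ultimately show ?thesis by simp
qed

lemma summable_on_powr_int:
  "(\<lambda>n::int. (1 + \<bar>real_of_int n\<bar>) powr (-3/2)) summable_on UNIV"
proof -
  have "summable (\<lambda>n. real n powr (-3/2))"
    by (simp add: summable_real_powr_iff)
  then have "summable (\<lambda>n. real (Suc n) powr (-3/2))"
    using summable_Suc_iff[of "\<lambda>n. real n powr (-3/2)"] by simp
  then show ?thesis
    by (intro summable_on_int_iff_nat) (auto simp: add.commute)
qed

text \<open>The explicit bound matters as k tends to 0: it becomes the growth of the false theta
  functions near the real line, one factor 1 + 1 / Im \<tau> for each summation variable.\<close>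

lemma summable_on_exp_abs_int:
  assumes "0 < k"
  shows "(\<lambda>n::int. exp (- k * \<bar>real_of_int n\<bar>)) summable_on UNIV"
    and "(\<Sum>\<^sub>\<infinity>n::int. exp (- k * \<bar>real_of_int n\<bar>)) \<le> 2 + 2 / k"
proof -
  have q: "exp (-k * real n) = exp (-k) ^ n" for n
    by (simp add: exp_of_nat_mult[symmetric] mult.commute)
  have s: "summable (\<lambda>n. exp (-k) ^ n)"
    using assms by (intro summable_geometric) auto
  show 1: "(\<lambda>n::int. exp (- k * \<bar>real_of_int n\<bar>)) summable_on UNIV"
    using s q by (intro summable_on_int_iff_nat) auto
  have kk: "1 / (1 - exp (-k)) \<le> 1 + 1 / k"
  proof -
    have "1 + k \<le> exp k" by simp
    then have "exp (-k) \<le> 1 / (1 + k)"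
      using assms by (simp add: exp_minus field_simps)
    then have "k / (1 + k) \<le> 1 - exp (-k)"
      using assms by (simp add: field_simps)
    then have "1 / (1 - exp (-k)) \<le> 1 / (k / (1 + k))"
      using assms by (intro divide_left_mono) (auto intro!: mult_pos_pos)
    then show ?thesis using assms by (simp add: field_simps)
  qed
  have geo: "((\<lambda>n. exp (- k * \<bar>real_of_int n\<bar>)) has_sum 1 / (1 - exp (-k))) (range h)"
    if "inj h" "\<And>n. \<bar>h n\<bar> = int n" for h :: "nat \<Rightarrow> int"
  proof -
    have "\<bar>real_of_int (h n)\<bar> = real n" for n
      using that(2)[of n] by (metis of_int_abs of_int_of_nat_eq)
    then have e: "(\<lambda>n. exp (- k * \<bar>real_of_int n\<bar>)) \<circ> h = (\<lambda>n. exp (-k) ^ n)"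
      by (auto simp: o_def q[symmetric])
    have "((\<lambda>n. exp (-k) ^ n) has_sum 1 / (1 - exp (-k))) UNIV"
      using geometric_sums[of "exp (-k)"] assms by (intro sums_nonneg_imp_has_sum) auto
    then show ?thesis
      using has_sum_reindex[OF that(1), of "\<lambda>n. exp (- k * \<bar>real_of_int n\<bar>)"] e by simp
  qed
  have u: "UNIV = range int \<union> range (\<lambda>n. - int n)"
    by (auto simp: image_iff) (metis int_cases2)
  have g1: "((\<lambda>n::int. exp (- k * \<bar>real_of_int n\<bar>)) has_sum 1 / (1 - exp (-k))) (range int)"
    and g2: "((\<lambda>n::int. exp (- k * \<bar>real_of_int n\<bar>)) has_sum 1 / (1 - exp (-k))) (range (\<lambda>n. - int n))"
    by (rule geo; auto simp: inj_def)+
  let ?f = "\<lambda>n::int. exp (- k * \<bar>real_of_int n\<bar>)"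
  \<comment> \<open>The index 0 lies in both ranges. Counting it twice gives the upper bound 2 (1 +
    1/k).\<close>
  have "infsum ?f UNIV = infsum ?f (range int) + infsum ?f (range (\<lambda>n. - int n) - range int)"
    using summable_on_subset_banach[OF 1]
    by (subst infsum_Un_disjoint[symmetric]) (auto simp: u)
  also have "\<dots> \<le> infsum ?f (range int) + infsum ?f (range (\<lambda>n. - int n))"
    using summable_on_subset_banach[OF 1] by (intro add_left_mono infsum_mono2) auto
  also have "\<dots> \<le> 2 + 2 / k"
    using kk infsumI[OF g1] infsumI[OF g2] by simp
  finally show "(\<Sum>\<^sub>\<infinity>n::int. exp (- k * \<bar>real_of_int n\<bar>)) \<le> 2 + 2 / k" .
qed

lemma summable_on_product_nonneg:
  fixes f :: "'a \<Rightarrow> real" and g :: "'b \<Rightarrow> real"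
  assumes "f summable_on A" "g summable_on B" "\<And>x. x \<in> A \<Longrightarrow> 0 \<le> f x" "\<And>x. x \<in> B \<Longrightarrow> 0 \<le> g x"
  shows "(\<lambda>(x, y). f x * g y) summable_on A \<times> B"
    and "(\<Sum>\<^sub>\<infinity>(x, y)\<in>A \<times> B. f x * g y) = infsum f A * infsum g B"
proof -
  show *: "(\<lambda>(x, y). f x * g y) summable_on A \<times> B"
    using assms
    by (intro summable_on_SigmaI[where g = "\<lambda>x. f x * infsum g B"])
       (auto intro!: has_sum_cmult_right has_sum_infsum summable_on_cmult_left)
  show "(\<Sum>\<^sub>\<infinity>(x, y)\<in>A \<times> B. f x * g y) = infsum f A * infsum g B"
    using infsum_Sigma'_banach[OF *] by (simp add: infsum_cmult_right' infsum_cmult_left')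
qed

text \<open>Since 1 + |m| + |n| is at least 1 + |m| and at least 1 + |n|, splitting the exponent 3
  as 3/2 + 3/2 gives a majorant that is a product of two convergent one-variable series.\<close>

lemma summable_on_lattice_cube:
  "(\<lambda>(m::int, n::int). 1 / (1 + \<bar>real_of_int m\<bar> + \<bar>real_of_int n\<bar>) ^ 3) summable_on UNIV"
proof -
  let ?h = "\<lambda>n::int. (1 + \<bar>real_of_int n\<bar>) powr (-3/2)"
  let ?f = "\<lambda>(m::int, n::int). 1 / (1 + \<bar>real_of_int m\<bar> + \<bar>real_of_int n\<bar>) ^ 3"
  have "(\<lambda>(m, n). ?h m * ?h n) summable_on UNIV \<times> UNIV"
    by (intro summable_on_product_nonneg summable_on_powr_int) auto
  moreover have "1 / (1 + \<bar>real_of_int m\<bar> + \<bar>real_of_int n\<bar>) ^ 3 \<le> ?h m * ?h n" for m n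
  proof -
    let ?s = "1 + \<bar>real_of_int m\<bar> + \<bar>real_of_int n\<bar>"
    have "?s powr (-3/2) * ?s powr (-3/2) \<le> ?h m * ?h n"
      by (rule mult_mono; (rule powr_mono2')?; simp)
    moreover have "?s powr (-3/2) * ?s powr (-3/2) = 1 / ?s ^ 3"
    proof -
      have "?s powr (-3/2) * ?s powr (-3/2) = ?s powr (- real 3)"
        by (subst powr_add[symmetric]) simp
      also have "\<dots> = 1 / ?s powr real 3"
        by (simp only: powr_minus divide_inverse mult_1)
      also have "?s powr real 3 = ?s ^ 3"
        by (rule powr_realpow) linarith
      finally show ?thesis .
    qed
    ultimately show ?thesis by simp
  qed
  ultimately have *: "?f (m, n) \<le> (\<lambda>(m, n). ?h m * ?h n) (m, n)"
    and sm: "(\<lambda>(m, n). ?h m * ?h n) summable_on UNIV" for m n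
    by (simp_all only: prod.case UNIV_Times_UNIV)
  show ?thesis
  proof (rule has_sum_bound_nonneg[OF _ _ sm])
    fix x :: "int \<times> int"
    obtain m n where x: "x = (m, n)" by (cases x)
    show "0 \<le> ?f x" unfolding x prod.case by (intro divide_nonneg_nonneg zero_le_power) auto
    show "?f x \<le> (\<lambda>(m, n). ?h m * ?h n) x" unfolding x by (rule *)
  qed
qed

lemma infsum_product:
  fixes f g :: "_ \<Rightarrow> complex"
  assumes "(\<lambda>x. norm (f x)) summable_on A" "(\<lambda>x. norm (g x)) summable_on B"
  shows "infsum f A * infsum g B = (\<Sum>\<^sub>\<infinity>(x, y)\<in>A \<times> B. f x * g y)"
proof -
  have "(\<lambda>(x, y). norm (f x) * norm (g y)) summable_on A \<times> B"
    using assms by (intro summable_on_product_nonneg) auto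
  then have "(\<lambda>z. norm (case z of (x, y) \<Rightarrow> f x * g y)) summable_on A \<times> B"
    by (simp add: case_prod_unfold norm_mult)
  then have *: "(\<lambda>(x, y). f x * g y) summable_on A \<times> B"
    by (rule abs_summable_summable)
  show ?thesis
    using infsum_Sigma'_banach[OF *] by (simp add: infsum_cmult_right' infsum_cmult_left')
qed

text \<open>Dominated convergence for series: the M-test makes the finite partial sums converge
  uniformly on \<open>S\<close>, so the two limits commute.\<close>

lemma tendsto_infsum:
  fixes f :: "'a \<Rightarrow> 'b \<Rightarrow> complex"
  assumes "\<And>i. i \<in> I \<Longrightarrow> (f i \<longlongrightarrow> g i) F"
    and "\<forall>\<^sub>F x in F. x \<in> S" "\<And>i x. i \<in> I \<Longrightarrow> x \<in> S \<Longrightarrow> norm (f i x) \<le> M i" "M summable_on I"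
    and "F \<noteq> bot"
  shows "((\<lambda>x. \<Sum>\<^sub>\<infinity>i\<in>I. f i x) \<longlongrightarrow> (\<Sum>\<^sub>\<infinity>i\<in>I. g i)) F"
proof -
  have gM: "norm (g i) \<le> M i" if "i \<in> I" for i
  proof (rule tendsto_le[OF assms(5) tendsto_const tendsto_norm[OF assms(1)[OF that]]])
    show "\<forall>\<^sub>F x in F. norm (f i x) \<le> M i"
      using assms(2) by eventually_elim (use assms(3) that in auto)
  qed
  have "(\<lambda>i. norm (g i)) summable_on I"
    using Infinite_Sum.abs_summable_on_comparison_test'[OF assms(4) gM] by simp
  then have gs: "g summable_on I" by (rule abs_summable_summable)
  show ?thesis
  proof (rule swap_uniform_limit')
    show "uniform_limit S (\<lambda>X y. \<Sum>x\<in>X. f x y) (\<lambda>y. \<Sum>\<^sub>\<infinity>x\<in>I. f x y) (finite_subsets_at_top I)"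
      by (rule Weierstrass_m_test_general) (use assms in auto)
    show "\<forall>\<^sub>F X in finite_subsets_at_top I. ((\<lambda>x. \<Sum>i\<in>X. f i x) \<longlongrightarrow> (\<Sum>i\<in>X. g i)) F"
      by (rule eventually_finite_subsets_at_top_weakI) (auto intro!: tendsto_sum assms(1))
    show "((\<lambda>X. \<Sum>i\<in>X. g i) \<longlongrightarrow> (\<Sum>\<^sub>\<infinity>i\<in>I. g i)) (finite_subsets_at_top I)"
      using gs by (rule infsum_tendsto)
  qed (use assms in auto)
qed

text \<open>Holomorphy is local, so a summable majorant on a small disc around each point is enough;
  radius and majorant may depend on the point.\<close>

lemma holomorphic_on_infsum:
  fixes f :: "'a \<Rightarrow> complex \<Rightarrow> complex"
  assumes "\<And>i. i \<in> I \<Longrightarrow> f i holomorphic_on S" "open S"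
    and "\<And>z. z \<in> S \<Longrightarrow> \<exists>r M. 0 < r \<and> cball z r \<subseteq> S \<and> M summable_on I \<and>
           (\<forall>i\<in>I. \<forall>x\<in>cball z r. norm (f i x) \<le> M i)"
  shows "(\<lambda>z. \<Sum>\<^sub>\<infinity>i\<in>I. f i z) holomorphic_on S"
proof -
  have "\<exists>r>0. (\<lambda>z. \<Sum>\<^sub>\<infinity>i\<in>I. f i z) holomorphic_on ball z r" if z: "z \<in> S" for z
  proof -
    obtain r M where rM: "0 < r" "cball z r \<subseteq> S" "M summable_on I"
      "\<And>i x. i\<in>I \<Longrightarrow> x\<in>cball z r \<Longrightarrow> norm (f i x) \<le> M i"
      using assms(3)[OF z] by blast
    have "(\<lambda>z. \<Sum>\<^sub>\<infinity>i\<in>I. f i z) holomorphic_on ball z r"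
    proof (rule holomorphic_uniform_limit)
      show "uniform_limit (cball z r) (\<lambda>X y. \<Sum>x\<in>X. f x y) (\<lambda>y. \<Sum>\<^sub>\<infinity>x\<in>I. f x y)
              (finite_subsets_at_top I)"
        by (rule Weierstrass_m_test_general) (use rM in auto)
      show "\<forall>\<^sub>F n in finite_subsets_at_top I. continuous_on (cball z r) (\<lambda>y. \<Sum>x\<in>n. f x y)
              \<and> (\<lambda>y. \<Sum>x\<in>n. f x y) holomorphic_on ball z r"
      proof (rule eventually_finite_subsets_at_top_weakI)
        fix X assume "finite X" "X \<subseteq> I"
        then have "(\<lambda>y. \<Sum>x\<in>X. f x y) holomorphic_on cball z r"
          using assms(1) rM(2) by (intro holomorphic_on_sum) (auto intro: holomorphic_on_subset)
        then show "continuous_on (cball z r) (\<lambda>y. \<Sum>x\<in>X. f x y)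
              \<and> (\<lambda>y. \<Sum>x\<in>X. f x y) holomorphic_on ball z r"
          by (auto intro: holomorphic_on_imp_continuous_on holomorphic_on_subset)
      qed
    qed auto
    then show ?thesis using rM by auto
  qed
  then show ?thesis
    by (meson assms(2) at_within_open centre_in_ball field_differentiable_at_within
        holomorphic_on_def holomorphic_on_imp_differentiable_at open_ball)
qed

lemma has_integral_infsum:
  fixes f :: "'a \<Rightarrow> real \<Rightarrow> complex"
  assumes "\<And>i. i \<in> I \<Longrightarrow> f i integrable_on {a..b}"
    and "\<And>i x. i \<in> I \<Longrightarrow> x \<in> {a..b} \<Longrightarrow> norm (f i x) \<le> M i" "M summable_on I"
  shows "((\<lambda>x. \<Sum>\<^sub>\<infinity>i\<in>I. f i x) has_integral (\<Sum>\<^sub>\<infinity>i\<in>I. integral {a..b} (f i))) {a..b}"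
proof -
  define g where "g = (\<lambda>x. \<Sum>\<^sub>\<infinity>i\<in>I. f i x)"
  let ?F = "finite_subsets_at_top I"
  have u: "uniform_limit {a..b} (\<lambda>X y. \<Sum>x\<in>X. f x y) g ?F"
    unfolding g_def by (rule Weierstrass_m_test_general) (use assms in auto)
  have fin: "(\<lambda>y. \<Sum>x\<in>X. f x y) integrable_on {a..b}" if "finite X" "X \<subseteq> I" for X
    using that assms by (intro integrable_sum) auto
  have ev: "\<forall>\<^sub>F X in ?F. finite X \<and> X \<subseteq> I \<and> (\<forall>x\<in>{a..b}. norm ((\<Sum>i\<in>X. f i x) - g x) \<le> e)"
    if "e > 0" for e
  proof -
    have "\<forall>\<^sub>F X in ?F. finite X \<and> X \<subseteq> I"
      by (rule eventually_finite_subsets_at_top_weakI) auto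
    with uniform_limitD[OF u that] show ?thesis
      by eventually_elim (auto simp: dist_norm less_imp_le)
  qed
  have gi: "g integrable_on {a..b}"
  proof (rule integrable_uniform_limit_real)
    fix e :: real assume "e > 0"
    from eventually_happens[OF ev[OF this]] obtain X where X: "finite X" "X \<subseteq> I"
      "\<forall>x\<in>{a..b}. norm ((\<Sum>i\<in>X. f i x) - g x) \<le> e" by auto
    then show "\<exists>h. (\<forall>x\<in>{a..b}. norm (g x - h x) \<le> e) \<and> h integrable_on {a..b}"
      by (intro exI[of _ "\<lambda>y. \<Sum>x\<in>X. f x y"]) (auto intro: fin simp: norm_minus_commute)
  qed
  have "((\<lambda>i. integral {a..b} (f i)) has_sum integral {a..b} g) I"
    unfolding has_sum_def
  proof (rule tendstoI)
    fix e :: real assume e: "e > 0"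
    \<comment> \<open>The 1 in the denominator keeps \<open>d\<close> positive and well defined when
      the interval is degenerate or empty.\<close>
    define d where "d = e / (2 * (1 + \<bar>b - a\<bar>))"
    have d: "d > 0" unfolding d_def using e by (intro divide_pos_pos) (auto intro: add_pos_nonneg)
    from ev[OF d] show "\<forall>\<^sub>F X in ?F. dist (\<Sum>i\<in>X. integral {a..b} (f i)) (integral {a..b} g) < e"
    proof eventually_elim
      case (elim X)
      have "(\<Sum>i\<in>X. integral {a..b} (f i)) - integral {a..b} g
          = integral {a..b} (\<lambda>x. (\<Sum>i\<in>X. f i x) - g x)"
        using elim assms(1) gi fin by (subst Henstock_Kurzweil_Integration.integral_diff)
          (auto simp: Henstock_Kurzweil_Integration.integral_sum subset_iff)
      moreover have "norm (integral {a..b} (\<lambda>x. (\<Sum>i\<in>X. f i x) - g x)) \<le> d * \<bar>b - a\<bar>"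
      proof (cases "a \<le> b")
        case True
        then show ?thesis
          using has_integral_bound_real[OF less_imp_le[OF d] finite.emptyI integrable_integral[OF integrable_diff[OF fin gi]], of X] elim
          by auto
      next
        case False
        then show ?thesis using d by simp
      qed
      moreover have "d * \<bar>b - a\<bar> \<le> d * (1 + \<bar>b - a\<bar>)"
        using d by (intro mult_left_mono) auto
      moreover have "d * (1 + \<bar>b - a\<bar>) = e / 2"
      proof -
        define D where "D = 1 + \<bar>b - a\<bar>"
        have "D > 0" unfolding D_def by linarith
        then show ?thesis unfolding d_def D_def[symmetric] by simp
      qed
      ultimately show ?case using e by (simp add: dist_norm)
    qed
  qed
  then show ?thesis
    using integrable_integral[OF gi] by (simp add: infsumI g_def)
qed

text \<open>Exchange of sum and integral without a uniform majorant. The Eichler integrals need this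
  form because of the inverse square root singularity and the unbounded range of integration. An
  enumeration of \<open>I\<close> by the naturals reduces it to series.\<close>

lemma integral_infsum_lebesgue:
  fixes f :: "'a \<Rightarrow> 'b \<Rightarrow> complex"
  assumes I: "countable I" "infinite I"
    and int: "\<And>i. i \<in> I \<Longrightarrow> integrable M (f i)"
    and abs: "\<And>x. x \<in> space M \<Longrightarrow> (\<lambda>i. norm (f i x)) summable_on I"
    and sum: "(\<lambda>i. \<integral>x. norm (f i x) \<partial>M) summable_on I"
  shows "integrable M (\<lambda>x. \<Sum>\<^sub>\<infinity>i\<in>I. f i x)"
    and "(\<integral>x. (\<Sum>\<^sub>\<infinity>i\<in>I. f i x) \<partial>M) = (\<Sum>\<^sub>\<infinity>i\<in>I. \<integral>x. f i x \<partial>M)"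
proof -
  define e where "e = from_nat_into I"
  have bij: "bij_betw e UNIV I"
    unfolding e_def using bij_betw_from_nat_into[OF I] .
  have eI: "e n \<in> I" for n using bij by (auto simp: bij_betw_def)
  have tr: "g summable_on I \<longleftrightarrow> (\<lambda>n. g (e n)) summable_on UNIV"
    "infsum g I = infsum (\<lambda>n. g (e n)) UNIV" for g :: "'a \<Rightarrow> 'c :: {comm_monoid_add, t2_space}"
    using summable_on_reindex_bij_betw[OF bij] infsum_reindex_bij_betw[OF bij] by metis+
  have toS: "infsum g I = (\<Sum>n. g (e n))" if "(\<lambda>i. norm (g i)) summable_on I" for g :: "'a \<Rightarrow> complex"
    using has_sum_imp_sums[OF has_sum_infsum, of "\<lambda>n. g (e n)"] abs_summable_summable[OF that]
    by (simp add: tr(1)[of g] tr(2)[of g] sums_unique)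
  have s1: "summable (\<lambda>n. norm (f (e n) x))" if "x \<in> space M" for x
    using abs[OF that] tr(1)[of "\<lambda>i. norm (f i x)"] summable_on_imp_summable by auto
  have s2: "summable (\<lambda>n. \<integral>x. norm (f (e n) x) \<partial>M)"
    using sum tr(1)[of "\<lambda>i. \<integral>x. norm (f i x) \<partial>M"] summable_on_imp_summable by auto
  have *: "AE x in M. summable (\<lambda>n. norm (f (e n) x))"
    using s1 by auto
  have eq: "(\<Sum>\<^sub>\<infinity>i\<in>I. f i x) = (\<Sum>n. f (e n) x)" if "x \<in> space M" for x
    using toS[of "\<lambda>i. f i x"] abs[OF that] by simp
  have "integrable M (\<lambda>x. \<Sum>n. f (e n) x)"
    by (rule integrable_suminf[OF int[OF eI] * s2])
  then show "integrable M (\<lambda>x. \<Sum>\<^sub>\<infinity>i\<in>I. f i x)"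
    by (subst Bochner_Integration.integrable_cong[OF refl eq]) auto
  have "(\<lambda>i. norm (\<integral>x. f i x \<partial>M)) summable_on I"
    by (rule Infinite_Sum.abs_summable_on_comparison_test'[OF sum]) simp
  then have "(\<Sum>\<^sub>\<infinity>i\<in>I. \<integral>x. f i x \<partial>M) = (\<Sum>n. \<integral>x. f (e n) x \<partial>M)"
    by (rule toS)
  also have "\<dots> = (\<integral>x. (\<Sum>n. f (e n) x) \<partial>M)"
    by (rule integral_suminf[OF int[OF eI] * s2, symmetric])
  also have "\<dots> = (\<integral>x. (\<Sum>\<^sub>\<infinity>i\<in>I. f i x) \<partial>M)"
    by (rule Bochner_Integration.integral_cong) (auto simp: eq)
  finally show "(\<integral>x. (\<Sum>\<^sub>\<infinity>i\<in>I. f i x) \<partial>M) = (\<Sum>\<^sub>\<infinity>i\<in>I. \<integral>x. f i x \<partial>M)" by simp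
qed

subsection \<open>Lattice sums of weight three\<close>

text \<open>The imaginary part of c w + d bounds c, and then d is recovered as the difference with c
  w. The constant depends on Y and R only, so it is uniform for w in compact sets.\<close>

lemma lattice_lower_bound:
  assumes "0 < Y" "Y \<le> Im w" "norm w \<le> R"
  shows "\<bar>c\<bar> + \<bar>d\<bar> \<le> (1 + (1 + R) / Y) * norm (of_real c * w + of_real d)"
proof -
  let ?z = "of_real c * w + of_real d"
  have "\<bar>c\<bar> * Y \<le> \<bar>c\<bar> * Im w" using assms by (intro mult_left_mono) auto
  also have "\<dots> = \<bar>Im ?z\<bar>" using assms by (simp add: abs_mult)
  also have "\<dots> \<le> norm ?z" by (rule abs_Im_le_cmod)
  finally have c: "\<bar>c\<bar> \<le> norm ?z / Y" using assms by (simp add: field_simps)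
  have R: "0 \<le> R" using assms norm_ge_zero[of w] by linarith
  have "\<bar>d\<bar> = norm (?z - of_real c * w)" by simp
  also have "\<dots> \<le> norm ?z + \<bar>c\<bar> * norm w"
    by (rule order.trans[OF norm_triangle_ineq4]) (simp add: norm_mult)
  also have "\<dots> \<le> norm ?z + norm ?z / Y * R"
    using c assms R by (intro add_left_mono mult_mono) auto
  finally show ?thesis using c by (simp add: distrib_left distrib_right add_divide_distrib mult.commute)
qed

lemma lattice_upper_bound:
  "norm (of_real c * w + of_real d :: complex) \<le> (1 + norm w) * (\<bar>c\<bar> + \<bar>d\<bar>)"
proof -
  have "norm (of_real c * w + of_real d :: complex) \<le> \<bar>c\<bar> * norm w + \<bar>d\<bar>"
    by (rule order.trans[OF norm_triangle_ineq]) (simp add: norm_mult)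
  moreover have "0 \<le> \<bar>c\<bar>" "0 \<le> norm w * \<bar>d\<bar>" by auto
  ultimately show ?thesis unfolding distrib_left distrib_right
    by (simp only: mult.commute[of "\<bar>c\<bar>"] mult_1)
qed

text \<open>This is -1/2 times the derivative of the Weierstrass function of the lattice spanned by
  w and 1. At a lattice point the polar term is 1/0 = 0, so periodicity and oddness hold without
  exceptions.\<close>

definition lattice_cube_sum :: "complex \<Rightarrow> complex \<Rightarrow> complex" where
  "lattice_cube_sum w z = (\<Sum>\<^sub>\<infinity>(m, n)\<in>UNIV. 1 / (z + of_int m * w + of_int n) ^ 3)"

lemma norm_inverse_cube_le:
  fixes z :: complex
  assumes "0 < s" "s \<le> C * norm z"
  shows "norm (1 / z ^ 3) \<le> C ^ 3 * (1 / s ^ 3)"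
proof (cases "z = 0")
  case False
  then have "s ^ 3 \<le> (C * norm z) ^ 3" using assms by (intro power_mono) auto
  then show ?thesis using assms False
    by (simp add: norm_divide norm_power field_simps)
qed (use assms in auto)

text \<open>Only finitely many lattice translates of z0 lie in the unit disc, so those with index in
  \<open>I\<close> keep a positive distance e from 0; far away the lattice bound takes over. The
  index set \<open>I\<close> makes it possible to leave out a vanishing denominator and to treat the
  rest of the series near a pole.\<close>

lemma lattice_local_bound:
  assumes w: "0 < Im w" and z0: "\<And>m n. (m, n) \<in> I \<Longrightarrow> z0 + of_int m * w + of_int n \<noteq> 0"
  obtains r C where "0 < r" "0 < C"
    "\<And>z m n. z \<in> cball z0 r \<Longrightarrow> (m, n) \<in> I \<Longrightarrow>
      1 + \<bar>real_of_int m\<bar> + \<bar>real_of_int n\<bar> \<le> C * norm (z + of_int m * w + of_int n)"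
proof -
  define K where "K = 1 + (1 + norm w) / Im w"
  have K: "K \<ge> 1" using w by (simp add: K_def)
  have low: "\<bar>real_of_int m\<bar> + \<bar>real_of_int n\<bar> \<le> K * norm (of_int m * w + of_int n)" for m n
    using lattice_lower_bound[OF w order.refl order.refl, of m n] by (simp add: K_def)
  define S where "S = {(m, n) \<in> I. norm (z0 + of_int m * w + of_int n) < 1}"
  define k where "k = \<lceil>K * (norm z0 + 1)\<rceil>"
  have "S \<subseteq> {-k..k} \<times> {-k..k}"
  proof safe
    fix m n assume "(m, n) \<in> S"
    then have "norm (z0 + of_int m * w + of_int n) < 1" by (auto simp: S_def)
    moreover have "norm (of_int m * w + of_int n) \<le> norm (z0 + of_int m * w + of_int n) + norm z0"
      using norm_triangle_ineq4[of "z0 + of_int m * w + of_int n" z0] by simp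
    ultimately have "K * norm (of_int m * w + of_int n) \<le> K * (norm z0 + 1)"
      using K by (intro mult_left_mono) auto
    then have "\<bar>real_of_int m\<bar> + \<bar>real_of_int n\<bar> \<le> of_int k"
      using low[of m n] unfolding k_def by linarith
    then have "\<bar>m\<bar> + \<bar>n\<bar> \<le> k" by linarith
    then show "m \<in> {-k..k}" "n \<in> {-k..k}" by auto
  qed
  then have fin: "finite S" by (rule finite_subset) auto
  define e where "e = Min (insert 1 ((\<lambda>(m, n). norm (z0 + of_int m * w + of_int n)) ` S))"
  have e: "0 < e" unfolding e_def using fin z0 by (subst Min_gr_iff) (auto simp: S_def)
  have eS: "e \<le> norm (z0 + of_int m * w + of_int n)" if "(m, n) \<in> I" for m n
  proof (cases "(m, n) \<in> S")
    case True
    then show ?thesis unfolding e_def using fin by (intro Min_le) (auto simp: image_iff)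
  next
    case False
    have "e \<le> 1" unfolding e_def using fin by (intro Min_le) auto
    with False that show ?thesis by (auto simp: S_def)
  qed
  \<comment> \<open>The first summand absorbs the additive constant, since the denominators stay
    above e / 2; the second is the factor of the lattice bound.\<close>
  define C where "C = (1 + K * (norm z0 + e)) / (e / 2) + K"
  have *: "1 + \<bar>real_of_int m\<bar> + \<bar>real_of_int n\<bar> \<le> C * norm (z + of_int m * w + of_int n)"
    if z: "z \<in> cball z0 (e / 2)" and mn: "(m, n) \<in> I" for z m n
  proof -
    let ?x = "z + of_int m * w + of_int n"
    have zz: "norm (z - z0) \<le> e / 2" using z by (simp add: dist_norm norm_minus_commute)
    have "norm (z0 + of_int m * w + of_int n) \<le> norm ?x + norm (z - z0)"
      using norm_triangle_ineq4[of ?x "z - z0"] by (simp add: algebra_simps)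
    then have x: "e / 2 \<le> norm ?x" using eS[OF mn] zz by linarith
    have "norm z \<le> norm z0 + norm (z - z0)"
      using norm_triangle_ineq[of z0 "z - z0"] by simp
    then have nz: "norm z \<le> norm z0 + e" using zz e by linarith
    have "norm (of_int m * w + of_int n) \<le> norm ?x + norm z"
      using norm_triangle_ineq4[of ?x z] by simp
    then have "K * norm (of_int m * w + of_int n) \<le> K * (norm ?x + (norm z0 + e))"
      using K nz by (intro mult_left_mono) auto
    then have "1 + \<bar>real_of_int m\<bar> + \<bar>real_of_int n\<bar> \<le> 1 + K * (norm z0 + e) + K * norm ?x"
      using low[of m n] by (simp add: algebra_simps)
    moreover have "(1 + K * (norm z0 + e)) * 1 \<le> (1 + K * (norm z0 + e)) * (norm ?x / (e / 2))"
      using x e K by (intro mult_left_mono) (auto simp: field_simps)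
    ultimately show ?thesis unfolding C_def by (simp add: algebra_simps)
  qed
  have "C > 0" unfolding C_def using e K by (intro add_nonneg_pos divide_nonneg_pos) auto
  then show thesis
    using e by (intro that[of "e / 2" C] *) auto
qed

lemma lattice_partial_sum_holomorphic:
  assumes w: "0 < Im w" and z0: "\<And>m n. (m, n) \<in> I \<Longrightarrow> z0 + of_int m * w + of_int n \<noteq> 0"
  shows "\<exists>r>0. (\<lambda>z. \<Sum>\<^sub>\<infinity>(m, n)\<in>I. 1 / (z + of_int m * w + of_int n) ^ 3) holomorphic_on ball z0 r"
    and "(\<lambda>(m, n). 1 / (z0 + of_int m * w + of_int n) ^ 3) summable_on I"
proof -
  obtain r C where r: "r > 0" and C: "C > 0"
    and b: "\<And>z m n. z \<in> cball z0 r \<Longrightarrow> (m, n) \<in> I \<Longrightarrow>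
      1 + \<bar>real_of_int m\<bar> + \<bar>real_of_int n\<bar> \<le> C * norm (z + of_int m * w + of_int n)"
    by (rule lattice_local_bound[OF w z0]) (assumption, rule that)
  define M where "M = (\<lambda>(m::int, n::int). C ^ 3 * (1 / (1 + \<bar>real_of_int m\<bar> + \<bar>real_of_int n\<bar>) ^ 3))"
  have M: "M summable_on I"
    using summable_on_subset_banach[OF summable_on_cmult_right[OF summable_on_lattice_cube, of "C ^ 3"], of I]
    by (simp add: M_def case_prod_unfold)
  have le: "norm (case i of (m, n) \<Rightarrow> 1 / (z + of_int m * w + of_int n) ^ 3) \<le> M i"
    if "z \<in> cball z0 r" "i \<in> I" for z i
  proof -
    obtain m n where i: "i = (m, n)" by (cases i)
    show ?thesis unfolding i M_def prod.case
      by (rule norm_inverse_cube_le) (use b that i in auto)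
  qed
  have nz: "z + of_int m * w + of_int n \<noteq> 0" if "z \<in> cball z0 r" "(m, n) \<in> I" for z m n
    using b[OF that] by auto
  show "\<exists>r>0. (\<lambda>z. \<Sum>\<^sub>\<infinity>(m, n)\<in>I. 1 / (z + of_int m * w + of_int n) ^ 3) holomorphic_on ball z0 r"
  proof (intro exI conjI)
    show "(\<lambda>z. \<Sum>\<^sub>\<infinity>(m, n)\<in>I. 1 / (z + of_int m * w + of_int n) ^ 3) holomorphic_on ball z0 r"
    proof (rule holomorphic_on_infsum)
      fix z assume "z \<in> ball z0 r"
      then obtain e where "0 < e" "cball z e \<subseteq> ball z0 r"
        using open_contains_cball[of "ball z0 r"] by (meson open_ball)
      then show "\<exists>e M. 0 < e \<and> cball z e \<subseteq> ball z0 r \<and> M summable_on I \<and>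
           (\<forall>i\<in>I. \<forall>x\<in>cball z e. norm (case i of (m, n) \<Rightarrow> 1 / (x + of_int m * w + of_int n) ^ 3) \<le> M i)"
        using M le by (intro exI[of _ e] exI[of _ M]) (auto simp: subset_iff)
    next
      fix i assume "i \<in> I"
      then show "(\<lambda>z. case i of (m, n) \<Rightarrow> 1 / (z + of_int m * w + of_int n) ^ 3) holomorphic_on ball z0 r"
        using nz by (cases i) (auto intro!: holomorphic_intros)
    qed auto
  qed (rule r)
  show "(\<lambda>(m, n). 1 / (z0 + of_int m * w + of_int n) ^ 3) summable_on I"
    by (rule abs_summable_summable, rule Infinite_Sum.abs_summable_on_comparison_test'[OF M])
       (use le[of z0] r in auto)
qed

lemma lattice_cube_sum_periodic:
  "lattice_cube_sum w (z + of_int a * w + of_int b) = lattice_cube_sum w z"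
  unfolding lattice_cube_sum_def
  by (rule infsum_reindex_bij_witness[of _ "\<lambda>(m, n). (m - a, n - b)" "\<lambda>(m, n). (m + a, n + b)"])
     (auto simp: algebra_simps)

lemma lattice_cube_sum_minus: "lattice_cube_sum w (- z) = - lattice_cube_sum w z"
proof -
  have "lattice_cube_sum w (- z) = (\<Sum>\<^sub>\<infinity>(m, n)\<in>UNIV. - (1 / (z + of_int m * w + of_int n) ^ 3))"
    unfolding lattice_cube_sum_def
  proof (rule infsum_reindex_bij_witness[of _ "\<lambda>(m, n). (- m, - n)" "\<lambda>(m, n). (- m, - n)"], goal_cases)
    case (5 x)
    obtain m n where x: "x = (m, n)" by (cases x)
    have "(- z + of_int m * w + of_int n) ^ 3 = - ((z + of_int (- m) * w + of_int (- n)) ^ 3)"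
      by (simp add: power3_eq_cube algebra_simps)
    then show ?case unfolding x by simp
  qed auto
  then show ?thesis
    by (simp add: lattice_cube_sum_def case_prod_unfold infsum_uminus)
qed

text \<open>Modulo the lattice h and -h coincide, and the sum is odd.\<close>

lemma lattice_cube_sum_half_period:
  assumes "2 * h = of_int a * w + of_int b"
  shows "lattice_cube_sum w h = 0"
proof -
  have "lattice_cube_sum w h = lattice_cube_sum w (- h + of_int a * w + of_int b)"
  proof -
    have "- h + of_int a * w + of_int b = h" using assms by algebra
    then show ?thesis by (simp only:)
  qed
  also have "\<dots> = - lattice_cube_sum w h"
    by (simp only: lattice_cube_sum_periodic lattice_cube_sum_minus)
  finally show ?thesis by simp
qed

text \<open>The term m = n = 0 contributes exactly 1; the remaining series is holomorphic near 0 and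
  is killed by z^3.\<close>

lemma lattice_cube_sum_pole:
  assumes w: "0 < Im w"
  shows "((\<lambda>z. z ^ 3 * lattice_cube_sum w z) \<longlongrightarrow> 1) (at 0)"
proof -
  let ?I = "UNIV - {(0::int, 0::int)}"
  define H where "H = (\<lambda>z. \<Sum>\<^sub>\<infinity>(m, n)\<in>?I. 1 / (z + of_int m * w + of_int n) ^ 3)"
  have nz: "0 + of_int m * w + of_int n \<noteq> 0" if "(m, n) \<in> ?I" for m n :: int
    using that w by (auto simp: complex_eq_iff)
  obtain r C where r: "r > 0" and C: "C > 0"
    and b: "\<And>z m n. z \<in> cball 0 r \<Longrightarrow> (m, n) \<in> ?I \<Longrightarrow>
      1 + \<bar>real_of_int m\<bar> + \<bar>real_of_int n\<bar> \<le> C * norm (z + of_int m * w + of_int n)"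
    by (rule lattice_local_bound[OF w nz]) (assumption, rule that)
  obtain r' where r': "r' > 0" "H holomorphic_on ball 0 r'"
    using lattice_partial_sum_holomorphic(1)[OF w nz] unfolding H_def by blast
  have "isCont H 0"
    using r' holomorphic_on_imp_continuous_on[OF r'(2)] by (simp add: continuous_on_eq_continuous_at)
  then have "((\<lambda>z. z ^ 3 * H z) \<longlongrightarrow> 0 ^ 3 * H 0) (at 0)"
    by (intro tendsto_intros) (simp add: isCont_def)
  then have "((\<lambda>z. 1 + z ^ 3 * H z) \<longlongrightarrow> 1 + 0 ^ 3 * H 0) (at 0)"
    by (rule tendsto_add[OF tendsto_const])
  then have lim: "((\<lambda>z. 1 + z ^ 3 * H z) \<longlongrightarrow> 1) (at 0)" by simp
  have "\<forall>\<^sub>F z in at 0. z \<in> ball 0 r - {0}"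
    using r by (intro eventually_at_in_open) auto
  then have "\<forall>\<^sub>F z in at 0. 1 + z ^ 3 * H z = z ^ 3 * lattice_cube_sum w z"
  proof eventually_elim
    case (elim z)
    have "z + of_int m * w + of_int n \<noteq> 0" if "(m, n) \<in> ?I" for m n
      using b[of z m n] that elim by auto
    then have s: "(\<lambda>(m, n). 1 / (z + of_int m * w + of_int n) ^ 3) summable_on ?I"
      by (rule lattice_partial_sum_holomorphic(2)[OF w])
    have "lattice_cube_sum w z = (\<Sum>\<^sub>\<infinity>(m, n)\<in>insert (0, 0) ?I. 1 / (z + of_int m * w + of_int n) ^ 3)"
      unfolding lattice_cube_sum_def by (simp add: insert_absorb)
    also have "\<dots> = 1 / z ^ 3 + H z"
      using s unfolding H_def by (subst infsum_insert) auto
    finally show ?case using elim by (simp add: field_simps)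
  qed
  with lim show ?thesis by (rule Lim_transform_eventually)
qed


text \<open>Lattice points are included, so that the set is closed under addition and contains the
  poles of all four translates used below.\<close>

definition half_periods :: "complex \<Rightarrow> complex set" where
  "half_periods w = {z. \<exists>a b :: int. 2 * z = of_int a * w + of_int b}"

lemma half_periods_add:
  assumes "h \<in> half_periods w"
  shows "z + h \<in> half_periods w \<longleftrightarrow> z \<in> half_periods w"
proof -
  obtain a b :: int where h: "2 * h = of_int a * w + of_int b"
    using assms by (auto simp: half_periods_def)
  show ?thesis
  proof
    assume "z + h \<in> half_periods w"
    then obtain c d :: int where "2 * (z + h) = of_int c * w + of_int d"
      by (auto simp: half_periods_def)
    with h have "2 * z = of_int (c - a) * w + of_int (d - b)"
      by (simp add: algebra_simps)
    then show "z \<in> half_periods w" unfolding half_periods_def by blast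
  next
    assume "z \<in> half_periods w"
    then obtain c d :: int where "2 * z = of_int c * w + of_int d"
      by (auto simp: half_periods_def)
    with h have "2 * (z + h) = of_int (c + a) * w + of_int (d + b)"
      by (simp add: algebra_simps)
    then show "z + h \<in> half_periods w" unfolding half_periods_def by blast
  qed
qed

lemma half_periods_uminus: "h \<in> half_periods w \<Longrightarrow> - h \<in> half_periods w"
  using half_periods_add[of h w "- h"] by (auto simp: half_periods_def intro: exI[of _ 0])

lemma lattice_cube_sum_holomorphic:
  assumes "0 < Im w" "z0 \<notin> half_periods w"
  shows "\<exists>r>0. lattice_cube_sum w holomorphic_on ball z0 r"
proof -
  have "z0 + of_int m * w + of_int n \<noteq> 0" for m n
  proof
    assume "z0 + of_int m * w + of_int n = 0"
    then have "2 * z0 = of_int (- 2 * m) * w + of_int (- 2 * n)" by (simp add: algebra_simps) algebra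
    with assms(2) show False unfolding half_periods_def by blast
  qed
  from lattice_partial_sum_holomorphic(1)[OF assms(1) this, of UNIV]
  show ?thesis unfolding lattice_cube_sum_def[abs_def] .
qed

text \<open>As a or b is odd, h is not a lattice point; the sum is holomorphic and zero there, and
  its difference quotient converges. Each of the three nontrivial half periods thus supplies one
  factor z against the triple pole.\<close>

lemma lattice_cube_sum_simple_zero:
  assumes w: "0 < Im w" and h: "2 * h = of_int a * w + of_int b" "odd a \<or> odd b"
  shows "\<exists>L. ((\<lambda>z. lattice_cube_sum w (z + h) / z) \<longlongrightarrow> L) (at 0)"
proof -
  have "h + of_int m * w + of_int n \<noteq> 0" for m n
  proof
    assume "h + of_int m * w + of_int n = 0"
    then have "of_int (a + 2 * m) * w + of_int (b + 2 * n) = 0"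
      using h(1) by (simp add: algebra_simps) algebra
    note * = this
    have "Im (of_int (a + 2 * m) * w + of_int (b + 2 * n)) = 0" unfolding * by simp
    then have "of_int (a + 2 * m) * Im w = 0" by simp
    then have am: "a + 2 * m = 0" using w by (metis less_irrefl mult_eq_0_iff of_int_eq_0_iff)
    with * have "of_int (b + 2 * n) = (0::complex)" by simp
    then have "b + 2 * n = 0" by (simp only: of_int_eq_0_iff)
    with am have "a = - 2 * m" "b = - 2 * n" by auto
    then show False using h(2) by auto
  qed
  from lattice_partial_sum_holomorphic(1)[OF w this, of UNIV]
  obtain r where "r > 0" "lattice_cube_sum w holomorphic_on ball h r"
    unfolding lattice_cube_sum_def[abs_def] by blast
  then have "lattice_cube_sum w field_differentiable (at h)"
    by (meson centre_in_ball holomorphic_on_imp_differentiable_at open_ball)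
  then obtain D where "(lattice_cube_sum w has_field_derivative D) (at h)"
    by (auto simp: field_differentiable_def)
  then have "((\<lambda>z. (lattice_cube_sum w (h + z) - lattice_cube_sum w h) / z) \<longlongrightarrow> D) (at 0)"
    by (simp add: DERIV_def)
  then show ?thesis
    using lattice_cube_sum_half_period[OF h(1)] by (auto simp: add.commute)
qed

text \<open>Holomorphic functions on a connected open set have no zero divisors: where the first
  factor is nonzero, an open set, the second vanishes, and the identity theorem spreads
  this.\<close>

lemma holomorphic_mult_eq_0:
  assumes "open U" "connected U" "f holomorphic_on U" "g holomorphic_on U"
    and "\<And>z. z \<in> U \<Longrightarrow> f z * g z = 0"
  shows "(\<forall>z\<in>U. f z = 0) \<or> (\<forall>z\<in>U. g z = 0)"
proof (rule ccontr)
  assume "\<not> ?thesis"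
  then obtain x y where x: "x \<in> U" "f x \<noteq> 0" and y: "y \<in> U" "g y \<noteq> 0" by blast
  have "continuous_on U f" using assms by (intro holomorphic_on_imp_continuous_on)
  then have "open {z \<in> U. f z \<noteq> 0}"
    using continuous_open_preimage[of U f "- {0}"] assms(1) by (simp add: vimage_def Int_def open_Compl)
  moreover have "g z = 0" if "z \<in> {z \<in> U. f z \<noteq> 0}" for z using assms(5)[of z] that by auto
  ultimately have "g y = (\<lambda>_. 0) y"
    using x by (intro analytic_continuation_open[OF _ assms(1) _ assms(2) _ assms(4) _ _ y(1),
      where s = "{z \<in> U. f z \<noteq> 0}"]) auto
  with y show False by simp
qed

text \<open>
  The product of the translates of the lattice sum by the four half periods is constant: its
  triple poles at the half periods are cancelled by three zeros.
\<close>

lemma lattice_cube_sum_nonzero: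
  assumes w: "0 < Im w" and z1: "z1 \<notin> half_periods w"
  shows "lattice_cube_sum w z1 \<noteq> 0"
proof
  assume zero: "lattice_cube_sum w z1 = 0"
  let ?G = "lattice_cube_sum w"
  let ?H = "half_periods w"
  define hp where "hp = (\<lambda>a b. (of_int a * w + of_int b) / 2)"
  have hp: "2 * hp a b = of_int a * w + of_int b" for a b by (simp add: hp_def)
  have hpH: "hp a b \<in> ?H" for a b using hp[of a b] unfolding half_periods_def by blast
  define \<Phi> where "\<Phi> = (\<lambda>z. ?G z * (?G (z + hp 0 1) * (?G (z + hp 1 0) * ?G (z + hp 1 1))))"
  have per: "?G (z + hp (a + 2 * c) (b + 2 * d)) = ?G (z + hp a b)" for z a b c d
  proof -
    have "z + hp (a + 2 * c) (b + 2 * d) = (z + hp a b) + of_int c * w + of_int d"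
      by (simp add: hp_def field_simps)
    then show ?thesis by (simp only: lattice_cube_sum_periodic)
  qed
  have hadd: "(z + hp a b) + hp c d = z + hp (a + c) (b + d)" for z a b c d
    by (simp add: hp_def field_simps)
  have hp0: "hp 0 0 = 0" by (simp add: hp_def)
  \<comment> \<open>A shift by a half period permutes the four factors up to lattice
    periods.\<close>
  have \<Phi>01: "\<Phi> (z + hp 0 1) = \<Phi> z" for z
    using per[of z 0 0 0 1] per[of z 1 0 0 1] unfolding \<Phi>_def by (simp add: hadd hp0 mult_ac)
  have \<Phi>10: "\<Phi> (z + hp 1 0) = \<Phi> z" for z
    using per[of z 0 1 0 0] per[of z 0 0 1 0] per[of z 0 1 1 0] unfolding \<Phi>_def by (simp add: hadd hp0 mult_ac)
  have \<Phi>int: "\<Phi> (z + hp a b) = \<Phi> z" for z a b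
  proof -
    have 1: "\<Phi> (z + hp 0 (int n)) = \<Phi> z" for z n
    proof (induction n arbitrary: z)
      case (Suc n)
      have "z + hp 0 (int (Suc n)) = (z + hp 0 (int n)) + hp 0 1" by (simp add: hp_def field_simps)
      then show ?case by (simp only: \<Phi>01 Suc)
    qed (simp add: hp0)
    have 2: "\<Phi> (z + hp (int n) 0) = \<Phi> z" for z n
    proof (induction n arbitrary: z)
      case (Suc n)
      have "z + hp (int (Suc n)) 0 = (z + hp (int n) 0) + hp 1 0" by (simp add: hp_def field_simps)
      then show ?case by (simp only: \<Phi>10 Suc)
    qed (simp add: hp0)
    have 3: "\<Phi> (z + hp 0 b) = \<Phi> z" for z
      using 1[of z "nat b"] 1[of "z + hp 0 b" "nat (- b)"] by (cases "0 \<le> b") (auto simp: hadd hp0)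
    have 4: "\<Phi> (z + hp a 0) = \<Phi> z" for z
      using 2[of z "nat a"] 2[of "z + hp a 0" "nat (- a)"] by (cases "0 \<le> a") (auto simp: hadd hp0)
    have "\<Phi> (z + hp a b) = \<Phi> ((z + hp a 0) + hp 0 b)" by (simp add: hadd)
    then show ?thesis by (simp only: 3 4)
  qed
  have \<Phi>H: "\<Phi> (z + h) = \<Phi> z" if "h \<in> ?H" for z h
  proof -
    obtain a b :: int where "2 * h = of_int a * w + of_int b" using \<open>h \<in> ?H\<close> by (auto simp: half_periods_def)
    then have "h = hp a b" by (simp add: hp_def field_simps)
    then show ?thesis by (simp add: \<Phi>int)
  qed
  have holG: "\<exists>r>0. ?G holomorphic_on ball z r" if "z \<notin> ?H" for z
    using lattice_cube_sum_holomorphic[OF w that] .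
  \<comment> \<open>Removing a countable set leaves the plane path connected, which the identity
    theorem at the end requires.\<close>
  have "countable (range (\<lambda>(a, b). hp a b))" by (rule countable_image) auto
  moreover have "?H \<subseteq> range (\<lambda>(a, b). hp a b)"
  proof
    fix h assume "h \<in> ?H"
    then obtain a b :: int where "2 * h = of_int a * w + of_int b" by (auto simp: half_periods_def)
    then have "h = hp a b" by (simp add: hp_def field_simps)
    then show "h \<in> range (\<lambda>(a, b). hp a b)" by auto
  qed
  ultimately have "countable ?H" by (rule countable_subset[rotated])
  then have conn: "connected (- ?H)"
    by (intro path_connected_imp_connected path_connected_complement_countable) auto
  \<comment> \<open>A half period x has 2 x = m w + n, so the denominator at -2 x with index (m, n)
    is 0. The local bound around -2 z forbids this for every (m, n) whose denominator at -2 z is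
    nonzero, which leaves only x = z.\<close>
  have isol: "\<exists>r>0. ball z r \<inter> ?H \<subseteq> {z}" for z
  proof -
    define I where "I = {(m :: int, n :: int). 2 * (- z) + of_int m * w + of_int n \<noteq> 0}"
    obtain r C where r: "0 < r" "0 < C" and b:
      "\<And>x m n. x \<in> cball (2 * (- z)) r \<Longrightarrow> (m, n) \<in> I \<Longrightarrow>
        1 + \<bar>real_of_int m\<bar> + \<bar>real_of_int n\<bar> \<le> C * norm (x + of_int m * w + of_int n)"
      by (rule lattice_local_bound[OF w, of I "2 * (- z)"]) (auto simp: I_def)
    have "x = z" if that1: "x \<in> ball z (r / 2)" "x \<in> ?H" for x
    proof (rule ccontr)
      assume "x \<noteq> z"
      obtain m n :: int where mn: "2 * x = of_int m * w + of_int n"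
        using that1 by (auto simp: half_periods_def)
      then have "(m, n) \<in> I" using \<open>x \<noteq> z\<close> by (auto simp: I_def algebra_simps)
      moreover have "dist (2 * (- z)) (2 * (- x)) = 2 * dist z x"
      proof -
        have "2 * (- z) - 2 * (- x) = 2 * (x - z)" by simp
        then show ?thesis
          unfolding dist_norm by (simp only: norm_mult norm_minus_commute[of z x]) simp
      qed
      then have "2 * (- x) \<in> cball (2 * (- z)) r" using that1 by simp
      ultimately show False using b[of "2 * (- x)" m n] mn by (simp add: algebra_simps)
    qed
    then show ?thesis using r by (intro exI[of _ "r / 2"]) auto
  qed
  have op: "open (- ?H)"
  proof (rule openI)
    fix z assume "z \<in> - ?H"
    then show "\<exists>r>0. ball z r \<subseteq> - ?H" using isol[of z] by blast
  qed
  have G_U: "(\<lambda>z. ?G (z + h)) holomorphic_on - ?H" if "h \<in> ?H" for h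
  proof -
    have "?G holomorphic_on - ?H"
      unfolding holomorphic_on_open[OF op]
    proof
      fix x assume "x \<in> - ?H"
      then obtain r where "r > 0" "?G holomorphic_on ball x r" using holG by auto
      then show "\<exists>f'. (?G has_field_derivative f') (at x)"
        by (auto simp: holomorphic_on_open)
    qed
    moreover have "(\<lambda>z. z + h) ` (- ?H) \<subseteq> - ?H" using half_periods_add[OF that] by auto
    ultimately have "(?G \<circ> (\<lambda>z. z + h)) holomorphic_on - ?H"
      by (intro holomorphic_on_compose_gen[of _ _ _ "- ?H"]) (auto intro!: holomorphic_intros)
    then show ?thesis by (simp add: o_def)
  qed
  have "0 \<in> ?H" using hpH[of 0 0] hp0 by simp
  from G_U[OF this] have G_U0: "?G holomorphic_on - ?H" by simp
  note hol = G_U0 G_U[OF hpH]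
  have \<Phi>hol: "\<Phi> holomorphic_on - ?H"
    unfolding \<Phi>_def by (intro holomorphic_intros hol)
  obtain L1 L2 L3 where L:
    "((\<lambda>z. ?G (z + hp 0 1) / z) \<longlongrightarrow> L1) (at 0)" "((\<lambda>z. ?G (z + hp 1 0) / z) \<longlongrightarrow> L2) (at 0)"
    "((\<lambda>z. ?G (z + hp 1 1) / z) \<longlongrightarrow> L3) (at 0)"
    using lattice_cube_sum_simple_zero[OF w hp, of 0 1] lattice_cube_sum_simple_zero[OF w hp, of 1 0]
      lattice_cube_sum_simple_zero[OF w hp, of 1 1] by auto
  define L where "L = 1 * (L1 * (L2 * L3))"
  have "((\<lambda>z. (z ^ 3 * ?G z) * (?G (z + hp 0 1) / z * (?G (z + hp 1 0) / z * (?G (z + hp 1 1) / z)))) \<longlongrightarrow> L) (at 0)"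
    unfolding L_def by (intro tendsto_mult L lattice_cube_sum_pole w)
  moreover have "\<forall>\<^sub>F z in at 0. (z ^ 3 * ?G z) * (?G (z + hp 0 1) / z * (?G (z + hp 1 0) / z * (?G (z + hp 1 1) / z))) = \<Phi> z"
    unfolding eventually_at_filter \<Phi>_def
    by (rule always_eventually) (simp add: power3_eq_cube)
  ultimately have lim0: "(\<Phi> \<longlongrightarrow> L) (at 0)" by (rule Lim_transform_eventually)
  \<comment> \<open>One value serves at all half periods because \<Phi> is invariant under them;
    removing the singularity at 0 therefore removes all of them.\<close>
  define \<Psi> where "\<Psi> = (\<lambda>z. if z \<in> ?H then L else \<Phi> z)"
  have \<Psi>H: "\<Psi> (z + h) = \<Psi> z" if "h \<in> ?H" for z h
    using half_periods_add[OF that] \<Phi>H[OF that] by (auto simp: \<Psi>_def)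
  obtain r0 where r0: "r0 > 0" "ball 0 r0 \<inter> ?H \<subseteq> {0}" using isol by blast
  have \<Psi>_out: "\<Psi> holomorphic_on - ?H"
    using \<Phi>hol by (rule holomorphic_transform) (auto simp: \<Psi>_def)
  have \<Psi>_ball: "\<Psi> holomorphic_on ball 0 r0"
  proof (rule no_isolated_singularity[where K = "{0}"])
    show *: "\<Psi> holomorphic_on ball 0 r0 - {0}"
      by (rule holomorphic_on_subset[OF \<Psi>_out]) (use r0 in auto)
    have "isCont \<Psi> 0"
    proof -
      have "\<forall>\<^sub>F z in at 0. z \<in> ball 0 r0 - {0}"
        using r0 by (intro eventually_at_in_open) auto
      then have "\<forall>\<^sub>F z in at 0. \<Phi> z = \<Psi> z"
        by eventually_elim (use r0 in \<open>auto simp: \<Psi>_def\<close>)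
      then have "(\<Psi> \<longlongrightarrow> L) (at 0)" by (rule Lim_transform_eventually[OF lim0])
      then show ?thesis using \<open>0 \<in> ?H\<close> by (simp add: isCont_def \<Psi>_def)
    qed
    have "open (ball 0 r0 - {0 :: complex})" by (intro open_delete open_ball)
    then have "\<forall>z\<in>ball 0 r0 - {0}. isCont \<Psi> z"
      using holomorphic_on_imp_continuous_on[OF *] by (simp only: continuous_on_eq_continuous_at)
    with \<open>isCont \<Psi> 0\<close> have "isCont \<Psi> z" if "z \<in> ball 0 r0" for z
      using that by (cases "z = 0") (simp_all only:, blast)
    then show "continuous_on (ball 0 r0) \<Psi>"
      by (intro continuous_at_imp_continuous_on ballI)
  qed auto
  have entire: "\<Psi> holomorphic_on UNIV"
    unfolding holomorphic_on_open[OF open_UNIV]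
  proof
    fix z :: complex
    show "\<exists>f'. (\<Psi> has_field_derivative f') (at z)"
    proof (cases "z \<in> ?H")
      case True
      obtain D where D: "(\<Psi> has_field_derivative D) (at 0)"
        using holomorphic_on_imp_differentiable_at[OF \<Psi>_ball open_ball] r0(1)
        by (metis centre_in_ball field_differentiable_def)
      have "((\<lambda>x. \<Psi> (x + - z)) has_field_derivative D) (at z)"
        using DERIV_shift[of \<Psi> D z "- z"] D by simp
      moreover have "\<Psi> (x + - z) = \<Psi> x" for x by (rule \<Psi>H[OF half_periods_uminus[OF True]])
      ultimately show ?thesis by auto
    next
      case False
      then show ?thesis using \<Psi>_out holomorphic_on_open[OF op] by auto
    qed
  qed
  have "bounded (range \<Psi>)"
  proof -
    let ?K = "(\<lambda>(x, y). of_real x * w + of_real y) ` ({0..1} \<times> {0..1::real})"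
    have "compact ?K"
      by (intro compact_continuous_image compact_Times)
         (auto intro!: continuous_intros simp: case_prod_unfold)
    then have "compact (\<Psi> ` ?K)"
      by (rule compact_continuous_image[OF continuous_on_subset[OF holomorphic_on_imp_continuous_on[OF entire] subset_UNIV]])
    moreover have "range \<Psi> \<subseteq> \<Psi> ` ?K"
    proof safe
      fix z :: complex
      define x where "x = Im z / Im w"
      define y where "y = Re z - x * Re w"
      have z: "z = of_real x * w + of_real y"
        using w by (simp add: complex_eq_iff x_def y_def)
      \<comment> \<open>The factors 2 make the shift a genuine lattice vector, moving z into the
        closed fundamental parallelogram.\<close>
      define z' where "z' = z + hp (- 2 * \<lfloor>x\<rfloor>) (- 2 * \<lfloor>y\<rfloor>)"
      have "z' = of_real (frac x) * w + of_real (frac y)"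
        unfolding z'_def hp_def z frac_def by (simp add: field_simps)
      then have "z' \<in> ?K"
        by (intro image_eqI[of _ _ "(frac x, frac y)"]) (auto simp: frac_ge_0 less_imp_le[OF frac_lt_1])
      moreover have "\<Psi> z' = \<Psi> z" unfolding z'_def by (rule \<Psi>H[OF hpH])
      ultimately show "\<Psi> z \<in> \<Psi> ` ?K" by (metis image_eqI)
    qed
    ultimately show ?thesis by (meson bounded_subset compact_imp_bounded)
  qed
  then have "\<Psi> constant_on UNIV"
    by (rule Liouville_theorem[OF entire])
  then obtain c where c: "\<And>z. \<Psi> z = c" by (auto simp: constant_on_def)
  \<comment> \<open>A zero at z1 makes the constant 0. Then one of the four translates, hence the
    lattice sum itself, vanishes off the half periods, in conflict with the pole at 0.\<close>
  have "\<Psi> z1 = 0" using z1 zero by (simp add: \<Psi>_def \<Phi>_def)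
  with c have c: "\<Psi> z = 0" for z by simp
  have "\<Phi> z = 0" if "z \<in> - ?H" for z using that c[of z] by (simp add: \<Psi>_def)
  then have "(\<forall>z\<in>-?H. ?G z = 0) \<or>
      (\<forall>z\<in>-?H. ?G (z + hp 0 1) * (?G (z + hp 1 0) * ?G (z + hp 1 1)) = 0)"
    unfolding \<Phi>_def by (intro holomorphic_mult_eq_0[OF op conn] holomorphic_intros hol)
  moreover have "(\<forall>z\<in>-?H. ?G (z + hp 0 1) * (?G (z + hp 1 0) * ?G (z + hp 1 1)) = 0) \<Longrightarrow>
     (\<forall>z\<in>-?H. ?G (z + hp 0 1) = 0) \<or> (\<forall>z\<in>-?H. ?G (z + hp 1 0) * ?G (z + hp 1 1) = 0)"
    by (intro holomorphic_mult_eq_0[OF op conn] holomorphic_intros hol) blast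
  moreover have "(\<forall>z\<in>-?H. ?G (z + hp 1 0) * ?G (z + hp 1 1) = 0) \<Longrightarrow>
     (\<forall>z\<in>-?H. ?G (z + hp 1 0) = 0) \<or> (\<forall>z\<in>-?H. ?G (z + hp 1 1) = 0)"
    by (intro holomorphic_mult_eq_0[OF op conn] holomorphic_intros hol) blast
  ultimately have "(\<forall>z\<in>-?H. ?G (z + 0) = 0) \<or> (\<forall>z\<in>-?H. ?G (z + hp 0 1) = 0) \<or>
     (\<forall>z\<in>-?H. ?G (z + hp 1 0) = 0) \<or> (\<forall>z\<in>-?H. ?G (z + hp 1 1) = 0)"
    unfolding add_0_right by blast
  then obtain h where h: "h \<in> ?H" "\<forall>z\<in>-?H. ?G (z + h) = 0"
    using hpH \<open>0 \<in> ?H\<close> by blast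
  have G0: "?G z = 0" if "z \<in> - ?H" for z
    using h(2)[rule_format, of "z + - h"] half_periods_add[OF half_periods_uminus[OF h(1)], of z] that
    by simp
  have "\<forall>\<^sub>F z in at 0. z \<in> ball 0 r0 - {0}"
    using r0 by (intro eventually_at_in_open) auto
  then have "\<forall>\<^sub>F z in at 0. z ^ 3 * ?G z = 0"
  proof eventually_elim
    case (elim z)
    then have "z \<in> - ?H" using r0 by auto
    then show ?case by (simp add: G0)
  qed
  then have "((\<lambda>_. 0) \<longlongrightarrow> (1::complex)) (at (0::complex))"
    by (rule Lim_transform_eventually[OF lattice_cube_sum_pole[OF w]])
  then have "(1::complex) = 0"
    by (rule tendsto_unique[OF _ _ tendsto_const, rotated]) simp
  then show False by simp
qed

text \<open>The point 1/4 is no half period, so the value never vanishes; and a matrix with c = 0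
  and d = 1 modulo 4 fixes it modulo the lattice, which makes the value a modular form in w.\<close>

definition quarter_cube_sum :: "complex \<Rightarrow> complex" where
  "quarter_cube_sum w = lattice_cube_sum w (1 / 4)"

lemma quarter_cube_sum_nonzero:
  assumes "0 < Im w"
  shows "quarter_cube_sum w \<noteq> 0"
proof -
  have "1 / 4 \<notin> half_periods w"
  proof
    assume "1 / 4 \<in> half_periods w"
    then obtain a b :: int where ab: "2 * (1 / 4) = of_int a * w + of_int b"
      by (auto simp: half_periods_def)
    have "Im (2 * (1 / 4)) = Im (of_int a * w + of_int b)" unfolding ab ..
    then have "a = 0" using assms by simp
    with ab have "of_int b * 2 = (1 :: complex)" by simp
    then have "of_int (b * 2) = (of_int 1 :: complex)" by simp
    then have "b * 2 = 1" by (simp only: of_int_eq_iff)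
    then show False by presburger
  qed
  then show ?thesis
    unfolding quarter_cube_sum_def by (rule lattice_cube_sum_nonzero[OF assms])
qed

section \<open>Moebius transformations and the form of weight three\<close>

lemma moebius_denom_nonzero:
  assumes "0 < Im \<tau>" "c \<noteq> 0 \<or> d \<noteq> 0"
  shows "of_int c * \<tau> + of_int d \<noteq> 0"
proof
  assume *: "of_int c * \<tau> + of_int d = 0"
  have "Im (of_int c * \<tau> + of_int d) = 0" unfolding * by simp
  then have "c = 0" using assms by simp
  with * assms show False by simp
qed

lemma Im_moebius:
  assumes "a * d - b * c = 1" "0 < Im \<tau>"
  shows "Im (moebius a b c d \<tau>) = Im \<tau> / (norm (of_int c * \<tau> + of_int d))\<^sup>2"
    and "0 < Im (moebius a b c d \<tau>)"
proof -
  let ?D = "of_int c * \<tau> + of_int d"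
  have "c \<noteq> 0 \<or> d \<noteq> 0" using assms(1) by auto
  then have D: "?D \<noteq> 0" by (rule moebius_denom_nonzero[OF assms(2)])
  have "Im ((of_int a * \<tau> + of_int b) * cnj ?D) = Im \<tau> * of_int (a * d - b * c)"
    by (simp add: algebra_simps)
  moreover have "moebius a b c d \<tau> = ((of_int a * \<tau> + of_int b) * cnj ?D) / of_real ((norm ?D)\<^sup>2)"
    unfolding moebius_def by (rule complex_div_cnj[unfolded of_real_power[symmetric]])
  ultimately show *: "Im (moebius a b c d \<tau>) = Im \<tau> / (norm ?D)\<^sup>2"
    using assms(1) by (simp only: Im_divide_of_real mult_1_right of_int_1)
  show "0 < Im (moebius a b c d \<tau>)"
    unfolding * using D assms(2) by simp
qed

lemma moebius_compose:
  assumes "0 < Im \<tau>" "a' * d' - b' * c' = 1"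
  shows "of_int c * moebius a' b' c' d' \<tau> + of_int d
           = (of_int (c * a' + d * c') * \<tau> + of_int (c * b' + d * d')) / (of_int c' * \<tau> + of_int d')"
    and "moebius a b c d (moebius a' b' c' d' \<tau>)
           = moebius (a * a' + b * c') (a * b' + b * d') (c * a' + d * c') (c * b' + d * d') \<tau>"
proof -
  have "c' \<noteq> 0 \<or> d' \<noteq> 0" using assms(2) by auto
  then have D: "of_int c' * \<tau> + of_int d' \<noteq> 0" by (rule moebius_denom_nonzero[OF assms(1)])
  then show 1: "of_int c * moebius a' b' c' d' \<tau> + of_int d
           = (of_int (c * a' + d * c') * \<tau> + of_int (c * b' + d * d')) / (of_int c' * \<tau> + of_int d')" for c d
    by (simp add: moebius_def field_simps)
  show "moebius a b c d (moebius a' b' c' d' \<tau>)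
           = moebius (a * a' + b * c') (a * b' + b * d') (c * a' + d * c') (c * b' + d * d') \<tau>"
    unfolding moebius_def[of a b c d] 1 using D by (simp add: moebius_def)
qed

text \<open>With c = 4 k and d = 4 l + 1, multiplying a denominator by c w + d turns 1/4 into 1/4 +
  k w + l. The index (m, n) is thus mapped by the matrix and then translated by (k, l), a bijection
  of the lattice.\<close>

lemma quarter_cube_sum_moebius:
  assumes "0 < Im w" "a * d - b * c = 1" "[c = 0] (mod 4)" "[d = 1] (mod 4)"
  shows "quarter_cube_sum (moebius a b c d w) = (of_int c * w + of_int d) ^ 3 * quarter_cube_sum w"
proof -
  have "4 dvd c" "4 dvd d - 1" using assms(3,4) by (simp_all add: cong_0_iff cong_iff_dvd_diff)
  then obtain k l where k: "c = 4 * k" and l': "d - 1 = 4 * l" by (auto elim!: dvdE)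
  then have l: "d = 4 * l + 1" by simp
  let ?D = "of_int c * w + of_int d"
  have "c \<noteq> 0 \<or> d \<noteq> 0" using assms(2) by auto
  then have D: "?D \<noteq> 0" by (rule moebius_denom_nonzero[OF assms(1)])
  have det: "d * a - c * b = 1" using assms(2) by (simp add: algebra_simps)
  have "quarter_cube_sum (moebius a b c d w) =
      (\<Sum>\<^sub>\<infinity>(m, n)\<in>UNIV. ?D ^ 3 * (1 / (1 / 4 + of_int m * w + of_int n) ^ 3))"
    unfolding quarter_cube_sum_def lattice_cube_sum_def
  proof (rule infsum_reindex_bij_witness[of _
      "\<lambda>(m, n). (d * (m - k) - c * (n - l), a * (n - l) - b * (m - k))"
      "\<lambda>(m, n). (m * a + n * c + k, m * b + n * d + l)"], goal_cases)
    case (1 x)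
    obtain m n where x: "x = (m, n)" by (cases x)
    have "d * (m * a + n * c) - c * (m * b + n * d) = (d * a - c * b) * m"
      "a * (m * b + n * d) - b * (m * a + n * c) = (d * a - c * b) * n" by (simp_all add: algebra_simps)
    then show ?case unfolding x by (simp add: det)
  next
    case (3 x)
    obtain m n where x: "x = (m, n)" by (cases x)
    have "(d * (m - k) - c * (n - l)) * a + (a * (n - l) - b * (m - k)) * c = (d * a - c * b) * (m - k)"
      "(d * (m - k) - c * (n - l)) * b + (a * (n - l) - b * (m - k)) * d = (d * a - c * b) * (n - l)"
      by (simp_all add: algebra_simps)
    then show ?case unfolding x by (simp add: det)
  next
    case (5 x)
    obtain m n where x: "x = (m, n)" by (cases x)
    have "1 / 4 + of_int m * moebius a b c d w + of_int n =
      (1 / 4 + of_int (m * a + n * c + k) * w + of_int (m * b + n * d + l)) / ?D"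
    proof -
      have "1 / 4 + of_int (m * a + n * c + k) * w + of_int (m * b + n * d + l)
          = ?D / 4 + of_int m * (of_int a * w + of_int b) + of_int n * ?D"
        by (simp add: k l algebra_simps add_divide_distrib)
      moreover have "1 / 4 + x * (X / D) + y = (D / 4 + x * X + y * D) / D"
        if "D \<noteq> 0" for x X y D :: complex using that by (simp add: field_simps)
      ultimately show ?thesis using D by (simp only: moebius_def)
    qed
    then show ?case unfolding x using D by (simp add: power_divide)
  qed auto
  also have "\<dots> = ?D ^ 3 * quarter_cube_sum w"
    unfolding quarter_cube_sum_def lattice_cube_sum_def
    by (subst infsum_cmult_right'[symmetric]) (simp add: case_prod_unfold)
  finally show ?thesis .
qed

lemma quarter_bound:
  assumes "0 < Y" "Y \<le> Im w" "norm w \<le> R"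
  shows "1 + \<bar>real_of_int m\<bar> + \<bar>real_of_int n\<bar>
           \<le> 8 * (1 + (1 + R) / Y) * norm (1 / 4 + of_int m * w + of_int n)"
proof -
  let ?K = "1 + (1 + R) / Y" and ?N = "norm (1 / 4 + of_int m * w + of_int n)"
  have "of_real (of_int m) * w + of_real (of_int n + 1/4) = 1 / 4 + of_int m * w + of_int n"
    by simp
  with lattice_lower_bound[OF assms, of "of_int m" "of_int n + 1/4"]
  have "\<bar>real_of_int m\<bar> + \<bar>real_of_int n + 1/4\<bar> \<le> ?K * ?N" by (simp only:)
  \<comment> \<open>The shift keeps n + 1/4 at distance at least 1/4 from 0, so the additive 1 is
    absorbed by the factor 8.\<close>
  moreover have "1 + \<bar>real_of_int n\<bar> \<le> 8 * \<bar>real_of_int n + 1/4\<bar>"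
    by (cases "n = 0"; cases "n \<ge> 0") auto
  moreover have "1 + \<bar>real_of_int m\<bar> + \<bar>real_of_int n\<bar> \<le> 8 * (\<bar>real_of_int m\<bar> + \<bar>real_of_int n + 1/4\<bar>)"
    using calculation(2) by simp
  ultimately have "1 + \<bar>real_of_int m\<bar> + \<bar>real_of_int n\<bar> \<le> 8 * (?K * ?N)"
    by (meson mult_left_mono order.trans zero_le_numeral)
  then show ?thesis by (simp only: mult.assoc)
qed

lemma quarter_cube_sum_holomorphic:
  "quarter_cube_sum holomorphic_on upper_half_plane"
  unfolding quarter_cube_sum_def[abs_def] lattice_cube_sum_def
proof (rule holomorphic_on_infsum)
  show "open upper_half_plane" by (rule open_halfspace_Im_gt)
  fix z assume "z \<in> upper_half_plane"
  then have z: "0 < Im z" by simp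
  define r where "r = Im z / 2"
  define C where "C = 8 * (1 + (1 + (norm z + r)) / (Im z / 2))"
  have zr: "Im z / 2 \<le> Im x" "norm x \<le> norm z + r" if "x \<in> cball z r" for x
  proof -
    have "norm (x - z) \<le> r" using that by (simp add: dist_norm norm_minus_commute)
    moreover have "\<bar>Im (x - z)\<bar> \<le> norm (x - z)" by (rule abs_Im_le_cmod)
    moreover have "norm x \<le> norm z + norm (x - z)" using norm_triangle_ineq[of z "x - z"] by simp
    ultimately show "Im z / 2 \<le> Im x" "norm x \<le> norm z + r" by (auto simp: r_def)
  qed
  have le: "norm (case i of (m, n) \<Rightarrow> 1 / (1 / 4 + of_int m * x + of_int n) ^ 3)
     \<le> (case i of (m, n) \<Rightarrow> C ^ 3 * (1 / (1 + \<bar>real_of_int m\<bar> + \<bar>real_of_int n\<bar>) ^ 3))"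
    if "x \<in> cball z r" for x and i :: "int \<times> int"
  proof -
    obtain m n where i: "i = (m, n)" by (cases i)
    have "1 + \<bar>real_of_int m\<bar> + \<bar>real_of_int n\<bar> \<le> C * norm (1 / 4 + of_int m * x + of_int n)"
      unfolding C_def by (rule quarter_bound) (use zr[OF that] z in auto)
    then show ?thesis unfolding i prod.case by (intro norm_inverse_cube_le) auto
  qed
  show "\<exists>r M. 0 < r \<and> cball z r \<subseteq> upper_half_plane \<and> M summable_on UNIV \<and>
        (\<forall>i\<in>UNIV. \<forall>x\<in>cball z r.
          norm (case i of (m :: int, n :: int) \<Rightarrow> 1 / (1 / 4 + of_int m * x + of_int n) ^ 3) \<le> M i)"
  proof (intro exI conjI ballI)
    show "0 < r" using z by (simp add: r_def)
    show "cball z r \<subseteq> upper_half_plane" using zr(1) z by force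
    show "(\<lambda>(m, n). C ^ 3 * (1 / (1 + \<bar>real_of_int m\<bar> + \<bar>real_of_int n\<bar>) ^ 3)) summable_on UNIV"
      using summable_on_cmult_right[OF summable_on_lattice_cube, of "C ^ 3"]
      by (simp add: case_prod_unfold)
  qed (rule le)
next
  fix i :: "int \<times> int"
  obtain m n where i: "i = (m, n)" by (cases i)
  have "1 / 4 + of_int m * x + of_int n \<noteq> 0" if "0 < Im x" for x
    using quarter_bound[OF that order.refl order.refl, of m n] by auto
  then show "(\<lambda>x. case i of (m, n) \<Rightarrow> 1 / (1 / 4 + of_int m * x + of_int n) ^ 3) holomorphic_on upper_half_plane"
    unfolding i prod.case by (auto intro!: holomorphic_intros)
qed

text \<open>The value at the cusp, kept as a double sum so that it is literally the termwise limit.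
  By the cotangent expansion it equals 2 pi^3.\<close>

definition quarter_cube_limit :: complex where
  "quarter_cube_limit = (\<Sum>\<^sub>\<infinity>(m::int, n::int)\<in>UNIV. if m = 0 then 1 / (1 / 4 + of_int n) ^ 3 else 0)"

text \<open>Moving up vertically does not decrease any denominator, so a majorant at t = 0 is a
  majorant for the whole ray.\<close>

lemma norm_denom_shift_ge:
  assumes "0 < Im \<tau>" "0 \<le> t"
  shows "norm (of_real c * \<tau> + of_real d) \<le> norm (of_real c * (\<tau> + \<i> * of_real t) + of_real d)"
proof -
  have "(c * Im \<tau>)\<^sup>2 \<le> (c * (Im \<tau> + t))\<^sup>2"
    unfolding power_mult_distrib using assms by (intro mult_left_mono power_mono) auto
  then show ?thesis unfolding cmod_def by (simp add: algebra_simps)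
qed

lemma norm_denom_shift_at_top:
  assumes "c \<noteq> 0"
  shows "filterlim (\<lambda>t. norm (of_real c * (\<tau> + \<i> * of_real t) + of_real d)) at_top at_top"
proof (rule filterlim_at_top_mono)
  show "filterlim (\<lambda>t. \<bar>c\<bar> * t + - \<bar>c\<bar> * \<bar>Im \<tau>\<bar>) at_top at_top"
    using assms by real_asymp
  show "\<forall>\<^sub>F t in at_top. \<bar>c\<bar> * t + - \<bar>c\<bar> * \<bar>Im \<tau>\<bar> \<le> norm (of_real c * (\<tau> + \<i> * of_real t) + of_real d)"
  proof (rule always_eventually, rule allI)
    fix t
    have "\<bar>c\<bar> * t - \<bar>c\<bar> * \<bar>Im \<tau>\<bar> \<le> \<bar>c\<bar> * \<bar>Im \<tau> + t\<bar>"
      unfolding right_diff_distrib[symmetric] by (intro mult_left_mono) auto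
    also have "\<dots> = \<bar>Im (of_real c * (\<tau> + \<i> * of_real t) + of_real d)\<bar>"
      by (simp add: abs_mult)
    also have "\<dots> \<le> norm (of_real c * (\<tau> + \<i> * of_real t) + of_real d)" by (rule abs_Im_le_cmod)
    finally show "\<bar>c\<bar> * t + - \<bar>c\<bar> * \<bar>Im \<tau>\<bar> \<le> norm (of_real c * (\<tau> + \<i> * of_real t) + of_real d)" by simp
  qed
qed

lemma tendsto_inverse_power_at_top:
  fixes f :: "real \<Rightarrow> complex"
  assumes "filterlim (\<lambda>t. norm (f t)) at_top at_top" "0 < k"
  shows "((\<lambda>t. 1 / f t ^ k) \<longlongrightarrow> 0) at_top"
proof (rule tendsto_norm_zero_cancel)
  have "filterlim (\<lambda>t. norm (f t) ^ k) at_top at_top"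
    by (rule filterlim_pow_at_top[OF assms(2,1)])
  then have "((\<lambda>t. inverse (norm (f t) ^ k)) \<longlongrightarrow> 0) at_top"
    by (rule tendsto_inverse_0_at_top)
  then show "((\<lambda>t. norm (1 / f t ^ k)) \<longlongrightarrow> 0) at_top"
    by (simp add: norm_divide norm_power divide_inverse norm_inverse)
qed

lemma quarter_cube_sum_tendsto:
  assumes "0 < Im \<tau>"
  shows "((\<lambda>t. quarter_cube_sum (\<tau> + \<i> * of_real t)) \<longlongrightarrow> quarter_cube_limit) at_top"
  unfolding quarter_cube_sum_def lattice_cube_sum_def quarter_cube_limit_def
proof (rule tendsto_infsum)
  let ?C = "8 * (1 + (1 + norm \<tau>) / Im \<tau>)"
  show "(\<lambda>(m, n). ?C ^ 3 * (1 / (1 + \<bar>real_of_int m\<bar> + \<bar>real_of_int n\<bar>) ^ 3)) summable_on UNIV"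
    using summable_on_cmult_right[OF summable_on_lattice_cube, of "?C ^ 3"]
    by (simp add: case_prod_unfold)
  show "\<forall>\<^sub>F t in at_top. t \<in> {0::real..}" using eventually_ge_at_top[of 0] by simp
  fix i :: "int \<times> int"
  obtain m n where i: "i = (m, n)" by (cases i)
  have eq: "1 / 4 + of_int m * x + of_int n = of_real (of_int m) * x + of_real (of_int n + 1/4)" for x :: complex
    by simp
  show "norm (case i of (m, n) \<Rightarrow> 1 / (1 / 4 + of_int m * (\<tau> + \<i> * of_real t) + of_int n) ^ 3)
     \<le> (case i of (m, n) \<Rightarrow> ?C ^ 3 * (1 / (1 + \<bar>real_of_int m\<bar> + \<bar>real_of_int n\<bar>) ^ 3))"
    if "t \<in> {0..}" for t
  proof -
    have "1 + \<bar>real_of_int m\<bar> + \<bar>real_of_int n\<bar> \<le> ?C * norm (1 / 4 + of_int m * \<tau> + of_int n)"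
      by (rule quarter_bound) (use assms in auto)
    also have "\<dots> \<le> ?C * norm (1 / 4 + of_int m * (\<tau> + \<i> * of_real t) + of_int n)"
      unfolding eq using norm_denom_shift_ge[OF assms, of t "of_int m" "of_int n + 1/4"] that assms
      by (intro mult_left_mono) (auto intro!: add_nonneg_nonneg divide_nonneg_pos)
    finally show ?thesis unfolding i prod.case by (intro norm_inverse_cube_le) auto
  qed
  show "((\<lambda>t. case i of (m, n) \<Rightarrow> 1 / (1 / 4 + of_int m * (\<tau> + \<i> * of_real t) + of_int n) ^ 3) \<longlongrightarrow>
      (case i of (m, n) \<Rightarrow> if m = 0 then 1 / (1 / 4 + of_int n) ^ 3 else 0)) at_top"
  proof (cases "m = 0")
    case True
    then show ?thesis unfolding i prod.case by simp
  next
    case False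
    then show ?thesis unfolding i prod.case eq
      using tendsto_inverse_power_at_top[OF norm_denom_shift_at_top[of "of_int m" \<tau> "of_int n + 1/4"], of 3] by simp
  qed
qed auto

text \<open>Pairing n with -1 - n gives the positive terms (n + 1/4)^-3 - (n + 3/4)^-3. Summed over
  all integers, every pair occurs twice, which accounts for the factor 2.\<close>

lemma quarter_cube_limit_nonzero: "quarter_cube_limit \<noteq> 0"
proof -
  let ?g = "\<lambda>n::int. 1 / (1 / 4 + real_of_int n) ^ 3"
  \<comment> \<open>Summability over n is read off the double series at w = \<i>, restricted to m =
    0.\<close>
  have "(\<lambda>(m::int, n::int). 1 / (1 / 4 + of_int m * \<i> + of_int n) ^ 3 :: complex) summable_on UNIV"
  proof (rule lattice_partial_sum_holomorphic(2))
    show "1 / 4 + of_int m * \<i> + of_int n \<noteq> 0" for m n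
      using quarter_bound[of 1 \<i> 1 m n] by auto
  qed auto
  then have "(\<lambda>(m::int, n::int). 1 / (1 / 4 + of_int m * \<i> + of_int n) ^ 3 :: complex) summable_on range (Pair 0)"
    by (rule summable_on_subset_banach) auto
  then have s: "(\<lambda>n::int. complex_of_real (?g n)) summable_on UNIV"
    by (subst (asm) summable_on_reindex) (auto simp: o_def inj_def)
  have "quarter_cube_limit = (\<Sum>\<^sub>\<infinity>(m::int, n::int)\<in>range (Pair 0). complex_of_real (?g n))"
    unfolding quarter_cube_limit_def by (rule infsum_cong_neutral) (auto simp: image_iff)
  also have "\<dots> = (\<Sum>\<^sub>\<infinity>n::int. complex_of_real (?g n))"
    by (subst infsum_reindex) (auto simp: o_def inj_def)
  finally have 1: "quarter_cube_limit = (\<Sum>\<^sub>\<infinity>n::int. complex_of_real (?g n))" .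
  have sr: "?g summable_on UNIV" using summable_on_Re[OF s] by simp
  have 2: "quarter_cube_limit = of_real (\<Sum>\<^sub>\<infinity>n::int. ?g n)"
    unfolding 1 using has_sum_of_real[OF has_sum_infsum[OF sr], where ?'a = complex]
    by (simp add: infsumI)
  have sr': "(\<lambda>n. ?g (- 1 - n)) summable_on UNIV"
    using summable_on_reindex_bij_witness[of UNIV "\<lambda>n. - 1 - n" "\<lambda>n. - 1 - n" UNIV ?g "\<lambda>n. ?g (- 1 - n)"] sr
    by auto
  have eq: "infsum ?g UNIV = infsum (\<lambda>n. ?g (- 1 - n)) UNIV"
    by (rule infsum_reindex_bij_witness[of _ "\<lambda>n. - 1 - n" "\<lambda>n. - 1 - n"]) auto
  have pos: "0 < ?g n + ?g (- 1 - n)" for n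
  proof -
    have mi: "1 / (- y) ^ 3 = - (1 / y ^ 3)" for y :: real by (simp add: power3_eq_cube)
    have "1 / 4 + real_of_int (- 1 - n) = - (3 / 4 + real_of_int n)" by simp
    then have A: "?g (- 1 - n) = - (1 / (3 / 4 + real_of_int n) ^ 3)" by (simp only: mi)
    have B: "1 / (3 / 4 + x) ^ 3 < 1 / (1 / 4 + x) ^ 3" if "x \<ge> 0 \<or> x \<le> -1" for x :: real
    proof (cases "x \<ge> 0")
      case True
      then show ?thesis by (intro divide_strict_left_mono power_strict_mono mult_pos_pos zero_less_power) auto
    next
      case False
      then have x: "x \<le> -1" using that by auto
      have "(- (3 / 4 + x)) ^ 3 < (- (1 / 4 + x)) ^ 3" using x by (intro power_strict_mono) auto
      then have "1 / (- (1 / 4 + x)) ^ 3 < 1 / (- (3 / 4 + x)) ^ 3"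
        using x by (intro divide_strict_left_mono mult_pos_pos zero_less_power) auto
      then show ?thesis by (simp only: mi neg_less_iff_less)
    qed
    have "real_of_int n \<ge> 0 \<or> real_of_int n \<le> -1" by (cases "0 \<le> n") auto
    from B[OF this] show ?thesis unfolding A by linarith
  qed
  have "0 < infsum (\<lambda>n. ?g n + ?g (- 1 - n)) {0}" using pos[of 0] by simp
  also have "\<dots> \<le> infsum (\<lambda>n. ?g n + ?g (- 1 - n)) UNIV"
  proof (rule infsum_mono2)
    show "(\<lambda>n. ?g n + ?g (- 1 - n)) summable_on UNIV" by (rule summable_on_add[OF sr sr'])
    show "0 \<le> ?g n + ?g (- 1 - n)" for n using pos[of n] by (rule less_imp_le)
  qed simp_all
  also have "\<dots> = 2 * infsum ?g UNIV"
    by (subst infsum_add[OF sr sr']) (simp add: eq)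
  finally have "infsum ?g UNIV \<noteq> 0" by simp
  then show ?thesis unfolding 2 by simp
qed


subsection \<open>Completions by Poincare series\<close>

text \<open>The lower rows of the matrices in \<Gamma>(K); they label the cosets by which the
  Poincare series is summed.\<close>

definition cusp_rows :: "int \<Rightarrow> (int \<times> int) set" where
  "cusp_rows K = {(c, d). coprime c d \<and> [c = 0] (mod K) \<and> [d = 1] (mod K)}"

definition gamma_mat :: "int \<Rightarrow> int \<Rightarrow> int \<Rightarrow> int \<Rightarrow> int \<Rightarrow> bool" where
  "gamma_mat K a b c d \<longleftrightarrow> a * d - b * c = 1 \<and> [a = 1] (mod K) \<and> [b = 0] (mod K) \<and> [c = 0] (mod K) \<and> [d = 1] (mod K)"

lemma gamma_mat_mult:
  assumes "gamma_mat K a b c d" "gamma_mat K a' b' c' d'"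
  shows "gamma_mat K (a * a' + b * c') (a * b' + b * d') (c * a' + d * c') (c * b' + d * d')"
  unfolding gamma_mat_def
proof (intro conjI)
  have "(a * a' + b * c') * (c * b' + d * d') - (a * b' + b * d') * (c * a' + d * c')
      = (a * d - b * c) * (a' * d' - b' * c')" by (simp add: algebra_simps)
  also have "\<dots> = 1" using assms by (simp add: gamma_mat_def)
  finally show "(a * a' + b * c') * (c * b' + d * d') - (a * b' + b * d') * (c * a' + d * c') = 1" .
  have *: "[a = 1] (mod K)" "[b = 0] (mod K)" "[c = 0] (mod K)" "[d = 1] (mod K)"
    "[a' = 1] (mod K)" "[b' = 0] (mod K)" "[c' = 0] (mod K)" "[d' = 1] (mod K)"
    using assms by (auto simp: gamma_mat_def)
  show "[a * a' + b * c' = 1] (mod K)" using cong_add[OF cong_mult[OF *(1,5)] cong_mult[OF *(2,7)]] by simp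
  show "[a * b' + b * d' = 0] (mod K)" using cong_add[OF cong_mult[OF *(1,6)] cong_mult[OF *(2,8)]] by simp
  show "[c * a' + d * c' = 0] (mod K)" using cong_add[OF cong_mult[OF *(3,5)] cong_mult[OF *(4,7)]] by simp
  show "[c * b' + d * d' = 1] (mod K)" using cong_add[OF cong_mult[OF *(3,6)] cong_mult[OF *(4,8)]] by simp
qed

lemma gamma_mat_inverse:
  assumes "gamma_mat K a b c d"
  shows "gamma_mat K d (- b) (- c) a"
  using assms cong_minus_minus_iff[of b 0 K] cong_minus_minus_iff[of c 0 K]
  by (auto simp: gamma_mat_def algebra_simps)

lemma gamma_mat_cusp_row: "gamma_mat K a b c d \<Longrightarrow> (c, d) \<in> cusp_rows K"
proof -
  assume g: "gamma_mat K a b c d"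
  then have "d * a + c * (- b) = 1" by (simp add: gamma_mat_def algebra_simps)
  then have "coprime c d" by (metis coprime_commute coprimeI dvd_add dvd_mult2)
  with g show ?thesis by (simp add: cusp_rows_def gamma_mat_def)
qed

lemma cusp_row_gamma_mat:
  assumes "(c, d) \<in> cusp_rows K"
  shows "\<exists>a b. gamma_mat K a b c d"
proof -
  have cd: "coprime c d" "[c = 0] (mod K)" "[d = 1] (mod K)" using assms by (auto simp: cusp_rows_def)
  obtain x y where "x * c + y * d = 1" using cd(1) bezout_int[of c d] by auto
  then have xy: "y * d - (- x) * c = 1" by simp
  \<comment> \<open>Adding x times the lower row to the Bezout row keeps the determinant. As d = 1
    modulo K it makes b divisible by K, and the determinant then forces a = 1 modulo K.\<close>
  define a b where "a = y + x * c" and "b = - x + x * d"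
  have det: "a * d - b * c = 1" using xy by (simp add: a_def b_def algebra_simps)
  have "[- x + x * d = - x + x * 1] (mod K)" by (intro cong_add cong_mult cong_refl cd)
  then have b: "[b = 0] (mod K)" by (simp add: b_def)
  have "[a * d - b * c = a * 1 - 0 * 0] (mod K)" by (intro cong_diff cong_mult cong_refl cd b)
  then have "[a = 1] (mod K)" using det by (simp add: cong_sym_eq)
  with det b cd show ?thesis unfolding gamma_mat_def by blast
qed

text \<open>
  Two matrices of \<open>\<Gamma>(K)\<close> with the same lower row differ by a translation by a multiple of \<open>K\<close>, so
  the choice is immaterial once a \<open>K\<close>-periodic function is applied to the result.
\<close>

definition cusp_act :: "int \<Rightarrow> int \<Rightarrow> int \<Rightarrow> complex \<Rightarrow> complex" where
  "cusp_act K c d \<tau> = (let (a, b) = (SOME (a, b). gamma_mat K a b c d) in moebius a b c d \<tau>)"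

lemma cusp_act_gamma_mat:
  assumes "(c, d) \<in> cusp_rows K"
  obtains a b where "gamma_mat K a b c d" "cusp_act K c d = moebius a b c d"
proof -
  obtain a b where ab: "(SOME (a, b). gamma_mat K a b c d) = (a, b)" by (metis surj_pair)
  have "case (a, b) of (a, b) \<Rightarrow> gamma_mat K a b c d"
    unfolding ab[symmetric] by (rule someI_ex) (use cusp_row_gamma_mat[OF assms] in auto)
  then show thesis by (intro that[of a b]) (auto simp: cusp_act_def ab)
qed

lemma gamma_mat_same_row:
  assumes "gamma_mat K a b c d" "gamma_mat K a' b' c d" "0 < Im \<tau>"
  shows "\<exists>j. moebius a' b' c d \<tau> = moebius a b c d \<tau> + of_int (K * j)"
proof -
  \<comment> \<open>The determinant b' a - a' b of the two upper rows is the multiple of the lower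
    row by which they differ.\<close>
  have "[b' * a - a' * b = 0 * 1 - 1 * 0] (mod K)"
    using assms unfolding gamma_mat_def by (intro cong_diff cong_mult) auto
  then have "K dvd b' * a - a' * b" by (simp add: cong_0_iff)
  then obtain j where j: "b' * a - a' * b = K * j" by (elim dvdE)
  have det: "a * d - b * c = 1" "a' * d - b' * c = 1" using assms by (auto simp: gamma_mat_def)
  have "a' = a' * (a * d - b * c)" using det by simp
  also have "\<dots> = a * (a' * d - b' * c) + (b' * a - a' * b) * c" by (simp add: algebra_simps)
  finally have a': "a' = a + K * j * c" using det j by simp
  have "b' = b' * (a * d - b * c)" using det by simp
  also have "\<dots> = b * (a' * d - b' * c) + (b' * a - a' * b) * d" by (simp add: algebra_simps)
  finally have b': "b' = b + K * j * d" using det j by simp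
  have "c \<noteq> 0 \<or> d \<noteq> 0" using det by auto
  then have D: "of_int c * \<tau> + of_int d \<noteq> 0" by (rule moebius_denom_nonzero[OF assms(3)])
  have "of_int a' * \<tau> + of_int b' = (of_int a * \<tau> + of_int b) + of_int (K * j) * (of_int c * \<tau> + of_int d)"
    unfolding a' b' by (simp add: algebra_simps)
  then have "moebius a' b' c d \<tau> = moebius a b c d \<tau> + of_int (K * j)"
  proof -
    assume *: "of_int a' * \<tau> + of_int b' = (of_int a * \<tau> + of_int b) + of_int (K * j) * (of_int c * \<tau> + of_int d)"
    have "(X + k * E) / E = X / E + k" if "E \<noteq> 0" for X k E :: complex
      using that by (simp add: field_simps)
    then show ?thesis using D by (simp only: moebius_def *)
  qed
  then show ?thesis by blast
qed

definition poincare_term ::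
    "int \<Rightarrow> (complex \<Rightarrow> complex) \<Rightarrow> complex \<Rightarrow> complex \<Rightarrow> int \<times> int \<Rightarrow> complex" where
  "poincare_term K f \<tau> w = (\<lambda>(c, d). f (cusp_act K c d \<tau>) /
     ((of_int c * \<tau> + of_int d) * (of_int c * w + of_int d) ^ 12))"

definition poincare_series ::
    "int \<Rightarrow> (complex \<Rightarrow> complex) \<Rightarrow> complex \<Rightarrow> complex \<Rightarrow> complex" where
  "poincare_series K f \<tau> w = (\<Sum>\<^sub>\<infinity>i\<in>cusp_rows K. poincare_term K f \<tau> w i)"

lemma cusp_rows_nonzero: "(c, d) \<in> cusp_rows K \<Longrightarrow> c \<noteq> 0 \<or> d \<noteq> 0"
  by (auto simp: cusp_rows_def)

text \<open>Put s = |c| + |d|. The imaginary part of the translate is at least a constant times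
  s^-2, so the growth hypothesis costs s^4; the denominators give s^-1 and s^-12. The total s^-9 is
  compared with the summable (1 + s)^-3, the 8 coming from 1 + s <= 2 s. The constant C is left
  abstract, so that w may range over a compact set or a vertical ray.\<close>

lemma poincare_term_bound:
  assumes f: "\<And>\<tau>. 0 < Im \<tau> \<Longrightarrow> norm (f \<tau>) \<le> B * (1 + 1 / Im \<tau>)\<^sup>2" and B: "0 \<le> B"
    and tau: "0 < Y" "Y \<le> Im \<tau>" "norm \<tau> \<le> R"
    and C: "0 \<le> C" and w: "\<And>c d. \<bar>c\<bar> + \<bar>d\<bar> \<le> C * norm (of_real c * w + of_real d)"
    and cd: "(c, d) \<in> cusp_rows K"
  shows "norm (poincare_term K f \<tau> w (c, d)) \<le>
     8 * B * (1 + (1 + R)\<^sup>2 / Y)\<^sup>2 * (1 + (1 + R) / Y) * C ^ 12 *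
       (1 / (1 + \<bar>real_of_int c\<bar> + \<bar>real_of_int d\<bar>) ^ 3)"
proof -
  define s where "s = \<bar>real_of_int c\<bar> + \<bar>real_of_int d\<bar>"
  define C1 where "C1 = 1 + (1 + R) / Y"
  define D where "D = norm (of_int c * \<tau> + of_int d)"
  define E where "E = norm (of_int c * w + of_int d)"
  define Q where "Q = 1 + (1 + R)\<^sup>2 / Y"
  have R: "0 \<le> R" using tau norm_ge_zero[of \<tau>] by linarith
  have Q: "Q \<ge> 1" unfolding Q_def using tau by simp
  have C1: "C1 \<ge> 1" unfolding C1_def using tau R by simp
  have "1 \<le> \<bar>c\<bar> + \<bar>d\<bar>" using cusp_rows_nonzero[OF cd] by auto
  then have s: "1 \<le> s" unfolding s_def by linarith
  have im: "0 < Im \<tau>" using tau by linarith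
  have D0: "s \<le> C1 * D" unfolding s_def C1_def D_def
    using lattice_lower_bound[OF tau, of "of_int c" "of_int d"] by simp
  have E0: "s \<le> C * E" unfolding s_def E_def using w[of "of_int c" "of_int d"] by simp
  have Dpos: "0 < D" using D0 s C1 by (metis D_def less_le_trans mult_zero_right not_one_le_zero order.trans zero_less_norm_iff norm_eq_zero)
  have Epos: "0 < E" using E0 s by (metis E_def mult_zero_right not_one_le_zero order.trans zero_less_norm_iff norm_eq_zero)
  have "D \<le> (1 + norm \<tau>) * s" unfolding D_def s_def
    using lattice_upper_bound[of "of_int c" \<tau> "of_int d"] by simp
  also have "\<dots> \<le> (1 + R) * s" using tau s by (intro mult_right_mono) auto
  finally have D1: "D \<le> (1 + R) * s" .
  obtain a b where ab: "gamma_mat K a b c d" "cusp_act K c d = moebius a b c d"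
    by (rule cusp_act_gamma_mat[OF cd])
  have det: "a * d - b * c = 1" using ab by (simp add: gamma_mat_def)
  have "norm (f (cusp_act K c d \<tau>)) \<le> B * (1 + 1 / (Im \<tau> / D\<^sup>2))\<^sup>2"
    using f[OF Im_moebius(2)[OF det im]] unfolding ab(2) D_def Im_moebius(1)[OF det im] .
  also have "\<dots> \<le> B * (1 + ((1 + R)\<^sup>2 / Y) * s\<^sup>2)\<^sup>2"
  proof (intro mult_left_mono power_mono add_left_mono B)
    have "1 / (Im \<tau> / D\<^sup>2) \<le> ((1 + R) * s)\<^sup>2 / Y"
      using tau D1 Dpos im by (auto intro!: frac_le power_mono)
    also have "((1 + R) * s)\<^sup>2 / Y = ((1 + R)\<^sup>2 / Y) * s\<^sup>2" by (simp add: power_mult_distrib)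
    finally show "1 / (Im \<tau> / D\<^sup>2) \<le> ((1 + R)\<^sup>2 / Y) * s\<^sup>2" .
    show "0 \<le> 1 + 1 / (Im \<tau> / D\<^sup>2)" using im by simp
  qed
  also have "\<dots> \<le> B * (Q * s\<^sup>2)\<^sup>2"
  proof -
    have "1 \<le> s\<^sup>2" using s by (simp add: one_le_power)
    then have "1 + ((1 + R)\<^sup>2 / Y) * s\<^sup>2 \<le> Q * s\<^sup>2" unfolding Q_def distrib_right by simp
    then show ?thesis using B tau by (intro mult_left_mono power_mono) auto
  qed
  finally have fb: "norm (f (cusp_act K c d \<tau>)) \<le> B * (Q * s\<^sup>2)\<^sup>2" .
  have iD: "1 / D \<le> C1 / s" using D0 Dpos s by (simp add: field_simps)
  have iE: "1 / E \<le> C / s" using E0 Epos s by (simp add: field_simps)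
  have "norm (poincare_term K f \<tau> w (c, d)) = norm (f (cusp_act K c d \<tau>)) * (1 / D) * (1 / E) ^ 12"
    unfolding poincare_term_def D_def E_def by (simp add: norm_divide norm_mult norm_power power_divide)
  also have "\<dots> \<le> (B * (Q * s\<^sup>2)\<^sup>2) * (C1 / s) * (C / s) ^ 12"
    using fb iD iE Dpos Epos B C1 s C by (intro mult_mono power_mono mult_nonneg_nonneg) auto
  also have "\<dots> = (B * Q\<^sup>2 * C1 * C ^ 12) * (1 / s ^ 9)"
    using s by (simp add: field_simps power_mult_distrib flip: power_mult power_add) (simp add: power_numeral_reduce)?
  also have "\<dots> \<le> (B * Q\<^sup>2 * C1 * C ^ 12) * (8 * (1 / (1 + s) ^ 3))"
  proof (rule mult_left_mono)
    have "(1 + s) ^ 3 \<le> (2 * s) ^ 3" using s by (intro power_mono) auto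
    also have "(2 * s) ^ 3 = 8 * s ^ 3" by (simp add: power_mult_distrib)
    also have "\<dots> \<le> 8 * s ^ 9" using s by (intro mult_left_mono power_increasing) auto
    finally show "1 / s ^ 9 \<le> 8 * (1 / (1 + s) ^ 3)" using s by (simp add: field_simps)
    show "0 \<le> B * Q\<^sup>2 * C1 * C ^ 12" using B C1 C by simp
  qed
  also have "\<dots> = 8 * B * Q\<^sup>2 * C1 * C ^ 12 * (1 / (1 + s) ^ 3)" by simp
  finally show ?thesis unfolding Q_def C1_def s_def by (simp only: add.assoc)
qed

lemma upper_half_plane_cball:
  assumes "0 < Im z" "x \<in> cball z (Im z / 2)"
  shows "Im z / 2 \<le> Im x" "norm x \<le> norm z + Im z / 2"
proof -
  have "norm (x - z) \<le> Im z / 2" using assms by (simp add: dist_norm norm_minus_commute)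
  moreover have "\<bar>Im (x - z)\<bar> \<le> norm (x - z)" by (rule abs_Im_le_cmod)
  moreover have "norm x \<le> norm z + norm (x - z)" using norm_triangle_ineq[of z "x - z"] by simp
  ultimately show "Im z / 2 \<le> Im x" "norm x \<le> norm z + Im z / 2" by auto
qed

lemma lattice_lower_bound_nonneg:
  assumes "0 < Y" "0 \<le> R" shows "0 \<le> 1 + (1 + R) / (Y :: real)"
  using assms by (intro add_nonneg_nonneg divide_nonneg_pos) auto

locale poincare_data =
  fixes K :: int and f :: "complex \<Rightarrow> complex" and B :: real
  assumes f_holo: "f holomorphic_on upper_half_plane"
    and f_per: "\<And>\<tau> j. 0 < Im \<tau> \<Longrightarrow> f (\<tau> + of_int (K * j)) = f \<tau>"
    and f_bound: "\<And>\<tau>. 0 < Im \<tau> \<Longrightarrow> norm (f \<tau>) \<le> B * (1 + 1 / Im \<tau>)\<^sup>2"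
    and B: "0 \<le> B" and K: "0 < K" "4 dvd K"
begin

lemma f_cusp_act:
  assumes "gamma_mat K a b c d" "0 < Im \<tau>"
  shows "f (cusp_act K c d \<tau>) = f (moebius a b c d \<tau>)"
proof -
  obtain a' b' where ab: "gamma_mat K a' b' c d" "cusp_act K c d = moebius a' b' c d"
    by (rule cusp_act_gamma_mat[OF gamma_mat_cusp_row[OF assms(1)]])
  obtain j where "moebius a' b' c d \<tau> = moebius a b c d \<tau> + of_int (K * j)"
    using gamma_mat_same_row[OF assms(1) ab(1) assms(2)] by blast
  moreover have "0 < Im (moebius a b c d \<tau>)"
    using assms by (intro Im_moebius(2)) (auto simp: gamma_mat_def)
  ultimately show ?thesis by (simp only: ab(2) f_per)
qed

text \<open>Right multiplication by the matrix permutes the lower rows. The denominators obey the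
  cocycle relation \<open>moebius_compose\<close>, and \<open>f_cusp_act\<close> allows any
  representative of the resulting coset.\<close>

lemma poincare_series_moebius:
  assumes g: "gamma_mat K a b c d" and tau: "0 < Im \<tau>" and w: "0 < Im w"
  shows "poincare_series K f (moebius a b c d \<tau>) (moebius a b c d w)
    = (of_int c * \<tau> + of_int d) * (of_int c * w + of_int d) ^ 12 * poincare_series K f \<tau> w"
proof -
  let ?D = "of_int c * \<tau> + of_int d" and ?E = "of_int c * w + of_int d"
  have det: "a * d - b * c = 1" using g by (simp add: gamma_mat_def)
  then have cd: "c \<noteq> 0 \<or> d \<noteq> 0" by auto
  have det': "d * a - c * b = 1" using det by (simp add: algebra_simps)
  have D: "?D \<noteq> 0" and E: "?E \<noteq> 0" using moebius_denom_nonzero[OF _ cd] tau w by auto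
  have mul: "(x * a + y * c, x * b + y * d) \<in> cusp_rows K"
    if "(x, y) \<in> cusp_rows K" "gamma_mat K a b c d" for x y a b c d
    using cusp_row_gamma_mat[OF that(1)] gamma_mat_mult[OF _ that(2)] gamma_mat_cusp_row by blast
  have "poincare_series K f (moebius a b c d \<tau>) (moebius a b c d w)
      = (\<Sum>\<^sub>\<infinity>i\<in>cusp_rows K. ?D * ?E ^ 12 * poincare_term K f \<tau> w i)"
    unfolding poincare_series_def
  proof (rule infsum_reindex_bij_witness[of _
      "\<lambda>(x, y). (x * d + y * (- c), x * (- b) + y * a)" "\<lambda>(x, y). (x * a + y * c, x * b + y * d)"], goal_cases)
    case (1 i)
    obtain x y where i: "i = (x, y)" by (cases i)
    have "(x * a + y * c) * d + (x * b + y * d) * (- c) = x * (d * a - c * b)"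
      "(x * a + y * c) * (- b) + (x * b + y * d) * a = y * (d * a - c * b)" by (simp_all add: algebra_simps)
    then show ?case unfolding i by (simp add: det')
  next
    case (2 i)
    then show ?case using mul[OF _ g] by (cases i) auto
  next
    case (3 i)
    obtain x y where i: "i = (x, y)" by (cases i)
    have "(x * d + y * (- c)) * a + (x * (- b) + y * a) * c = x * (d * a - c * b)"
      "(x * d + y * (- c)) * b + (x * (- b) + y * a) * d = y * (d * a - c * b)" by (simp_all add: algebra_simps)
    then show ?case unfolding i by (simp add: det')
  next
    case (4 i)
    then show ?case using mul[OF _ gamma_mat_inverse[OF g]] by (cases i) auto
  next
    case (5 i)
    obtain x y where i: "i = (x, y)" by (cases i)
    with 5 obtain a' b' where g': "gamma_mat K a' b' x y" using cusp_row_gamma_mat by blast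
    have im: "0 < Im (moebius a b c d \<tau>)" by (rule Im_moebius(2)[OF det tau])
    have "f (cusp_act K x y (moebius a b c d \<tau>)) = f (moebius a' b' x y (moebius a b c d \<tau>))"
      by (rule f_cusp_act[OF g' im])
    also have "\<dots> = f (cusp_act K (x * a + y * c) (x * b + y * d) \<tau>)"
      unfolding moebius_compose(2)[OF tau det] by (rule f_cusp_act[OF gamma_mat_mult[OF g' g] tau, symmetric])
    finally have e: "f (cusp_act K x y (moebius a b c d \<tau>)) = f (cusp_act K (x * a + y * c) (x * b + y * d) \<tau>)" .
    show ?case unfolding i poincare_term_def prod.case e moebius_compose(1)[OF tau det] moebius_compose(1)[OF w det]
      using D E by (simp add: power_divide)
  qed
  also have "\<dots> = ?D * ?E ^ 12 * poincare_series K f \<tau> w"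
    unfolding poincare_series_def by (rule infsum_cmult_right')
  finally show ?thesis .
qed

lemma poincare_term_holomorphic:
  assumes "i \<in> cusp_rows K"
  shows "0 < Im w \<Longrightarrow> (\<lambda>\<tau>. poincare_term K f \<tau> w i) holomorphic_on upper_half_plane"
    and "(\<lambda>w. poincare_term K f \<tau> w i) holomorphic_on upper_half_plane"
proof -
  obtain c d where i: "i = (c, d)" by (cases i)
  with assms have cd: "(c, d) \<in> cusp_rows K" by simp
  obtain a b where ab: "gamma_mat K a b c d" "cusp_act K c d = moebius a b c d"
    by (rule cusp_act_gamma_mat[OF cd])
  have det: "a * d - b * c = 1" using ab by (simp add: gamma_mat_def)
  have nz: "of_int c * x + of_int d \<noteq> 0" if "0 < Im x" for x
    by (rule moebius_denom_nonzero[OF that cusp_rows_nonzero[OF cd]])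
  have "moebius a b c d holomorphic_on upper_half_plane"
    unfolding moebius_def[abs_def] using nz by (auto intro!: holomorphic_intros)
  moreover have "moebius a b c d ` upper_half_plane \<subseteq> upper_half_plane"
    using Im_moebius(2)[OF det] by auto
  ultimately have "(f \<circ> moebius a b c d) holomorphic_on upper_half_plane"
    by (intro holomorphic_on_compose_gen[OF _ f_holo])
  then have 1: "(\<lambda>\<tau>. f (moebius a b c d \<tau>)) holomorphic_on upper_half_plane" by (simp add: o_def)
  show "(\<lambda>\<tau>. poincare_term K f \<tau> w i) holomorphic_on upper_half_plane" if "0 < Im w"
    unfolding i poincare_term_def prod.case ab(2) using nz nz[OF that]
    by (intro holomorphic_intros 1) auto
  show "(\<lambda>w. poincare_term K f \<tau> w i) holomorphic_on upper_half_plane"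
    unfolding i poincare_term_def prod.case using nz
    by (cases "of_int c * \<tau> + of_int d = 0") (auto intro!: holomorphic_intros)
qed

lemma summable_poincare_majorant:
  "(\<lambda>(c, d). M * (1 / (1 + \<bar>real_of_int c\<bar> + \<bar>real_of_int d\<bar>) ^ 3)) summable_on cusp_rows K"
  using summable_on_subset_banach[OF summable_on_cmult_right[OF summable_on_lattice_cube, of M], of "cusp_rows K"]
  by (simp add: case_prod_unfold)

lemma poincare_series_holomorphic:
  shows "0 < Im w \<Longrightarrow> (\<lambda>\<tau>. poincare_series K f \<tau> w) holomorphic_on upper_half_plane"
    and "0 < Im \<tau> \<Longrightarrow> (\<lambda>w. poincare_series K f \<tau> w) holomorphic_on upper_half_plane"
proof -
  have op: "open upper_half_plane" by (rule open_halfspace_Im_gt)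
  have sub: "cball z (Im z / 2) \<subseteq> upper_half_plane" if "0 < Im z" for z
    using upper_half_plane_cball(1)[OF that] that by force
  show "(\<lambda>\<tau>. poincare_series K f \<tau> w) holomorphic_on upper_half_plane" if w: "0 < Im w"
    unfolding poincare_series_def
  proof (rule holomorphic_on_infsum[OF _ op])
    fix z assume "z \<in> upper_half_plane"
    then have z: "0 < Im z" by simp
    let ?C = "1 + (1 + norm w) / Im w" and ?R = "norm z + Im z / 2" and ?Y = "Im z / 2"
    define M where "M = 8 * B * (1 + (1 + ?R)\<^sup>2 / ?Y)\<^sup>2 * (1 + (1 + ?R) / ?Y) * ?C ^ 12"
    have le: "norm (poincare_term K f x w i) \<le> (case i of (c, d) \<Rightarrow> M * (1 / (1 + \<bar>real_of_int c\<bar> + \<bar>real_of_int d\<bar>) ^ 3))"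
      if "i \<in> cusp_rows K" "x \<in> cball z (Im z / 2)" for i x
    proof -
      obtain c d where i: "i = (c, d)" by (cases i)
      show ?thesis unfolding i prod.case M_def
        by (rule poincare_term_bound[OF f_bound B _ upper_half_plane_cball[OF z that(2)]])
           (use z that(1) i lattice_lower_bound[OF w order.refl order.refl] w in \<open>auto intro!: lattice_lower_bound_nonneg\<close>)
    qed
    show "\<exists>r M. 0 < r \<and> cball z r \<subseteq> upper_half_plane \<and> M summable_on cusp_rows K \<and>
        (\<forall>i\<in>cusp_rows K. \<forall>x\<in>cball z r. norm (poincare_term K f x w i) \<le> M i)"
      using le sub[OF z] z summable_poincare_majorant
      by (intro exI[of _ "Im z / 2"] exI[of _ "\<lambda>(c, d). M * (1 / (1 + \<bar>real_of_int c\<bar> + \<bar>real_of_int d\<bar>) ^ 3)"] conjI ballI)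
         (simp_all only: half_gt_zero_iff)
  qed (rule poincare_term_holomorphic(1)[OF _ w])
  show "(\<lambda>w. poincare_series K f \<tau> w) holomorphic_on upper_half_plane" if tau: "0 < Im \<tau>"
    unfolding poincare_series_def
  proof (rule holomorphic_on_infsum[OF _ op])
    fix z assume "z \<in> upper_half_plane"
    then have z: "0 < Im z" by simp
    let ?C = "1 + (1 + (norm z + Im z / 2)) / (Im z / 2)"
    define M where "M = 8 * B * (1 + (1 + norm \<tau>)\<^sup>2 / Im \<tau>)\<^sup>2 * (1 + (1 + norm \<tau>) / Im \<tau>) * ?C ^ 12"
    have le: "norm (poincare_term K f \<tau> x i) \<le> (case i of (c, d) \<Rightarrow> M * (1 / (1 + \<bar>real_of_int c\<bar> + \<bar>real_of_int d\<bar>) ^ 3))"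
      if "i \<in> cusp_rows K" "x \<in> cball z (Im z / 2)" for i x
    proof -
      obtain c d where i: "i = (c, d)" by (cases i)
      show ?thesis unfolding i prod.case M_def
        by (rule poincare_term_bound[OF f_bound B tau order.refl order.refl])
           (use z that(1) i lattice_lower_bound[OF _ upper_half_plane_cball[OF z that(2)]] in \<open>auto intro!: lattice_lower_bound_nonneg\<close>)
    qed
    show "\<exists>r M. 0 < r \<and> cball z r \<subseteq> upper_half_plane \<and> M summable_on cusp_rows K \<and>
        (\<forall>i\<in>cusp_rows K. \<forall>x\<in>cball z r. norm (poincare_term K f \<tau> x i) \<le> M i)"
      using le sub[OF z] z summable_poincare_majorant
      by (intro exI[of _ "Im z / 2"] exI[of _ "\<lambda>(c, d). M * (1 / (1 + \<bar>real_of_int c\<bar> + \<bar>real_of_int d\<bar>) ^ 3)"] conjI ballI)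
         (simp_all only: half_gt_zero_iff)
  qed (rule poincare_term_holomorphic(2))
qed

text \<open>Rows with c \<noteq> 0 die with their denominators in w. Among the rows with c = 0 only
  d = 1 occurs: d = -1 would make K, a multiple of 4, divide 2.\<close>

lemma poincare_series_tendsto:
  assumes tau: "0 < Im \<tau>"
  shows "((\<lambda>t. poincare_series K f \<tau> (\<tau> + \<i> * of_real t)) \<longlongrightarrow> f \<tau>) at_top"
proof -
  let ?C = "1 + (1 + norm \<tau>) / Im \<tau>"
  define M where "M = 8 * B * (1 + (1 + norm \<tau>)\<^sup>2 / Im \<tau>)\<^sup>2 * (1 + (1 + norm \<tau>) / Im \<tau>) * ?C ^ 12"
  have id: "gamma_mat K 1 0 0 1" by (simp add: gamma_mat_def)
  have row: "(0, d) \<in> cusp_rows K \<longleftrightarrow> d = 1" for d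
  proof
    assume d: "(0, d) \<in> cusp_rows K"
    then have "d = 1 \<or> d = -1" by (auto simp: cusp_rows_def)
    moreover have "d \<noteq> -1"
    proof
      assume "d = -1"
      with d have "[-1 = 1] (mod K)" by (simp add: cusp_rows_def)
      then have "K dvd 2" by (simp add: cong_iff_dvd_diff)
      with K(2) have "(4 :: int) dvd 2" by (rule dvd_trans)
      then show False by simp
    qed
    ultimately show "d = 1" by blast
  qed (use gamma_mat_cusp_row[OF id] in simp)
  have "((\<lambda>t. poincare_series K f \<tau> (\<tau> + \<i> * of_real t)) \<longlongrightarrow>
      (\<Sum>\<^sub>\<infinity>i\<in>cusp_rows K. if i = (0, 1) then f \<tau> else 0)) at_top"
    unfolding poincare_series_def
  proof (rule tendsto_infsum)
    show "\<forall>\<^sub>F t in at_top. t \<in> {0::real..}" using eventually_ge_at_top[of 0] by simp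
    show "(\<lambda>(c, d). M * (1 / (1 + \<bar>real_of_int c\<bar> + \<bar>real_of_int d\<bar>) ^ 3)) summable_on cusp_rows K"
      by (rule summable_poincare_majorant)
    fix i assume i0: "i \<in> cusp_rows K"
    obtain c d where i: "i = (c, d)" by (cases i)
    show "norm (poincare_term K f \<tau> (\<tau> + \<i> * of_real t) i)
        \<le> (case i of (c, d) \<Rightarrow> M * (1 / (1 + \<bar>real_of_int c\<bar> + \<bar>real_of_int d\<bar>) ^ 3))" if "t \<in> {0..}" for t
      unfolding i prod.case M_def
    proof (rule poincare_term_bound[OF f_bound B tau order.refl order.refl])
      show C0: "0 \<le> ?C" using tau by (intro lattice_lower_bound_nonneg) auto
      fix c d :: real
      have "\<bar>c\<bar> + \<bar>d\<bar> \<le> ?C * norm (of_real c * \<tau> + of_real d)"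
        by (rule lattice_lower_bound[OF tau order.refl order.refl])
      also have "\<dots> \<le> ?C * norm (of_real c * (\<tau> + \<i> * of_real t) + of_real d)"
        using norm_denom_shift_ge[OF tau] that C0 by (intro mult_left_mono) auto
      finally show "\<bar>c\<bar> + \<bar>d\<bar> \<le> ?C * norm (of_real c * (\<tau> + \<i> * of_real t) + of_real d)" .
    qed (use i0 i in auto)
    show "((\<lambda>t. poincare_term K f \<tau> (\<tau> + \<i> * of_real t) i) \<longlongrightarrow> (if i = (0, 1) then f \<tau> else 0)) at_top"
    proof (cases "c = 0")
      case True
      with i0 i row have "i = (0, 1)" by auto
      then show ?thesis
        using f_cusp_act[OF id tau] by (simp add: poincare_term_def moebius_def)
    next
      case False
      let ?k = "f (cusp_act K c d \<tau>) / (of_int c * \<tau> + of_int d)"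
      have "((\<lambda>t. ?k * (1 / (of_real (of_int c) * (\<tau> + \<i> * of_real t) + of_real (of_int d)) ^ 12)) \<longlongrightarrow> ?k * 0) at_top"
        using False by (intro tendsto_intros tendsto_inverse_power_at_top norm_denom_shift_at_top) auto
      then show ?thesis using False unfolding i poincare_term_def by simp
    qed
  qed auto
  moreover have "(\<Sum>\<^sub>\<infinity>i\<in>cusp_rows K. if i = (0, 1) then f \<tau> else 0) = (\<Sum>\<^sub>\<infinity>i\<in>{(0::int, 1::int)}. f \<tau>)"
    by (rule infsum_cong_neutral) (use row in auto)
  ultimately show ?thesis by simp
qed

lemma completion_exists: "\<exists>F. is_completion 1 f F"
proof -
  let ?N = quarter_cube_sum
  \<comment> \<open>The numerator normalises the factor of weight -12 in w so that it tends to 1 at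
    the cusp and leaves the limit f unchanged.\<close>
  define F where "F = (\<lambda>\<tau> w. (quarter_cube_limit / ?N w) ^ 4 * poincare_series K f \<tau> w)"
  have "is_completion 1 f F"
    unfolding is_completion_def
  proof (intro conjI ballI)
    fix w assume "w \<in> upper_half_plane"
    then have "(\<lambda>\<tau>. F \<tau> w) holomorphic_on upper_half_plane"
      unfolding F_def by (intro holomorphic_intros poincare_series_holomorphic) auto
    then show "(\<lambda>\<tau>. F \<tau> w) holomorphic_on upper_half_plane - {w}"
      by (rule holomorphic_on_subset) auto
  next
    fix \<tau> assume "\<tau> \<in> upper_half_plane"
    then have "F \<tau> holomorphic_on upper_half_plane"
      unfolding F_def
      by (intro holomorphic_intros poincare_series_holomorphic quarter_cube_sum_holomorphic)
         (auto simp: quarter_cube_sum_nonzero)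
    then show "F \<tau> holomorphic_on upper_half_plane - {\<tau>}"
      by (rule holomorphic_on_subset) auto
  next
    fix \<tau> assume "\<tau> \<in> upper_half_plane"
    then have tau: "0 < Im \<tau>" by simp
    have "((\<lambda>t. F \<tau> (\<tau> + \<i> * of_real t)) \<longlongrightarrow> (quarter_cube_limit / quarter_cube_limit) ^ 4 * f \<tau>) at_top"
      unfolding F_def
      by (intro tendsto_intros quarter_cube_sum_tendsto poincare_series_tendsto tau quarter_cube_limit_nonzero)
    then show "((\<lambda>t. F \<tau> (\<tau> + \<i> * of_real t)) \<longlongrightarrow> f \<tau>) at_top"
      using quarter_cube_limit_nonzero by simp
  next
    show "\<exists>K>0. \<forall>a b c d :: int.
        a * d - b * c = 1 \<and> [a = 1] (mod K) \<and> [b = 0] (mod K) \<and> [c = 0] (mod K) \<and> [d = 1] (mod K) \<longrightarrow>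
        (\<forall>\<tau>\<in>upper_half_plane. \<forall>w\<in>upper_half_plane. \<tau> \<noteq> w \<longrightarrow>
           F (moebius a b c d \<tau>) (moebius a b c d w) = (of_int c * \<tau> + of_int d) powi 1 * F \<tau> w)"
    proof (intro exI[of _ K] conjI allI impI ballI K(1))
      fix a b c d :: int and \<tau> w
      assume g: "a * d - b * c = 1 \<and> [a = 1] (mod K) \<and> [b = 0] (mod K) \<and> [c = 0] (mod K) \<and> [d = 1] (mod K)"
        and "\<tau> \<in> upper_half_plane" "w \<in> upper_half_plane"
      then have tau: "0 < Im \<tau>" and w: "0 < Im w" and gm: "gamma_mat K a b c d"
        by (auto simp: gamma_mat_def)
      have "c \<noteq> 0 \<or> d \<noteq> 0" using g by auto
      then have E: "of_int c * w + of_int d \<noteq> 0" by (rule moebius_denom_nonzero[OF w])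
      have c4: "[c = 0] (mod 4)" "[d = 1] (mod 4)"
        using g K(2) by (auto intro: cong_dvd_modulus)
      have "?N (moebius a b c d w) = (of_int c * w + of_int d) ^ 3 * ?N w"
        using g by (intro quarter_cube_sum_moebius w c4) auto
      then show "F (moebius a b c d \<tau>) (moebius a b c d w) = (of_int c * \<tau> + of_int d) powi 1 * F \<tau> w"
        unfolding F_def poincare_series_moebius[OF gm tau w]
        using E quarter_cube_sum_nonzero[OF w]
        by (simp add: power_mult_distrib power_divide flip: power_mult)
    qed
  qed
  then show ?thesis by blast
qed

end

subsection \<open>Iterated Eichler integrals\<close>

definition eichler_integral ::
    "(complex \<Rightarrow> complex \<Rightarrow> complex) \<Rightarrow> complex \<Rightarrow> complex \<Rightarrow> bool" where
  "eichler_integral \<Theta> \<tau> I \<longleftrightarrow>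
     has_iterated_integral
       (\<lambda>w1 w2. \<Theta> w1 w2 / (csqrt (\<i> * (w1 - \<tau>)) * csqrt (\<i> * (w2 - \<tau>)))) \<tau> I"

lemma eichler_integral_add:
  assumes "eichler_integral \<Theta> \<tau> I" "eichler_integral \<Theta>' \<tau> I'"
  shows "eichler_integral (\<lambda>w1 w2. \<Theta> w1 w2 + \<Theta>' w1 w2) \<tau> (I + I')"
proof -
  let ?g = "\<lambda>\<Theta> w1 w2. \<Theta> w1 w2 / (csqrt (\<i> * (w1 - \<tau>)) * csqrt (\<i> * (w2 - \<tau>)))"
  let ?l = "\<lambda>t. linepath \<tau> (\<tau> + \<i> * complex_of_real t)" and ?e = "\<lambda>t. \<tau> + \<i> * complex_of_real t"
  have a: "?g \<Theta> (?e t) contour_integrable_on ?l t" "?g \<Theta>' (?e t) contour_integrable_on ?l t"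
    if "0 < t" for t using assms that unfolding eichler_integral_def has_iterated_integral_def by auto
  have b: "((\<lambda>t. contour_integral (?l t) (?g \<Theta> (?e t)) * \<i>) has_integral I) {0<..}"
    "((\<lambda>t. contour_integral (?l t) (?g \<Theta>' (?e t)) * \<i>) has_integral I') {0<..}"
    using assms unfolding eichler_integral_def has_iterated_integral_def by auto
  have e: "?g (\<lambda>w1 w2. \<Theta> w1 w2 + \<Theta>' w1 w2) w1 = (\<lambda>w2. ?g \<Theta> w1 w2 + ?g \<Theta>' w1 w2)" for w1
    by (simp add: add_divide_distrib)
  show ?thesis
    unfolding eichler_integral_def has_iterated_integral_def e
  proof (intro conjI allI impI)
    show "(\<lambda>w2. ?g \<Theta> (?e t) w2 + ?g \<Theta>' (?e t) w2) contour_integrable_on ?l t" if "0 < t" for t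
      by (intro contour_integrable_add a that)
    have "((\<lambda>t. contour_integral (?l t) (?g \<Theta> (?e t)) * \<i> + contour_integral (?l t) (?g \<Theta>' (?e t)) * \<i>)
        has_integral I + I') {0<..}"
      by (intro has_integral_add b)
    then show "((\<lambda>t. contour_integral (?l t) (\<lambda>w2. ?g \<Theta> (?e t) w2 + ?g \<Theta>' (?e t) w2) * \<i>) has_integral I + I') {0<..}"
    proof (rule has_integral_eq[rotated])
      fix t :: real assume "t \<in> {0<..}"
      then have t: "0 < t" by simp
      show "contour_integral (?l t) (?g \<Theta> (?e t)) * \<i> + contour_integral (?l t) (?g \<Theta>' (?e t)) * \<i>
        = contour_integral (?l t) (\<lambda>w2. ?g \<Theta> (?e t) w2 + ?g \<Theta>' (?e t) w2) * \<i>"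
        by (subst contour_integral_add[OF a[OF t]]) (simp add: distrib_right)
    qed
  qed
qed

lemma eichler_integral_cmult:
  assumes "eichler_integral \<Theta> \<tau> I"
  shows "eichler_integral (\<lambda>w1 w2. c * \<Theta> w1 w2) \<tau> (c * I)"
proof -
  let ?g = "\<lambda>\<Theta> w1 w2. \<Theta> w1 w2 / (csqrt (\<i> * (w1 - \<tau>)) * csqrt (\<i> * (w2 - \<tau>)))"
  let ?l = "\<lambda>t. linepath \<tau> (\<tau> + \<i> * complex_of_real t)" and ?e = "\<lambda>t. \<tau> + \<i> * complex_of_real t"
  have a: "?g \<Theta> (?e t) contour_integrable_on ?l t"
    if "0 < t" for t using assms that unfolding eichler_integral_def has_iterated_integral_def by auto
  have b: "((\<lambda>t. contour_integral (?l t) (?g \<Theta> (?e t)) * \<i>) has_integral I) {0<..}"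
    using assms unfolding eichler_integral_def has_iterated_integral_def by auto
  have e: "?g (\<lambda>w1 w2. c * \<Theta> w1 w2) w1 = (\<lambda>w2. c * ?g \<Theta> w1 w2)" for w1
    by simp
  show ?thesis
    unfolding eichler_integral_def has_iterated_integral_def e
  proof (intro conjI allI impI)
    show "(\<lambda>w2. c * ?g \<Theta> (?e t) w2) contour_integrable_on ?l t" if "0 < t" for t
      by (intro contour_integrable_lmul a that)
    have "((\<lambda>t. c * (contour_integral (?l t) (?g \<Theta> (?e t)) * \<i>)) has_integral c * I) {0<..}"
      by (intro has_integral_mult_right b)
    then show "((\<lambda>t. contour_integral (?l t) (\<lambda>w2. c * ?g \<Theta> (?e t) w2) * \<i>) has_integral c * I) {0<..}"
    proof (rule has_integral_eq[rotated])
      fix t :: real assume "t \<in> {0<..}"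
      then have t: "0 < t" by simp
      show "c * (contour_integral (?l t) (?g \<Theta> (?e t)) * \<i>)
        = contour_integral (?l t) (\<lambda>w2. c * ?g \<Theta> (?e t) w2) * \<i>"
        by (subst contour_integral_lmul[OF a[OF t]]) simp
    qed
  qed
qed

lemma csqrt_minus_of_real: "0 \<le> x \<Longrightarrow> csqrt (- of_real x) = \<i> * of_real (sqrt x)"
  using csqrt_of_real_nonpos[of "- of_real x"] by simp

text \<open>Set w1 = \<tau> + \<i> t and w2 = \<tau> + \<i> t \<sigma>. Both radicands are negative
  real, on the branch cut, where the principal roots are \<i> sqrt t and \<i> sqrt (t \<sigma>).
  Their product -t sqrt \<sigma> cancels the factor -t from dw1 dw2 and leaves only 1 / sqrt
  \<sigma>.\<close>

lemma eichler_integralI: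
  assumes inner: "\<And>t. 0 < t \<Longrightarrow>
      ((\<lambda>\<sigma>. \<Theta> (\<tau> + \<i> * of_real t) (\<tau> + \<i> * of_real (t * \<sigma>)) / of_real (sqrt \<sigma>)) has_integral J t) {0..1}"
    and outer: "(J has_integral I) {0<..}"
  shows "eichler_integral \<Theta> \<tau> I"
proof -
  let ?g = "\<lambda>w1 w2. \<Theta> w1 w2 / (csqrt (\<i> * (w1 - \<tau>)) * csqrt (\<i> * (w2 - \<tau>)))"
  let ?l = "\<lambda>t. linepath \<tau> (\<tau> + \<i> * complex_of_real t)" and ?e = "\<lambda>t. \<tau> + \<i> * complex_of_real t"
  have ci: "(?g (?e t) has_contour_integral - \<i> * J t) (?l t)" if t: "0 < t" for t
    unfolding has_contour_integral_linepath
  proof -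
    have "((\<lambda>\<sigma>. - \<i> * (\<Theta> (?e t) (\<tau> + \<i> * of_real (t * \<sigma>)) / of_real (sqrt \<sigma>))) has_integral - \<i> * J t) {0..1}"
      by (intro has_integral_mult_right inner t)
    then show "((\<lambda>x. ?g (?e t) (?l t x) * (?e t - \<tau>)) has_integral - \<i> * J t) {0..1}"
    proof (rule has_integral_eq[rotated])
      fix \<sigma> :: real assume s: "\<sigma> \<in> {0..1}"
      have l: "?l t \<sigma> = \<tau> + \<i> * of_real (t * \<sigma>)"
        by (simp add: linepath_def scaleR_conv_of_real algebra_simps)
      have c1: "csqrt (\<i> * (?e t - \<tau>)) = \<i> * of_real (sqrt t)"
      proof -
        have "\<i> * (?e t - \<tau>) = - of_real t" by simp
        then show ?thesis using csqrt_minus_of_real[of t] t by simp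
      qed
      have c2: "csqrt (\<i> * (\<tau> + \<i> * of_real (t * \<sigma>) - \<tau>)) = \<i> * of_real (sqrt (t * \<sigma>))"
      proof -
        have "\<i> * (\<tau> + \<i> * of_real (t * \<sigma>) - \<tau>) = - of_real (t * \<sigma>)" by (simp add: algebra_simps)
        then show ?thesis using csqrt_minus_of_real[of "t * \<sigma>"] t s by simp
      qed
      have st: "of_real t = (of_real (sqrt t) * of_real (sqrt t) :: complex)"
        using t by (simp flip: of_real_mult)
      have "\<i> * of_real (sqrt t) * (\<i> * of_real (sqrt (t * \<sigma>))) = - (of_real t * of_real (sqrt \<sigma>) :: complex)"
      proof -
        have "\<i> * x * (\<i> * (x * y)) = (\<i> * \<i>) * (x * x * y)" for x y :: complex
          by (simp only: mult_ac)
        then show ?thesis by (simp add: real_sqrt_mult st)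
      qed
      then show "- \<i> * (\<Theta> (?e t) (\<tau> + \<i> * of_real (t * \<sigma>)) / of_real (sqrt \<sigma>)) = ?g (?e t) (?l t \<sigma>) * (?e t - \<tau>)"
        unfolding l c1 c2 using t by simp
    qed
  qed
  show ?thesis
    unfolding eichler_integral_def has_iterated_integral_def
  proof (intro conjI allI impI)
    show "?g (?e t) contour_integrable_on ?l t" if "0 < t" for t
      using ci[OF that] by (auto simp: contour_integrable_on_def)
    show "((\<lambda>t. contour_integral (?l t) (?g (?e t)) * \<i>) has_integral I) {0<..}"
      using outer
    proof (rule has_integral_eq[rotated])
      fix t :: real assume "t \<in> {0<..}"
      then have t: "0 < t" by simp
      show "J t = contour_integral (?l t) (?g (?e t)) * \<i>"
        unfolding contour_integral_unique[OF ci[OF t]] by (simp add: complex_eq_iff)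
    qed
  qed
qed

text \<open>Here p and r stand for the squares a^2 and b^2 of one term. The indicators extend the
  integrand by 0 to the whole plane, so that the order of integration can be changed for Lebesgue
  measure.\<close>

definition arctan_kernel :: "real \<Rightarrow> real \<Rightarrow> real \<Rightarrow> real \<Rightarrow> real" where
  "arctan_kernel p r t \<sigma> = indicator {0<..} t * (indicator {0<..1} \<sigma> * (exp (- (2 * pi * t * (p + r * \<sigma>))) / sqrt \<sigma>))"

lemma arctan_kernel_measurable [measurable]:
  "(\<lambda>(t, \<sigma>). arctan_kernel p r t \<sigma>) \<in> borel_measurable (lborel \<Otimes>\<^sub>M lborel)"
  "arctan_kernel p r t \<in> borel_measurable lborel"
  unfolding arctan_kernel_def[abs_def] by measurable

lemma arctan_kernel_nonneg: "0 \<le> arctan_kernel p r t \<sigma>"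
  by (auto simp: arctan_kernel_def indicator_def)

lemma has_integral_inverse_sqrt: "((\<lambda>\<sigma>. 1 / sqrt \<sigma>) has_integral 2) {0..1}"
proof -
  have "((\<lambda>\<sigma>. 1 / sqrt \<sigma>) has_integral 2 * sqrt 1 - 2 * sqrt 0) {0..1}"
    by (rule fundamental_theorem_of_calculus_interior)
       (auto intro!: continuous_intros derivative_eq_intros simp: has_real_derivative_iff_has_vector_derivative[symmetric] field_simps)
  then show ?thesis by simp
qed

lemma nn_integral_inverse_sqrt: "(\<integral>\<^sup>+\<sigma>. indicator {0<..1} \<sigma> * (1 / sqrt \<sigma>) \<partial>lborel) = ennreal 2"
proof (rule nn_integral_has_integral_lborel)
  have "((\<lambda>\<sigma>. if \<sigma> \<in> {0..1} then 1 / sqrt \<sigma> else 0) has_integral 2) UNIV"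
    using has_integral_inverse_sqrt by (subst has_integral_restrict_UNIV)
  then show "((\<lambda>\<sigma>::real. indicator {0<..1} \<sigma> * (1 / sqrt \<sigma>)) has_integral 2) UNIV"
    by (rule has_integral_eq[rotated]) (auto simp: indicator_def)
qed (auto simp: indicator_def)

lemma arctan_kernel_inner:
  assumes "0 \<le> p" "0 \<le> r"
  shows "integrable lborel (arctan_kernel p r t)" "(\<integral>\<sigma>. arctan_kernel p r t \<sigma> \<partial>lborel) \<le> 2"
proof -
  have i: "integrable lborel (\<lambda>\<sigma>. indicator {0<..1} \<sigma> * (1 / sqrt \<sigma>))"
    and v: "(\<integral>\<sigma>. indicator {0<..1} \<sigma> * (1 / sqrt \<sigma>) \<partial>lborel) = 2"
    using nn_integral_eq_integrable[of "\<lambda>\<sigma>. indicator {0<..1} \<sigma> * (1 / sqrt \<sigma>)" lborel 2] nn_integral_inverse_sqrt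
    by (auto simp: indicator_def)
  have le: "arctan_kernel p r t \<sigma> \<le> indicator {0<..1} \<sigma> * (1 / sqrt \<sigma>)" for \<sigma>
    using assms by (auto simp: arctan_kernel_def indicator_def intro!: divide_right_mono)
  show *: "integrable lborel (arctan_kernel p r t)"
  proof (rule Bochner_Integration.integrable_bound[OF i _ AE_I2])
    show "norm (arctan_kernel p r t \<sigma>) \<le> norm (indicator {0<..1} \<sigma> * (1 / sqrt \<sigma>))" for \<sigma>
      unfolding real_norm_def abs_of_nonneg[OF arctan_kernel_nonneg]
      by (rule order.trans[OF le abs_ge_self])
  qed measurable
  show "(\<integral>\<sigma>. arctan_kernel p r t \<sigma> \<partial>lborel) \<le> 2"
    unfolding v[symmetric] by (intro integral_mono * i le)
qed

text \<open>Integrating over t first leaves 1 / (2 pi (p + r \<sigma>) sqrt \<sigma>), which has the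
  antiderivative arctan (sqrt (r \<sigma> / p)) / (pi sqrt (p r)). The integrand is nonnegative, so
  the change of order needs no prior integrability.\<close>

lemma arctan_kernel_outer:
  assumes p: "0 < p" and r: "0 < r"
  shows "integrable lborel (\<lambda>t. \<integral>\<sigma>. arctan_kernel p r t \<sigma> \<partial>lborel)"
    and "(\<integral>t. \<integral>\<sigma>. arctan_kernel p r t \<sigma> \<partial>lborel \<partial>lborel) = arctan (sqrt r / sqrt p) / (pi * (sqrt p * sqrt r))"
proof -
  define V where "V = arctan (sqrt r / sqrt p) / (pi * (sqrt p * sqrt r))"
  have V: "0 \<le> V" unfolding V_def using p r by (intro divide_nonneg_nonneg) auto
  have ex: "(\<integral>\<^sup>+t. ennreal (exp (- (k * t))) * indicator {0..} t \<partial>lborel) = ennreal (1 / k)"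
    if k: "0 < k" for k :: real
  proof -
    have "((\<lambda>t. - (exp (- (k * t)) / k)) \<longlongrightarrow> 0) at_top"
      using k by real_asymp
    then have "(\<integral>\<^sup>+t. ennreal (exp (- (k * t))) * indicator {0..} t \<partial>lborel) = ennreal (0 - - (exp (- (k * 0)) / k))"
      using k by (intro nn_integral_FTC_atLeast) (auto intro!: derivative_eq_intros)
    then show ?thesis by simp
  qed
  have inner: "(\<integral>\<^sup>+t. ennreal (arctan_kernel p r t \<sigma>) \<partial>lborel)
      = ennreal (indicator {0<..1} \<sigma> * (1 / (2 * pi * (p + r * \<sigma>) * sqrt \<sigma>)))" for \<sigma>
  proof (cases "\<sigma> \<in> {0<..1}")
    case False
    then show ?thesis by (simp add: arctan_kernel_def)
  next
    case True
    then have s: "0 < \<sigma>" by simp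
    then have k: "0 < 2 * pi * (p + r * \<sigma>)" using p r by (intro mult_pos_pos add_pos_pos) auto
    have "(\<integral>\<^sup>+t. ennreal (arctan_kernel p r t \<sigma>) \<partial>lborel)
      = (\<integral>\<^sup>+t. ennreal (1 / sqrt \<sigma>) * (ennreal (exp (- (2 * pi * (p + r * \<sigma>) * t))) * indicator {0..} t) \<partial>lborel)"
    proof (rule nn_integral_cong_AE)
      have "AE t in lborel. t \<noteq> (0::real)" by (rule AE_lborel_singleton)
      then show "AE t in lborel. ennreal (arctan_kernel p r t \<sigma>) =
          ennreal (1 / sqrt \<sigma>) * (ennreal (exp (- (2 * pi * (p + r * \<sigma>) * t))) * indicator {0..} t)"
      proof eventually_elim
        case (elim t)
        have "arctan_kernel p r t \<sigma> = 1 / sqrt \<sigma> * exp (- (2 * pi * (p + r * \<sigma>) * t))" if "0 < t"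
          using True that by (simp add: arctan_kernel_def mult_ac)
        then show ?case using elim s True
          by (cases "0 < t") (auto simp: indicator_def arctan_kernel_def ennreal_mult[symmetric])
      qed
    qed
    also have "\<dots> = ennreal (1 / sqrt \<sigma>) * ennreal (1 / (2 * pi * (p + r * \<sigma>)))"
      by (subst nn_integral_cmult) (auto simp: ex[OF k])
    also have "\<dots> = ennreal (1 / (2 * pi * (p + r * \<sigma>) * sqrt \<sigma>))"
      using s k by (subst ennreal_mult[symmetric]) (auto simp: mult.commute)
    finally show ?thesis using True by simp
  qed
  have hi: "((\<lambda>\<sigma>. 1 / (2 * pi * (p + r * \<sigma>) * sqrt \<sigma>)) has_integral V) {0..1}"
  proof -
    let ?F = "\<lambda>\<sigma>. arctan (sqrt r / sqrt p * sqrt \<sigma>) / (pi * (sqrt p * sqrt r))"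
    have "((\<lambda>\<sigma>. 1 / (2 * pi * (p + r * \<sigma>) * sqrt \<sigma>)) has_integral ?F 1 - ?F 0) {0..1}"
    proof (rule fundamental_theorem_of_calculus_interior)
      show "continuous_on {0..1} ?F" using p r by (intro continuous_intros) auto
      fix \<sigma> :: real assume "\<sigma> \<in> {0<..<1}"
      then have s: "0 < \<sigma>" by simp
      have q: "p + r * \<sigma> > 0" using p r s by (simp add: add_pos_pos)
      have sq: "(sqrt r / sqrt p * sqrt \<sigma>)\<^sup>2 = r * \<sigma> / p"
        using p r s by (simp add: power_mult_distrib power_divide)
      have 1: "((\<lambda>\<sigma>. sqrt r / sqrt p * sqrt \<sigma>) has_real_derivative sqrt r / sqrt p * (inverse (sqrt \<sigma>) / 2)) (at \<sigma>)"
        using s by (intro DERIV_cmult DERIV_real_sqrt)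
      have "(?F has_real_derivative (inverse (1 + (sqrt r / sqrt p * sqrt \<sigma>)\<^sup>2) * (sqrt r / sqrt p * (inverse (sqrt \<sigma>) / 2))) / (pi * (sqrt p * sqrt r))) (at \<sigma>)"
        by (intro DERIV_cdivide DERIV_chain2[OF DERIV_arctan 1])
      moreover have "(inverse (1 + (sqrt r / sqrt p * sqrt \<sigma>)\<^sup>2) * (sqrt r / sqrt p * (inverse (sqrt \<sigma>) / 2))) / (pi * (sqrt p * sqrt r))
          = 1 / (2 * pi * (p + r * \<sigma>) * sqrt \<sigma>)"
      proof -
        have pp: "sqrt p * sqrt p = p" using p by simp
        have "inverse (1 + r * \<sigma> / p) = p / (p + r * \<sigma>)" using p q by (simp add: field_simps)
        then have "(inverse (1 + (sqrt r / sqrt p * sqrt \<sigma>)\<^sup>2) * (sqrt r / sqrt p * (inverse (sqrt \<sigma>) / 2))) / (pi * (sqrt p * sqrt r))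
           = (p / (p + r * \<sigma>)) * (1 / (2 * sqrt \<sigma>)) / (pi * (sqrt p * sqrt p))"
          unfolding sq using p r s by (simp add: divide_simps)
        also have "\<dots> = 1 / (2 * pi * (p + r * \<sigma>) * sqrt \<sigma>)"
          unfolding pp using p q s by (simp add: divide_simps)
        finally show ?thesis .
      qed
      ultimately show "(?F has_vector_derivative 1 / (2 * pi * (p + r * \<sigma>) * sqrt \<sigma>)) (at \<sigma>)"
        by (simp add: has_real_derivative_iff_has_vector_derivative[symmetric])
    qed simp
    then show ?thesis by (simp add: V_def)
  qed
  have hi': "((\<lambda>\<sigma>. indicator {0<..1} \<sigma> * (1 / (2 * pi * (p + r * \<sigma>) * sqrt \<sigma>))) has_integral V) UNIV"
  proof -
    have "((\<lambda>\<sigma>. if \<sigma> \<in> {0..1} then 1 / (2 * pi * (p + r * \<sigma>) * sqrt \<sigma>) else 0) has_integral V) UNIV"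
      using hi by (subst has_integral_restrict_UNIV)
    then show ?thesis by (rule has_integral_eq[rotated]) (auto simp: indicator_def)
  qed
  have "(\<integral>\<^sup>+t. ennreal (\<integral>\<sigma>. arctan_kernel p r t \<sigma> \<partial>lborel) \<partial>lborel)
      = (\<integral>\<^sup>+t. \<integral>\<^sup>+\<sigma>. ennreal (arctan_kernel p r t \<sigma>) \<partial>lborel \<partial>lborel)"
    using arctan_kernel_inner[of p r] p r arctan_kernel_nonneg
    by (intro nn_integral_cong nn_integral_eq_integral[symmetric]) auto
  also have "\<dots> = (\<integral>\<^sup>+\<sigma>. \<integral>\<^sup>+t. ennreal (arctan_kernel p r t \<sigma>) \<partial>lborel \<partial>lborel)"
    by (rule lborel_pair.Fubini') measurable
  also have "\<dots> = (\<integral>\<^sup>+\<sigma>. ennreal (indicator {0<..1} \<sigma> * (1 / (2 * pi * (p + r * \<sigma>) * sqrt \<sigma>))) \<partial>lborel)"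
    by (simp only: inner)
  also have "\<dots> = ennreal V"
    by (rule nn_integral_has_integral_lborel[OF _ _ hi'])
       (use p r in \<open>auto simp: indicator_def intro!: divide_nonneg_nonneg mult_nonneg_nonneg add_nonneg_nonneg\<close>)
  finally have *: "(\<integral>\<^sup>+t. ennreal (\<integral>\<sigma>. arctan_kernel p r t \<sigma> \<partial>lborel) \<partial>lborel) = ennreal V" .
  have "(\<lambda>t. \<integral>\<sigma>. arctan_kernel p r t \<sigma> \<partial>lborel) \<in> borel_measurable lborel"
    by measurable
  then show "integrable lborel (\<lambda>t. \<integral>\<sigma>. arctan_kernel p r t \<sigma> \<partial>lborel)"
    and "(\<integral>t. \<integral>\<sigma>. arctan_kernel p r t \<sigma> \<partial>lborel \<partial>lborel) = arctan (sqrt r / sqrt p) / (pi * (sqrt p * sqrt r))"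
    using * V arctan_kernel_nonneg
      nn_integral_eq_integrable[of "\<lambda>t. \<integral>\<sigma>. arctan_kernel p r t \<sigma> \<partial>lborel" lborel V]
    by (auto simp: V_def[symmetric] intro!: integral_nonneg_AE)
qed


section \<open>Termwise evaluation of double Eichler integrals\<close>

lemma norm_qpow: "norm (qpow \<tau> x) = exp (- (2 * pi * Im \<tau> * x))"
  by (simp add: qpow_def norm_exp_eq_Re)

lemma qpow_add: "qpow \<tau> (x + y) = qpow \<tau> x * qpow \<tau> y"
  by (simp add: qpow_def exp_add[symmetric] algebra_simps)

lemma qpow_shift:
  "qpow (\<tau> + \<i> * of_real t) x = qpow \<tau> x * of_real (exp (- (2 * pi * t * x)))"
proof -
  have "2 * of_real pi * \<i> * (\<tau> + \<i> * of_real t) * of_real x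
      = 2 * of_real pi * \<i> * \<tau> * of_real x + (\<i> * \<i>) * of_real (2 * pi * t * x)"
    by (simp add: algebra_simps)
  then show ?thesis
    unfolding qpow_def by (simp only: exp_add exp_of_real i_times_eq_iff[symmetric] i_squared mult_minus1 of_real_minus[symmetric])
qed

text \<open>Sum and integral are exchanged twice. In the inner integral the kernels contribute at
  most 2, the integral of 1 / sqrt \<sigma>. In the outer one the kernel integrates to a multiple of
  1 / |a b|, which the coefficient a b compensates; its sign turns the arctangent of |b / a| into
  that of b / a.\<close>

lemma eichler_integral_series:
  fixes a b :: "'i \<Rightarrow> real"
  assumes I: "countable I" "infinite I" and tau: "0 < Im \<tau>"
    and summ: "(\<lambda>i. (1 + \<bar>a i * b i\<bar>) * exp (- (2 * pi * Im \<tau> * ((a i)\<^sup>2 + (b i)\<^sup>2)))) summable_on I"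
    and \<Theta>: "\<And>w1 w2. 0 < Im w1 \<Longrightarrow> 0 < Im w2 \<Longrightarrow>
      \<Theta> w1 w2 = (\<Sum>\<^sub>\<infinity>i\<in>I. of_real (a i * b i) * (qpow w1 ((a i)\<^sup>2) * qpow w2 ((b i)\<^sup>2)))"
  shows "eichler_integral \<Theta> \<tau>
           (\<Sum>\<^sub>\<infinity>i\<in>I. of_real (arctan (b i / a i) / pi) * qpow \<tau> ((a i)\<^sup>2 + (b i)\<^sup>2))"
proof -
  define k where "k = (\<lambda>i. of_real (a i * b i) * qpow \<tau> ((a i)\<^sup>2 + (b i)\<^sup>2))"
  define h where "h = (\<lambda>i. arctan_kernel ((a i)\<^sup>2) ((b i)\<^sup>2))"
  define G where "G = (\<lambda>i t. \<integral>\<sigma>. h i t \<sigma> \<partial>lborel)"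
  have h0: "0 \<le> h i t \<sigma>" for i t \<sigma> by (simp add: h_def arctan_kernel_nonneg)
  have hint: "integrable lborel (h i t)" for i t by (simp add: h_def arctan_kernel_inner)
  have G2: "G i t \<le> 2" for i t by (simp add: G_def h_def arctan_kernel_inner)
  have G0: "0 \<le> G i t" for i t unfolding G_def by (intro integral_nonneg_AE AE_I2 h0)
  have Gz: "G i t = 0" if "t \<le> 0" for i t using that by (simp add: G_def h_def arctan_kernel_def)
  have nk: "norm (k i) = \<bar>a i * b i\<bar> * exp (- (2 * pi * Im \<tau> * ((a i)\<^sup>2 + (b i)\<^sup>2)))" for i
    by (simp add: k_def norm_mult norm_qpow abs_mult)
  have ks: "(\<lambda>i. norm (k i)) summable_on I"
    by (rule has_sum_bound_nonneg[OF _ _ summ]) (auto simp: nk algebra_simps abs_mult)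
  have qs: "(\<lambda>i. exp (- (2 * pi * Im \<tau> * ((a i)\<^sup>2 + (b i)\<^sup>2)))) summable_on I"
    by (rule has_sum_bound_nonneg[OF _ _ summ]) (auto simp: algebra_simps)
  have "((\<lambda>\<sigma>. \<Theta> (\<tau> + \<i> * of_real t) (\<tau> + \<i> * of_real (t * \<sigma>)) / of_real (sqrt \<sigma>)) has_integral
      (\<Sum>\<^sub>\<infinity>i\<in>I. k i * of_real (G i t))) {0..1}" if t: "0 < t" for t
  proof -
    let ?f = "\<lambda>i \<sigma>. k i * of_real (h i t \<sigma>)"
    have i1: "integrable lborel (?f i)" for i
      using hint by (intro integrable_mult_right integrable_of_real)
    have i2: "(\<lambda>i. norm (?f i \<sigma>)) summable_on I" for \<sigma>
    proof (rule has_sum_bound_nonneg[OF _ _ summable_on_cmult_left[OF ks, of "\<bar>1 / sqrt \<sigma>\<bar>"]])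
      fix i
      show "0 \<le> norm (?f i \<sigma>)" by simp
      have "h i t \<sigma> \<le> 1 / sqrt \<sigma>" if "0 < \<sigma>"
        using t that by (auto simp: h_def arctan_kernel_def indicator_def intro!: divide_right_mono)
      moreover have "h i t \<sigma> = 0" if "\<sigma> \<le> 0" using that by (simp add: h_def arctan_kernel_def)
      ultimately have "h i t \<sigma> \<le> \<bar>1 / sqrt \<sigma>\<bar>" by (cases "0 < \<sigma>") auto
      then show "norm (?f i \<sigma>) \<le> norm (k i) * \<bar>1 / sqrt \<sigma>\<bar>"
        unfolding norm_mult norm_of_real abs_of_nonneg[OF h0] by (rule mult_left_mono) simp
    qed
    have i3: "(\<lambda>i. \<integral>\<sigma>. norm (?f i \<sigma>) \<partial>lborel) summable_on I"
    proof (rule has_sum_bound_nonneg[OF _ _ summable_on_cmult_left[OF ks, of 2]])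
      fix i
      have "(\<integral>\<sigma>. norm (?f i \<sigma>) \<partial>lborel) = norm (k i) * G i t"
        using h0 by (simp add: norm_mult G_def)
      then show "(\<integral>\<sigma>. norm (?f i \<sigma>) \<partial>lborel) \<le> norm (k i) * 2"
        using G2 by (simp add: mult_left_mono)
    qed (auto intro!: integral_nonneg_AE)
    have *: "integrable lborel (\<lambda>\<sigma>. \<Sum>\<^sub>\<infinity>i\<in>I. ?f i \<sigma>)"
      "(\<integral>\<sigma>. (\<Sum>\<^sub>\<infinity>i\<in>I. ?f i \<sigma>) \<partial>lborel) = (\<Sum>\<^sub>\<infinity>i\<in>I. \<integral>\<sigma>. ?f i \<sigma> \<partial>lborel)"
      using integral_infsum_lebesgue[OF I i1 i2 i3] by auto
    have v: "(\<integral>\<sigma>. ?f i \<sigma> \<partial>lborel) = k i * of_real (G i t)" for i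
      by (simp add: G_def)
    have "((\<lambda>\<sigma>. \<Sum>\<^sub>\<infinity>i\<in>I. ?f i \<sigma>) has_integral (\<Sum>\<^sub>\<infinity>i\<in>I. k i * of_real (G i t))) UNIV"
      using has_integral_integral_lborel[OF *(1)] unfolding *(2) v .
    also have "(\<lambda>\<sigma>. \<Sum>\<^sub>\<infinity>i\<in>I. ?f i \<sigma>) = (\<lambda>\<sigma>. if \<sigma> \<in> {0..1} then
        \<Theta> (\<tau> + \<i> * of_real t) (\<tau> + \<i> * of_real (t * \<sigma>)) / of_real (sqrt \<sigma>) else 0)"
    proof
      fix \<sigma> :: real
      show "(\<Sum>\<^sub>\<infinity>i\<in>I. ?f i \<sigma>) = (if \<sigma> \<in> {0..1} then
        \<Theta> (\<tau> + \<i> * of_real t) (\<tau> + \<i> * of_real (t * \<sigma>)) / of_real (sqrt \<sigma>) else 0)"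
      proof (cases "\<sigma> \<in> {0<..1}")
        case False
        then have "h i t \<sigma> = 0" for i by (simp add: h_def arctan_kernel_def)
        then show ?thesis using False by (cases "\<sigma> = 0") auto
      next
        case True
        have "0 < Im (\<tau> + \<i> * of_real t)" "0 < Im (\<tau> + \<i> * of_real (t * \<sigma>))"
          using tau t True by (simp_all add: add_pos_pos)
        from \<Theta>[OF this]
        have "\<Theta> (\<tau> + \<i> * of_real t) (\<tau> + \<i> * of_real (t * \<sigma>)) / of_real (sqrt \<sigma>)
          = (\<Sum>\<^sub>\<infinity>i\<in>I. of_real (a i * b i) * (qpow (\<tau> + \<i> * of_real t) ((a i)\<^sup>2)
              * qpow (\<tau> + \<i> * of_real (t * \<sigma>)) ((b i)\<^sup>2)) * (1 / of_real (sqrt \<sigma>)))"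
          by (simp only: infsum_cmult_left') simp
        also have "\<dots> = (\<Sum>\<^sub>\<infinity>i\<in>I. ?f i \<sigma>)"
        proof (rule infsum_cong)
          fix i
          have "h i t \<sigma> = exp (- (2 * pi * t * (a i)\<^sup>2)) * exp (- (2 * pi * (t * \<sigma>) * (b i)\<^sup>2)) * (1 / sqrt \<sigma>)"
            using True t by (simp add: h_def arctan_kernel_def exp_add[symmetric] algebra_simps)
          then show "of_real (a i * b i) * (qpow (\<tau> + \<i> * of_real t) ((a i)\<^sup>2)
              * qpow (\<tau> + \<i> * of_real (t * \<sigma>)) ((b i)\<^sup>2)) * (1 / of_real (sqrt \<sigma>)) = ?f i \<sigma>"
            unfolding qpow_shift k_def qpow_add by (simp add: mult_ac)
        qed
        finally show ?thesis using True by simp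
      qed
    qed
    finally show ?thesis by (simp only: has_integral_restrict_UNIV)
  qed
  moreover have "((\<lambda>t. \<Sum>\<^sub>\<infinity>i\<in>I. k i * of_real (G i t)) has_integral
      (\<Sum>\<^sub>\<infinity>i\<in>I. of_real (arctan (b i / a i) / pi) * qpow \<tau> ((a i)\<^sup>2 + (b i)\<^sup>2))) {0<..}"
  proof -
    let ?f = "\<lambda>i t. k i * of_real (G i t)"
    have nz: "integrable lborel (G i) \<and> \<bar>a i * b i\<bar> * (\<integral>t. G i t \<partial>lborel) = \<bar>arctan (b i / a i)\<bar> / pi
        \<and> a i * b i * (\<integral>t. G i t \<partial>lborel) = arctan (b i / a i) / pi"
      if "a i \<noteq> 0" "b i \<noteq> 0" for i
    proof -
      have 1: "integrable lborel (G i)" "(\<integral>t. G i t \<partial>lborel) = arctan (\<bar>b i\<bar> / \<bar>a i\<bar>) / (pi * (\<bar>a i\<bar> * \<bar>b i\<bar>))"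
        using arctan_kernel_outer[of "(a i)\<^sup>2" "(b i)\<^sup>2"] that by (auto simp: G_def h_def)
      have 2: "arctan (\<bar>b i\<bar> / \<bar>a i\<bar>) = \<bar>arctan (b i / a i)\<bar>"
        by (metis abs_arctan abs_divide)
      have "\<bar>a i * b i\<bar> * (\<integral>t. G i t \<partial>lborel) = \<bar>arctan (b i / a i)\<bar> / pi"
        unfolding 1 2 abs_mult using that by simp
      moreover have "a i * b i * (\<integral>t. G i t \<partial>lborel) = arctan (b i / a i) / pi"
      proof -
        have "sgn (a i * b i) * \<bar>arctan (b i / a i)\<bar> = arctan (b i / a i)"
          using that by (cases "0 < a i"; cases "0 < b i") (simp_all add: sgn_mult abs_if divide_less_0_iff)
        moreover have "a i * b i = sgn (a i * b i) * \<bar>a i * b i\<bar>" by (simp only: sgn_mult_abs)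
        ultimately show ?thesis using \<open>\<bar>a i * b i\<bar> * (\<integral>t. G i t \<partial>lborel) = \<bar>arctan (b i / a i)\<bar> / pi\<close>
          by (metis mult.assoc times_divide_eq_right)
      qed
      ultimately show ?thesis using 1 by blast
    qed
    \<comment> \<open>If a i = 0 then b i / a i is 0 by the convention for division, so the
      arctangent vanishes together with the coefficient.\<close>
    have z: "k i = 0 \<and> arctan (b i / a i) = 0" if "\<not> (a i \<noteq> 0 \<and> b i \<noteq> 0)" for i
      using that by (auto simp: k_def)
    have i1: "integrable lborel (?f i)" for i
      using nz[of i] z[of i] by (cases "a i \<noteq> 0 \<and> b i \<noteq> 0") (auto intro!: integrable_mult_right integrable_of_real)
    have i2: "(\<lambda>i. norm (?f i t)) summable_on I" for t
      by (rule has_sum_bound_nonneg[OF _ _ summable_on_cmult_left[OF ks, of 2]])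
         (use G0 G2 in \<open>auto simp: norm_mult intro!: mult_left_mono\<close>)
    have val: "(\<integral>t. norm (?f i t) \<partial>lborel) = exp (- (2 * pi * Im \<tau> * ((a i)\<^sup>2 + (b i)\<^sup>2))) * (\<bar>arctan (b i / a i)\<bar> / pi)" for i
    proof (cases "a i \<noteq> 0 \<and> b i \<noteq> 0")
      case True
      have "(\<integral>t. norm (?f i t) \<partial>lborel) = norm (k i) * (\<integral>t. G i t \<partial>lborel)"
        using G0 by (simp add: norm_mult)
      also have "\<dots> = exp (- (2 * pi * Im \<tau> * ((a i)\<^sup>2 + (b i)\<^sup>2))) * (\<bar>a i * b i\<bar> * (\<integral>t. G i t \<partial>lborel))"
        unfolding nk by (simp only: mult_ac)
      finally show ?thesis using nz[of i] True by simp
    qed (use z in auto)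
    have i3: "(\<lambda>i. \<integral>t. norm (?f i t) \<partial>lborel) summable_on I"
    proof (rule has_sum_bound_nonneg[OF _ _ qs])
      fix i
      have "\<bar>arctan (b i / a i)\<bar> < pi / 2" using arctan_bounded[of "b i / a i"] by linarith
      then have "\<bar>arctan (b i / a i)\<bar> / pi \<le> 1" by (simp add: field_simps)
      then show "(\<integral>t. norm (?f i t) \<partial>lborel) \<le> exp (- (2 * pi * Im \<tau> * ((a i)\<^sup>2 + (b i)\<^sup>2)))"
        unfolding val by (rule mult_left_le) simp
    qed (auto intro!: integral_nonneg_AE)
    have *: "integrable lborel (\<lambda>t. \<Sum>\<^sub>\<infinity>i\<in>I. ?f i t)"
      "(\<integral>t. (\<Sum>\<^sub>\<infinity>i\<in>I. ?f i t) \<partial>lborel) = (\<Sum>\<^sub>\<infinity>i\<in>I. \<integral>t. ?f i t \<partial>lborel)"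
      using integral_infsum_lebesgue[OF I i1 i2 i3] by auto
    have v: "(\<integral>t. ?f i t \<partial>lborel) = of_real (arctan (b i / a i) / pi) * qpow \<tau> ((a i)\<^sup>2 + (b i)\<^sup>2)" for i
    proof (cases "a i \<noteq> 0 \<and> b i \<noteq> 0")
      case True
      have "(\<integral>t. ?f i t \<partial>lborel) = k i * of_real (\<integral>t. G i t \<partial>lborel)" by simp
      also have "\<dots> = of_real (a i * b i * (\<integral>t. G i t \<partial>lborel)) * qpow \<tau> ((a i)\<^sup>2 + (b i)\<^sup>2)"
        unfolding k_def by (simp only: of_real_mult mult_ac)
      finally show ?thesis using nz[of i] True by simp
    qed (use z in auto)
    have "((\<lambda>t. \<Sum>\<^sub>\<infinity>i\<in>I. ?f i t) has_integral (\<Sum>\<^sub>\<infinity>i\<in>I. of_real (arctan (b i / a i) / pi) * qpow \<tau> ((a i)\<^sup>2 + (b i)\<^sup>2))) UNIV"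
      using has_integral_integral_lborel[OF *(1)] unfolding *(2) v .
    also have "(\<lambda>t. \<Sum>\<^sub>\<infinity>i\<in>I. ?f i t) = (\<lambda>t. if t \<in> {0<..} then \<Sum>\<^sub>\<infinity>i\<in>I. ?f i t else 0)"
      by (auto simp: fun_eq_iff Gz)
    finally show ?thesis by (simp only: has_integral_restrict_UNIV)
  qed
  ultimately show ?thesis by (rule eichler_integralI)
qed

subsection \<open>Derivatives of unary theta functions\<close>

lemma summable_on_gauss_shift:
  fixes k L s :: real
  assumes k: "0 < k"
  shows "(\<lambda>j::int. exp (- k * (of_int j + s)\<^sup>2 + L * \<bar>of_int j + s\<bar>)) summable_on UNIV"
proof -
  \<comment> \<open>The fraction is the maximum of -k x^2 + (|L| + 1) x; the extra 1 leaves room for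
    the decay exp (-|j|).\<close>
  define C where "C = (\<bar>L\<bar> + 1)\<^sup>2 / (4 * k) + \<bar>s\<bar>"
  have le: "- k * (of_int j + s)\<^sup>2 + L * \<bar>of_int j + s\<bar> \<le> C - \<bar>real_of_int j\<bar>" for j :: int
  proof -
    define x where "x = \<bar>of_int j + s\<bar>"
    have x0: "0 \<le> x" by (simp add: x_def)
    have "\<bar>real_of_int j\<bar> \<le> x + \<bar>s\<bar>" unfolding x_def by linarith
    moreover have "- k * x\<^sup>2 + (\<bar>L\<bar> + 1) * x \<le> (\<bar>L\<bar> + 1)\<^sup>2 / (4 * k)"
    proof -
      have "0 \<le> (2 * k * x - (\<bar>L\<bar> + 1))\<^sup>2" by simp
      then have "4 * k * (- k * x\<^sup>2 + (\<bar>L\<bar> + 1) * x) \<le> (\<bar>L\<bar> + 1)\<^sup>2"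
        by (simp add: power2_eq_square algebra_simps)
      then show ?thesis using k by (simp add: field_simps)
    qed
    moreover have "L * x \<le> \<bar>L\<bar> * x" using x0 by (intro mult_right_mono) auto
    moreover have "(of_int j + s)\<^sup>2 = x\<^sup>2" by (simp add: x_def)
    ultimately show ?thesis unfolding C_def x_def[symmetric] by (simp add: algebra_simps)
  qed
  show ?thesis
  proof (rule has_sum_bound_nonneg)
    show "(\<lambda>j::int. exp C * exp (- 1 * \<bar>real_of_int j\<bar>)) summable_on UNIV"
      by (intro summable_on_cmult_right summable_on_exp_abs_int) simp
    show "exp (- k * (of_int j + s)\<^sup>2 + L * \<bar>of_int j + s\<bar>) \<le> exp C * exp (- 1 * \<bar>real_of_int j\<bar>)" for j :: int
      using le[of j] by (simp add: exp_add[symmetric])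
  qed simp
qed

lemma unary_theta_eq:
  assumes "0 < m"
  shows "unary_theta m r z \<tau> = (\<Sum>\<^sub>\<infinity>j::int. qpow \<tau> (real m * (of_int j + of_int r / (2 * real m))\<^sup>2)
           * exp (4 * of_real pi * \<i> * of_nat m * of_real (of_int j + of_int r / (2 * real m)) * z))"
proof -
  have "{of_int j + of_int r / (2 * real m) | j :: int. True} = range (\<lambda>j::int. of_int j + of_int r / (2 * real m))"
    by auto
  moreover have "inj (\<lambda>j::int. of_int j + of_int r / (2 * real m))" by (auto simp: inj_def)
  ultimately show ?thesis
    unfolding unary_theta_def by (simp only: infsum_reindex o_def)
qed

text \<open>The Gaussian decay beats the exponential growth in z uniformly on the unit disc, so the
  series may be differentiated termwise; the factor 4 pi \<i> m cancels the normalisation.\<close>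

lemma unary_theta_deriv_1_eq:
  assumes m: "0 < m" and tau: "0 < Im \<tau>"
  shows "unary_theta_deriv 1 m r \<tau> = (\<Sum>\<^sub>\<infinity>j::int. of_real (of_int j + of_int r / (2 * real m))
           * qpow \<tau> (real m * (of_int j + of_int r / (2 * real m))\<^sup>2))"
proof -
  define s where "s = of_int r / (2 * real m)"
  define c where "c = 4 * of_real pi * \<i> * of_nat m"
  have c0: "c \<noteq> 0" using m by (simp add: c_def)
  have nc: "norm c = 4 * pi * m" by (simp add: c_def norm_mult)
  define f where "f = (\<lambda>(j::int) z. qpow \<tau> (real m * (of_int j + s)\<^sup>2) * exp (c * of_real (of_int j + s) * z))"
  define g where "g = (\<lambda>z. \<Sum>\<^sub>\<infinity>j. f j z)"
  have g: "unary_theta m r z \<tau> = g z" for z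
    unfolding g_def f_def unary_theta_eq[OF m] s_def c_def by simp
  have bd: "norm (f j z) \<le> exp (- (2 * pi * Im \<tau> * real m) * (of_int j + s)\<^sup>2 + 4 * pi * m * \<bar>of_int j + s\<bar>)"
    if "z \<in> cball 0 1" for j z
  proof -
    have "Re (c * of_real (of_int j + s) * z) \<le> norm (c * of_real (of_int j + s) * z)" by (rule complex_Re_le_cmod)
    also have "\<dots> = 4 * pi * m * \<bar>of_int j + s\<bar> * norm z" by (simp only: norm_mult nc norm_of_real)
    also have "\<dots> \<le> 4 * pi * m * \<bar>of_int j + s\<bar> * 1" using that by (intro mult_left_mono) auto
    finally show ?thesis
      unfolding f_def norm_mult norm_qpow norm_exp_eq_Re exp_add[symmetric] by (simp add: algebra_simps)
  qed
  let ?F = "finite_subsets_at_top (UNIV :: int set)"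
  have ul: "uniform_limit (cball 0 1) (\<lambda>X z. \<Sum>j\<in>X. f j z) g ?F"
    unfolding g_def
  proof (rule Weierstrass_m_test_general[OF bd])
    show "(\<lambda>j. exp (- (2 * pi * Im \<tau> * real m) * (of_int j + s)\<^sup>2 + 4 * pi * m * \<bar>of_int j + s\<bar>)) summable_on UNIV"
      by (rule summable_on_gauss_shift) (use m tau in simp)
  qed
  have df: "(f j has_field_derivative c * of_real (of_int j + s) * f j z) (at z)" for j z
    unfolding f_def by (auto intro!: derivative_eq_intros simp: algebra_simps)
  have dF: "((\<lambda>z. \<Sum>j\<in>X. f j z) has_field_derivative (\<Sum>j\<in>X. c * of_real (of_int j + s) * f j z)) (at z)" for X z
    by (intro DERIV_sum df)
  have cF: "continuous_on (cball 0 1) (\<lambda>z. \<Sum>j\<in>X. f j z)" for X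
    by (rule DERIV_continuous_on[OF has_field_derivative_at_within[OF dF]])
  obtain g' where g': "\<And>z. z \<in> ball 0 1 \<Longrightarrow> (g has_field_derivative g' z) (at z) \<and>
      ((\<lambda>X. \<Sum>j\<in>X. c * of_real (of_int j + s) * f j z) \<longlongrightarrow> g' z) ?F"
  proof (rule has_complex_derivative_uniform_limit[OF _ ul, where f' = "\<lambda>X z. \<Sum>j\<in>X. c * of_real (of_int j + s) * f j z"])
    show "\<forall>\<^sub>F X in ?F. continuous_on (cball 0 1) (\<lambda>z. \<Sum>j\<in>X. f j z) \<and>
        (\<forall>w\<in>ball 0 1. ((\<lambda>z. \<Sum>j\<in>X. f j z) has_field_derivative (\<Sum>j\<in>X. c * of_real (of_int j + s) * f j w)) (at w))"
      by (intro always_eventually allI conjI ballI dF cF)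
    fix h assume "\<And>w. w \<in> ball 0 1 \<Longrightarrow> (g has_field_derivative h w) (at w) \<and>
      ((\<lambda>X. \<Sum>j\<in>X. c * of_real (of_int j + s) * f j w) \<longlongrightarrow> h w) ?F"
    then show thesis by (rule that)
  qed simp_all
  from g'[of 0] have d: "deriv g 0 = g' 0" and "((\<lambda>j. c * of_real (of_int j + s) * f j 0) has_sum g' 0) UNIV"
    by (auto simp: DERIV_imp_deriv has_sum_def)
  then have "deriv g 0 = (\<Sum>\<^sub>\<infinity>j. c * of_real (of_int j + s) * f j 0)" by (simp add: infsumI)
  also have "\<dots> = c * (\<Sum>\<^sub>\<infinity>j. of_real (of_int j + s) * f j 0)"
    by (simp only: mult.assoc infsum_cmult_right')
  finally show ?thesis
    unfolding unary_theta_deriv_def g s_def[symmetric] c_def[symmetric] using c0 by (simp add: f_def)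
qed

text \<open>The summation index n scaled by sqrt m, so that m n^2 becomes a square, the shape
  required by \<open>eichler_integral_series\<close>.\<close>

definition theta_exponents :: "nat \<Rightarrow> int \<Rightarrow> int \<Rightarrow> real" where
  "theta_exponents m r j = sqrt m * (of_int j + of_int r / (2 * real m))"

lemma eichler_integral_unary:
  assumes m: "0 < m" "0 < m'" and tau: "0 < Im \<tau>"
  shows "eichler_integral (\<lambda>w1 w2. of_real (sqrt m * sqrt m') * (unary_theta_deriv 1 m r w1 * unary_theta_deriv 1 m' r' w2)) \<tau>
    (\<Sum>\<^sub>\<infinity>(i, j)\<in>UNIV. of_real (arctan (theta_exponents m' r' j / theta_exponents m r i) / pi)
        * qpow \<tau> ((theta_exponents m r i)\<^sup>2 + (theta_exponents m' r' j)\<^sup>2))"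
proof -
  let ?a = "theta_exponents m r" and ?b = "theta_exponents m' r'"
  have sq: "(theta_exponents m r i)\<^sup>2 = real m * (of_int i + of_int r / (2 * real m))\<^sup>2" for m r i
    by (simp add: theta_exponents_def power_mult_distrib)
  have gs: "(\<lambda>i. exp \<bar>theta_exponents m r i\<bar> * exp (- (2 * pi * y * (theta_exponents m r i)\<^sup>2))) summable_on UNIV"
    if "0 < m" "0 < y" for m r y
  proof -
    have "(\<lambda>j::int. exp (- (2 * pi * y * m) * (of_int j + of_int r / (2 * real m))\<^sup>2 + sqrt m * \<bar>of_int j + of_int r / (2 * real m)\<bar>)) summable_on UNIV"
      using that by (intro summable_on_gauss_shift) auto
    moreover have "exp \<bar>theta_exponents m r i\<bar> * exp (- (2 * pi * y * (theta_exponents m r i)\<^sup>2))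
      = exp (- (2 * pi * y * m) * (of_int i + of_int r / (2 * real m))\<^sup>2 + sqrt m * \<bar>of_int i + of_int r / (2 * real m)\<bar>)" for i
      unfolding sq exp_add[symmetric] unfolding theta_exponents_def abs_mult by simp
    ultimately show ?thesis by (simp only:)
  qed
  have th: "unary_theta_deriv 1 m r w * of_real (sqrt m) = (\<Sum>\<^sub>\<infinity>i. of_real (theta_exponents m r i) * qpow w ((theta_exponents m r i)\<^sup>2))"
    and abs: "(\<lambda>i. norm (of_real (theta_exponents m r i) * qpow w ((theta_exponents m r i)\<^sup>2))) summable_on UNIV"
    if "0 < m" "0 < Im w" for m r w
  proof -
    show "unary_theta_deriv 1 m r w * of_real (sqrt m) = (\<Sum>\<^sub>\<infinity>i. of_real (theta_exponents m r i) * qpow w ((theta_exponents m r i)\<^sup>2))"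
      unfolding unary_theta_deriv_1_eq[OF that] sq
      by (subst infsum_cmult_left'[symmetric]) (simp add: theta_exponents_def mult_ac)
    show "(\<lambda>i. norm (of_real (theta_exponents m r i) * qpow w ((theta_exponents m r i)\<^sup>2))) summable_on UNIV"
    proof (rule has_sum_bound_nonneg[OF _ _ gs[OF that, of r]])
      fix i
      have "\<bar>theta_exponents m r i\<bar> \<le> exp \<bar>theta_exponents m r i\<bar>"
        using exp_ge_add_one_self[of "\<bar>theta_exponents m r i\<bar>"] by linarith
      then show "norm (of_real (theta_exponents m r i) * qpow w ((theta_exponents m r i)\<^sup>2))
        \<le> exp \<bar>theta_exponents m r i\<bar> * exp (- (2 * pi * Im w * (theta_exponents m r i)\<^sup>2))"
        unfolding norm_mult norm_qpow norm_of_real by (intro mult_right_mono) auto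
    qed simp
  qed
  have "eichler_integral (\<lambda>w1 w2. of_real (sqrt m * sqrt m') * (unary_theta_deriv 1 m r w1 * unary_theta_deriv 1 m' r' w2)) \<tau>
     (\<Sum>\<^sub>\<infinity>p\<in>UNIV. of_real (arctan (?b (snd p) / ?a (fst p)) / pi) * qpow \<tau> ((?a (fst p))\<^sup>2 + (?b (snd p))\<^sup>2))"
  proof (rule eichler_integral_series[where a = "\<lambda>p. ?a (fst p)" and b = "\<lambda>p. ?b (snd p)", OF _ _ tau])
    show "countable (UNIV :: (int \<times> int) set)" by simp
    show "infinite (UNIV :: (int \<times> int) set)" by (simp add: finite_prod)
    have "(\<lambda>(i, j). (exp \<bar>?a i\<bar> * exp (- (2 * pi * Im \<tau> * (?a i)\<^sup>2))) * (exp \<bar>?b j\<bar> * exp (- (2 * pi * Im \<tau> * (?b j)\<^sup>2)))) summable_on UNIV \<times> UNIV"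
      by (rule summable_on_product_nonneg(1)[OF gs[OF m(1) tau] gs[OF m(2) tau]]) simp_all
    then have *: "(\<lambda>(i, j). (exp \<bar>?a i\<bar> * exp (- (2 * pi * Im \<tau> * (?a i)\<^sup>2))) * (exp \<bar>?b j\<bar> * exp (- (2 * pi * Im \<tau> * (?b j)\<^sup>2)))) summable_on UNIV"
      by (simp only: UNIV_Times_UNIV)
    show "(\<lambda>p. (1 + \<bar>?a (fst p) * ?b (snd p)\<bar>) * exp (- (2 * pi * Im \<tau> * ((?a (fst p))\<^sup>2 + (?b (snd p))\<^sup>2)))) summable_on UNIV"
    proof (rule has_sum_bound_nonneg[OF _ _ *])
      fix p :: "int \<times> int"
      obtain i j where p: "p = (i, j)" by (cases p)
      have "1 + \<bar>x * y\<bar> \<le> exp \<bar>x\<bar> * exp \<bar>y\<bar>" for x y :: real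
      proof -
        have "1 + \<bar>x * y\<bar> \<le> (1 + \<bar>x\<bar>) * (1 + \<bar>y\<bar>)" by (simp add: algebra_simps abs_mult)
        also have "\<dots> \<le> exp \<bar>x\<bar> * exp \<bar>y\<bar>" by (intro mult_mono exp_ge_add_one_self) auto
        finally show ?thesis .
      qed
      then have "(1 + \<bar>?a i * ?b j\<bar>) * exp (- (2 * pi * Im \<tau> * ((?a i)\<^sup>2 + (?b j)\<^sup>2)))
        \<le> exp \<bar>?a i\<bar> * exp \<bar>?b j\<bar> * exp (- (2 * pi * Im \<tau> * ((?a i)\<^sup>2 + (?b j)\<^sup>2)))"
        by (intro mult_right_mono) auto
      also have "\<dots> = (exp \<bar>?a i\<bar> * exp (- (2 * pi * Im \<tau> * (?a i)\<^sup>2))) * (exp \<bar>?b j\<bar> * exp (- (2 * pi * Im \<tau> * (?b j)\<^sup>2)))"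
        by (simp add: exp_add[symmetric] algebra_simps)
      finally show "(1 + \<bar>?a (fst p) * ?b (snd p)\<bar>) * exp (- (2 * pi * Im \<tau> * ((?a (fst p))\<^sup>2 + (?b (snd p))\<^sup>2)))
        \<le> (case p of (i, j) \<Rightarrow> (exp \<bar>?a i\<bar> * exp (- (2 * pi * Im \<tau> * (?a i)\<^sup>2))) * (exp \<bar>?b j\<bar> * exp (- (2 * pi * Im \<tau> * (?b j)\<^sup>2))))"
        unfolding p by simp
    qed simp
    fix w1 w2 assume w: "0 < Im w1" "0 < Im w2"
    have "of_real (sqrt m * sqrt m') * (unary_theta_deriv 1 m r w1 * unary_theta_deriv 1 m' r' w2)
      = (unary_theta_deriv 1 m r w1 * of_real (sqrt m)) * (unary_theta_deriv 1 m' r' w2 * of_real (sqrt m'))"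
      by (simp add: mult_ac)
    also have "\<dots> = (\<Sum>\<^sub>\<infinity>(i, j)\<in>UNIV \<times> UNIV. (of_real (?a i) * qpow w1 ((?a i)\<^sup>2)) * (of_real (?b j) * qpow w2 ((?b j)\<^sup>2)))"
      unfolding th[OF m(1) w(1)] th[OF m(2) w(2)] by (intro infsum_product abs m w)
    finally show "of_real (sqrt m * sqrt m') * (unary_theta_deriv 1 m r w1 * unary_theta_deriv 1 m' r' w2)
      = (\<Sum>\<^sub>\<infinity>p\<in>UNIV. of_real (?a (fst p) * ?b (snd p)) * (qpow w1 ((?a (fst p))\<^sup>2) * qpow w2 ((?b (snd p))\<^sup>2)))"
      by (simp add: case_prod_unfold mult_ac)
  qed
  then show ?thesis by (simp add: case_prod_unfold)
qed

subsection \<open>Rank two false theta functions\<close>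

text \<open>
  With \<open>s = sqrt (M P)\<close> and \<open>X = sqrt (P / M) B u / v\<close> the two arguments are the slopes obtained by
  completing the square in \<open>u\<close> and in \<open>v\<close>; this uses \<open>1 + s\<^sup>2 = A B\<close>.
\<close>

lemma arctan_sum_identity:
  fixes s X :: real
  assumes X: "X \<noteq> 0"
  shows "arctan (s + X) + arctan (s + (1 + s\<^sup>2) / X) = arctan s + sgn X * (pi / 2)"
proof -
  define \<alpha> \<beta> where "\<alpha> = arctan (s + X)" and "\<beta> = arctan s"
  have c: "cos \<alpha> \<noteq> 0" "cos \<beta> \<noteq> 0" by (simp_all add: \<alpha>_def \<beta>_def)
  have t: "sin \<alpha> = (s + X) * cos \<alpha>" "sin \<beta> = s * cos \<beta>"
    using tan_arctan[of "s + X"] tan_arctan[of s] c by (simp_all add: \<alpha>_def \<beta>_def tan_def field_simps)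
  have cs: "cos (\<alpha> - \<beta>) = (1 + s * (s + X)) * (cos \<alpha> * cos \<beta>)" "sin (\<alpha> - \<beta>) = X * (cos \<alpha> * cos \<beta>)"
    by (simp_all add: cos_diff sin_diff t algebra_simps)
  \<comment> \<open>The second argument is the cotangent of \<alpha> - \<beta>, so its arctangent is
    \<alpha> - \<beta> subtracted from plus or minus pi / 2; the sign of X selects the
    branch.\<close>
  have q: "cos (\<alpha> - \<beta>) / sin (\<alpha> - \<beta>) = s + (1 + s\<^sup>2) / X"
    unfolding cs using c X by (simp add: field_simps power2_eq_square)
  have b: "- (pi / 2) < \<alpha>" "\<alpha> < pi / 2" "- (pi / 2) < \<beta>" "\<beta> < pi / 2"
    using arctan_bounded by (auto simp: \<alpha>_def \<beta>_def)
  have "arctan (s + (1 + s\<^sup>2) / X) = sgn X * (pi / 2) - (\<alpha> - \<beta>)"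
  proof (cases "X > 0")
    case True
    then have "\<beta> < \<alpha>" by (simp add: \<alpha>_def \<beta>_def arctan_less_iff)
    moreover have "tan (pi / 2 - (\<alpha> - \<beta>)) = s + (1 + s\<^sup>2) / X"
      unfolding q[symmetric] tan_def by (simp add: sin_diff[of "pi / 2"] cos_diff[of "pi / 2"])
    ultimately have "arctan (s + (1 + s\<^sup>2) / X) = pi / 2 - (\<alpha> - \<beta>)"
      using b by (intro arctan_unique) auto
    then show ?thesis using True by simp
  next
    case False
    then have "\<alpha> < \<beta>" using X by (simp add: \<alpha>_def \<beta>_def arctan_less_iff)
    moreover have "tan (- (pi / 2) - (\<alpha> - \<beta>)) = s + (1 + s\<^sup>2) / X"
      unfolding q[symmetric] tan_def by (simp add: sin_diff[of "- (pi / 2)"] cos_diff[of "- (pi / 2)"])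
    ultimately have "arctan (s + (1 + s\<^sup>2) / X) = - (pi / 2) - (\<alpha> - \<beta>)"
      using b by (intro arctan_unique) auto
    then show ?thesis using False X by simp
  qed
  then show ?thesis by (simp add: \<alpha>_def \<beta>_def)
qed

text \<open>Integers satisfy |n| <= n^2, so the Gaussian is dominated by a geometric series. The
  bound does not depend on the progression.\<close>

lemma summable_on_gauss_progression:
  fixes k :: real and M u0 :: int
  assumes k: "0 < k" and M: "M \<noteq> 0"
  shows "(\<lambda>x::int. exp (- k * (of_int (u0 + 2 * M * x))\<^sup>2)) summable_on UNIV"
    and "(\<Sum>\<^sub>\<infinity>x::int. exp (- k * (of_int (u0 + 2 * M * x))\<^sup>2)) \<le> 2 + 2 / k"
proof -
  let ?u = "\<lambda>x. u0 + 2 * M * x" and ?e = "\<lambda>n::int. exp (- k * \<bar>real_of_int n\<bar>)"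
  have inj: "inj ?u" using M by (auto simp: inj_def)
  have "?e summable_on range ?u"
    by (rule summable_on_subset_banach[OF summable_on_exp_abs_int(1)[OF k]]) auto
  then have s: "(\<lambda>x. ?e (?u x)) summable_on UNIV"
    using summable_on_reindex[OF inj, of ?e] by (simp add: o_def)
  have le: "exp (- k * (of_int n)\<^sup>2) \<le> ?e n" for n :: int
  proof -
    have "\<bar>n\<bar> * 1 \<le> \<bar>n\<bar> * \<bar>n\<bar>"
    proof (cases "n = 0")
      case False
      then have "1 \<le> \<bar>n\<bar>" by linarith
      then show ?thesis by (rule mult_left_mono) simp
    qed simp
    then have "\<bar>n\<bar> \<le> n\<^sup>2" by (simp add: power2_eq_square)
    then have "\<bar>real_of_int n\<bar> \<le> (of_int n)\<^sup>2"
      unfolding of_int_abs[symmetric] of_int_power[symmetric] of_int_le_iff .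
    then show ?thesis using k by simp
  qed
  show s2: "(\<lambda>x::int. exp (- k * (of_int (u0 + 2 * M * x))\<^sup>2)) summable_on UNIV"
    by (rule has_sum_bound_nonneg[OF _ _ s]) (simp, rule le)
  have "(\<Sum>\<^sub>\<infinity>x::int. exp (- k * (of_int (u0 + 2 * M * x))\<^sup>2)) \<le> (\<Sum>\<^sub>\<infinity>x. ?e (?u x))"
    by (rule infsum_mono[OF s2 s]) (rule le)
  also have "\<dots> = infsum ?e (range ?u)" using infsum_reindex[OF inj, of ?e] by (simp add: o_def)
  also have "\<dots> \<le> infsum ?e UNIV"
    by (rule infsum_mono2[OF summable_on_subset_banach[OF summable_on_exp_abs_int(1)[OF k]] summable_on_exp_abs_int(1)[OF k]]) auto
  also have "\<dots> \<le> 2 + 2 / k" by (rule summable_on_exp_abs_int(2)[OF k])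
  finally show "(\<Sum>\<^sub>\<infinity>x::int. exp (- k * (of_int (u0 + 2 * M * x))\<^sup>2)) \<le> 2 + 2 / k" .
qed


definition quad :: "int \<Rightarrow> int \<Rightarrow> int \<Rightarrow> int \<Rightarrow> int \<Rightarrow> int \<Rightarrow> real" where
  "quad M P A B u v = (of_int B * (of_int u)\<^sup>2 / of_int M + 2 * of_int u * of_int v
     + of_int A * (of_int v)\<^sup>2 / of_int P) / 4"

lemma quad_swap: "quad M P A B u v = quad P M B A v u"
  by (simp add: quad_def)

definition false_theta :: "int \<Rightarrow> int \<Rightarrow> int \<Rightarrow> int \<Rightarrow> int \<Rightarrow> int \<Rightarrow> complex \<Rightarrow> complex" where
  "false_theta M P A B u0 v0 \<tau> = (\<Sum>\<^sub>\<infinity>(x, y)\<in>UNIV.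
     of_int (sgn (u0 + 2 * M * x) * sgn (v0 + 2 * P * y)) * qpow \<tau> (quad M P A B (u0 + 2 * M * x) (v0 + 2 * P * y)))"

text \<open>The angle of the point whose coordinates are the signed roots of the two squares in
  \<open>quad_eq\<close>: with u' = B u + M v their quotient is sqrt (P / M) u' / v.\<close>

definition slope_angle :: "int \<Rightarrow> int \<Rightarrow> int \<Rightarrow> int \<Rightarrow> real" where
  "slope_angle M P u' v = arctan (sqrt (of_int M) * sqrt (of_int P) * of_int u' / (of_int M * of_int v))"

lemma abs_slope_angle_le: "\<bar>slope_angle M P u' v\<bar> \<le> pi"
proof -
  have "\<bar>arctan x\<bar> \<le> pi" for x
    using arctan_lbound[of x] arctan_ubound[of x] pi_gt_zero unfolding abs_le_iff by (intro conjI) linarith+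
  then show ?thesis unfolding slope_angle_def .
qed

locale unimodular_form =
  fixes M P A B :: int
  assumes pos: "0 < M" "0 < P" "0 < A" "0 < B" and det: "A * B - M * P = 1"
begin

lemma swapped: "unimodular_form P M B A"
  using pos det by unfold_locales (simp_all add: mult.commute)

text \<open>Completing the square in u leaves v^2 with the coefficient (A B - M P) / (4 P B), and
  the numerator is 1.\<close>

lemma quad_eq:
  "quad M P A B u v = (of_int v)\<^sup>2 / (4 * (of_int P * of_int B))
     + (of_int (B * u + M * v))\<^sup>2 / (4 * (of_int M * of_int B))"
proof -
  have "A * B = M * P + 1" using det by simp
  then have "real_of_int (A * B) = real_of_int (M * P + 1)" by (simp only:)
  then have A: "real_of_int A = (of_int M * of_int P + 1) / of_int B"
    using pos by (simp add: field_simps)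
  show ?thesis
    unfolding quad_def A using pos by (simp add: field_simps power2_eq_square)
qed

text \<open>Each of the two completions of the square bounds the form by the square of one variable
  alone; this is their average.\<close>

lemma quad_lower:
  "quad M P A B u v \<ge> (of_int u)\<^sup>2 / (8 * (of_int M * of_int A)) + (of_int v)\<^sup>2 / (8 * (of_int P * of_int B))"
proof -
  interpret s: unimodular_form P M B A by (rule swapped)
  have "quad M P A B u v \<ge> (of_int v)\<^sup>2 / (4 * (of_int P * of_int B))"
    unfolding quad_eq using pos by simp
  moreover have "quad M P A B u v \<ge> (of_int u)\<^sup>2 / (4 * (of_int M * of_int A))"
    unfolding quad_swap[of M] s.quad_eq using pos by simp
  ultimately show ?thesis by simp
qed

lemma theta_majorant:
  assumes c: "0 < c"
  defines "k \<equiv> c / (8 * (of_int M * of_int A))" and "l \<equiv> c / (8 * (of_int P * of_int B))"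
  shows "(\<lambda>(x, y). exp (- c * quad M P A B (u0 + 2 * M * x) (v0 + 2 * P * y))) summable_on UNIV"
    and "(\<Sum>\<^sub>\<infinity>(x, y)\<in>UNIV. exp (- c * quad M P A B (u0 + 2 * M * x) (v0 + 2 * P * y))) \<le> (2 + 2 / k) * (2 + 2 / l)"
proof -
  have k: "0 < k" and l: "0 < l" using pos c by (simp_all add: k_def l_def)
  let ?f = "\<lambda>(x, y). exp (- c * quad M P A B (u0 + 2 * M * x) (v0 + 2 * P * y))"
  let ?g = "\<lambda>x. exp (- k * (of_int (u0 + 2 * M * x))\<^sup>2)" and ?h = "\<lambda>y. exp (- l * (of_int (v0 + 2 * P * y))\<^sup>2)"
  have g: "?g summable_on UNIV" "infsum ?g UNIV \<le> 2 + 2 / k"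
    using summable_on_gauss_progression[OF k, of M u0] pos by auto
  have h: "?h summable_on UNIV" "infsum ?h UNIV \<le> 2 + 2 / l"
    using summable_on_gauss_progression[OF l, of P v0] pos by auto
  have gh: "(\<lambda>(x, y). ?g x * ?h y) summable_on UNIV" "(\<Sum>\<^sub>\<infinity>(x, y)\<in>UNIV. ?g x * ?h y) = infsum ?g UNIV * infsum ?h UNIV"
    using summable_on_product_nonneg[OF g(1) h(1)] by simp_all
  have le: "?f p \<le> (case p of (x, y) \<Rightarrow> ?g x * ?h y)" for p
  proof -
    obtain x y where p: "p = (x, y)" by (cases p)
    have "c * ((of_int (u0 + 2 * M * x))\<^sup>2 / (8 * (of_int M * of_int A)) + (of_int (v0 + 2 * P * y))\<^sup>2 / (8 * (of_int P * of_int B)))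
      \<le> c * quad M P A B (u0 + 2 * M * x) (v0 + 2 * P * y)"
      using c by (intro mult_left_mono quad_lower) auto
    then show ?thesis
      unfolding p prod.case exp_add[symmetric] exp_le_cancel_iff k_def l_def by (simp add: distrib_left)
  qed
  show s: "?f summable_on UNIV"
    by (rule has_sum_bound_nonneg[OF _ _ gh(1)]) (use le in \<open>auto simp: case_prod_unfold\<close>)
  have "infsum ?f UNIV \<le> (\<Sum>\<^sub>\<infinity>(x, y)\<in>UNIV. ?g x * ?h y)"
    by (rule infsum_mono[OF s gh(1)]) (rule le)
  also have "\<dots> \<le> (2 + 2 / k) * (2 + 2 / l)"
    unfolding gh(2) using g h k l by (intro mult_mono infsum_nonneg) auto
  finally show "infsum ?f UNIV \<le> (2 + 2 / k) * (2 + 2 / l)" .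
qed

lemma summable_theta:
  assumes tau: "0 < Im \<tau>" and C: "\<And>x y. norm (C x y :: complex) \<le> 1"
  shows "(\<lambda>(x, y). C x y * qpow \<tau> (quad M P A B (u0 + 2 * M * x) (v0 + 2 * P * y))) summable_on UNIV"
proof (rule abs_summable_summable, rule has_sum_bound_nonneg)
  show "(\<lambda>(x, y). exp (- (2 * pi * Im \<tau>) * quad M P A B (u0 + 2 * M * x) (v0 + 2 * P * y))) summable_on UNIV"
    using tau by (intro theta_majorant) auto
  fix p :: "int \<times> int"
  obtain x y where p: "p = (x, y)" by (cases p)
  show "norm (case p of (x, y) \<Rightarrow> C x y * qpow \<tau> (quad M P A B (u0 + 2 * M * x) (v0 + 2 * P * y)))
    \<le> (case p of (x, y) \<Rightarrow> exp (- (2 * pi * Im \<tau>) * quad M P A B (u0 + 2 * M * x) (v0 + 2 * P * y)))"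
    unfolding p prod.case norm_mult norm_qpow using mult_right_mono[OF C[of x y]] by simp
qed simp

text \<open>
  When \<open>y\<close> is restricted to a residue class \<open>j\<close> modulo \<open>B\<close>, the two squares \<open>v\<^sup>2\<close> and \<open>(B u + M v)\<^sup>2\<close> of
  \<open>quad_eq\<close> run independently through full residue classes, modulo \<open>2 P B\<close> and \<open>2 M B\<close>.
\<close>

definition eichler_kernel :: "int \<Rightarrow> int \<Rightarrow> complex \<Rightarrow> complex \<Rightarrow> complex" where
  "eichler_kernel u0 v0 w1 w2 = (\<Sum>j\<in>{0..<B}. of_real (sqrt (nat (P * B)) * sqrt (nat (M * B))) *
     (unary_theta_deriv 1 (nat (P * B)) (v0 + 2 * P * j) w1
      * unary_theta_deriv 1 (nat (M * B)) (B * u0 + M * (v0 + 2 * P * j)) w2))"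

lemma eichler_kernel_integral:
  assumes tau: "0 < Im \<tau>"
  shows "eichler_integral (eichler_kernel u0 v0) \<tau>
    (\<Sum>\<^sub>\<infinity>(x, y)\<in>UNIV. of_real (slope_angle M P (B * (u0 + 2 * M * x) + M * (v0 + 2 * P * y)) (v0 + 2 * P * y) / pi)
       * qpow \<tau> (quad M P A B (u0 + 2 * M * x) (v0 + 2 * P * y)))"
proof -
  let ?H = "\<lambda>(x, y). of_real (slope_angle M P (B * (u0 + 2 * M * x) + M * (v0 + 2 * P * y)) (v0 + 2 * P * y) / pi)
       * qpow \<tau> (quad M P A B (u0 + 2 * M * x) (v0 + 2 * P * y))"
  let ?m = "nat (P * B)" and ?m' = "nat (M * B)"
  have m: "0 < ?m" "0 < ?m'" using pos by simp_all
  have rm: "real ?m = of_int P * of_int B" "real ?m' = of_int M * of_int B" using pos by simp_all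
  define r where "r = (\<lambda>j. v0 + 2 * P * j)"
  define r' where "r' = (\<lambda>j. B * u0 + M * (v0 + 2 * P * j))"
  define G where "G = (\<lambda>j. \<Sum>\<^sub>\<infinity>(i, i')\<in>UNIV. of_real (arctan (theta_exponents ?m' (r' j) i' / theta_exponents ?m (r j) i) / pi)
        * qpow \<tau> ((theta_exponents ?m (r j) i)\<^sup>2 + (theta_exponents ?m' (r' j) i')\<^sup>2))"
  have "eichler_integral (\<lambda>w1 w2. \<Sum>j\<in>S. of_real (sqrt ?m * sqrt ?m') * (unary_theta_deriv 1 ?m (r j) w1 * unary_theta_deriv 1 ?m' (r' j) w2)) \<tau>
     (\<Sum>j\<in>S. G j)" if "finite S" for S
    using that
  proof (induction S)
    case empty
    show ?case using eichler_integral_cmult[OF eichler_integral_unary[OF m tau, of 0 0], of 0] by simp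
  next
    case (insert j S)
    show ?case unfolding sum.insert[OF insert(1,2)] G_def
      by (intro eichler_integral_add eichler_integral_unary m tau insert.IH[unfolded G_def])
  qed
  then have "eichler_integral (eichler_kernel u0 v0) \<tau> (\<Sum>j\<in>{0..<B}. G j)"
    unfolding eichler_kernel_def[abs_def] r_def r'_def by simp
  moreover have "(\<Sum>j\<in>{0..<B}. G j) = infsum ?H UNIV"
  proof -
    \<comment> \<open>With x = i' - P i and y = B i + j one gets v = r j + 2 P B i and B u + M v =
      r' j + 2 M B i', so i and i' are independent once the residue j of y modulo B is
      fixed.\<close>
    let ?F = "\<lambda>(j, i, i'). ?H (i' - P * i, B * i + j)"
    have G: "G j = (\<Sum>\<^sub>\<infinity>p\<in>UNIV. ?F (j, p))" for j
      unfolding G_def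
    proof (rule infsum_cong)
      fix p :: "int \<times> int"
      obtain i i' where p: "p = (i, i')" by (cases p)
      define u v where "u = u0 + 2 * M * (i' - P * i)" and "v = v0 + 2 * P * (B * i + j)"
      have n: "of_int i + of_int (r j) / (2 * real ?m) = of_int v / (2 * (of_int P * of_int B))"
        unfolding rm r_def v_def using pos by (simp add: field_simps)
      have n': "of_int i' + of_int (r' j) / (2 * real ?m') = of_int (B * u + M * v) / (2 * (of_int M * of_int B))"
        unfolding rm r'_def u_def v_def using pos by (simp add: field_simps)
      have e: "theta_exponents ?m (r j) i = sqrt (of_int P) * sqrt (of_int B) * (of_int v / (2 * (of_int P * of_int B)))"
        unfolding theta_exponents_def n unfolding rm by (simp add: real_sqrt_mult)
      have e': "theta_exponents ?m' (r' j) i' = sqrt (of_int M) * sqrt (of_int B) * (of_int (B * u + M * v) / (2 * (of_int M * of_int B)))"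
        unfolding theta_exponents_def n' unfolding rm by (simp add: real_sqrt_mult)
      have sq: "(theta_exponents ?m (r j) i)\<^sup>2 + (theta_exponents ?m' (r' j) i')\<^sup>2 = quad M P A B u v"
        unfolding quad_eq e e' using pos by (simp add: power_mult_distrib power_divide power2_eq_square field_simps)
      have "theta_exponents ?m' (r' j) i' / theta_exponents ?m (r j) i
        = sqrt (of_int M) * sqrt (of_int P) * of_int (B * u + M * v) / (of_int M * of_int v)"
      proof -
        have "real_of_int P = sqrt (of_int P) * sqrt (of_int P)" "sqrt (real_of_int P) \<noteq> 0" "sqrt (real_of_int B) \<noteq> 0"
          "real_of_int B \<noteq> 0" "real_of_int M \<noteq> 0"
          using pos by simp_all
        then have "sqrt (of_int M) * sqrt (of_int B) * (x / (2 * (of_int M * of_int B))) / (sqrt (of_int P) * sqrt (of_int B) * (y / (2 * (of_int P * of_int B))))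
          = sqrt (of_int M) * sqrt (of_int P) * x / (of_int M * y)" for x y :: real
          by (cases "y = 0") (auto simp: divide_simps)
        then show ?thesis unfolding e e' by blast
      qed
      then show "(case p of (i, i') \<Rightarrow> of_real (arctan (theta_exponents ?m' (r' j) i' / theta_exponents ?m (r j) i) / pi)
        * qpow \<tau> ((theta_exponents ?m (r j) i)\<^sup>2 + (theta_exponents ?m' (r' j) i')\<^sup>2)) = ?F (j, p)"
        unfolding p prod.case sq u_def[symmetric] v_def[symmetric] slope_angle_def by simp
    qed
    have bij: "bij_betw (\<lambda>(j, i, i'). (i' - P * i, B * i + j)) ({0..<B} \<times> UNIV) UNIV"
    proof (rule bij_betw_byWitness[where f' = "\<lambda>(x, y). (y mod B, y div B, x + P * (y div B))"])
      show "\<forall>a\<in>{0..<B} \<times> UNIV. (case case a of (j, i, i') \<Rightarrow> (i' - P * i, B * i + j) of (x, y) \<Rightarrow> (y mod B, y div B, x + P * (y div B))) = a"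
        using pos by auto
    qed (use pos in auto)
    have Hs: "?H summable_on UNIV"
    proof (rule summable_theta[OF tau])
      fix x y
      show "norm (of_real (slope_angle M P (B * (u0 + 2 * M * x) + M * (v0 + 2 * P * y)) (v0 + 2 * P * y) / pi) :: complex) \<le> 1"
        using abs_slope_angle_le by (simp only: norm_of_real abs_divide) simp
    qed
    have Fs: "?F summable_on ({0..<B} \<times> UNIV)"
      using summable_on_reindex_bij_betw[OF bij, of ?H] Hs by (simp add: case_prod_unfold)
    have "infsum ?H UNIV = infsum ?F ({0..<B} \<times> UNIV)"
      using infsum_reindex_bij_betw[OF bij, of ?H] by (simp add: case_prod_unfold)
    also have "\<dots> = (\<Sum>\<^sub>\<infinity>j\<in>{0..<B}. \<Sum>\<^sub>\<infinity>p\<in>UNIV. ?F (j, p))"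
      using infsum_Sigma_banach[OF Fs] by simp
    also have "\<dots> = (\<Sum>j\<in>{0..<B}. G j)" unfolding G by simp
    finally show ?thesis by simp
  qed
  ultimately show ?thesis by (simp only:)
qed

end

section \<open>Linear combinations of theta functions and of their Eichler integrals\<close>

lemma sum_lessThan_append:
  fixes f :: "nat \<Rightarrow> 'a :: comm_monoid_add"
  shows "sum f {..<m + n} = sum f {..<m} + (\<Sum>i<n. f (m + i))"
  by (induction n) (simp_all add: add.assoc)

lemma comb_of_unary_theta_deriv_products_add:
  assumes "comb_of_unary_theta_deriv_products \<Theta>" "comb_of_unary_theta_deriv_products \<Theta>'"
  shows "comb_of_unary_theta_deriv_products (\<lambda>w1 w2. \<Theta> w1 w2 + \<Theta>' w1 w2)"
proof -
  obtain N c k m r k' m' r' where 1: "\<And>i. i < N \<Longrightarrow> 0 < k i \<and> 0 < m i \<and> 0 < k' i \<and> 0 < m' i"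
    "\<And>w1 w2. w1 \<in> upper_half_plane \<Longrightarrow> w2 \<in> upper_half_plane \<Longrightarrow>
       \<Theta> w1 w2 = (\<Sum>i<(N::nat). c i * unary_theta_deriv (k i) (m i) (r i) w1 * unary_theta_deriv (k' i) (m' i) (r' i) w2)"
    using assms(1) unfolding comb_of_unary_theta_deriv_products_def by blast
  obtain N2 c2 k2 m2 r2 k2' m2' r2' where 2: "\<And>i. i < N2 \<Longrightarrow> 0 < k2 i \<and> 0 < m2 i \<and> 0 < k2' i \<and> 0 < m2' i"
    "\<And>w1 w2. w1 \<in> upper_half_plane \<Longrightarrow> w2 \<in> upper_half_plane \<Longrightarrow>
       \<Theta>' w1 w2 = (\<Sum>i<(N2::nat). c2 i * unary_theta_deriv (k2 i) (m2 i) (r2 i) w1 * unary_theta_deriv (k2' i) (m2' i) (r2' i) w2)"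
    using assms(2) unfolding comb_of_unary_theta_deriv_products_def by blast
  let ?j = "\<lambda>f g i. if i < N then f i else g (i - N)"
  show ?thesis
    unfolding comb_of_unary_theta_deriv_products_def
  proof (intro exI conjI allI impI ballI)
    fix i assume "i < N + N2"
    then show "0 < ?j k k2 i" "0 < ?j m m2 i" "0 < ?j k' k2' i" "0 < ?j m' m2' i"
      using 1(1)[of i] 2(1)[of "i - N"] by auto
  next
    fix w1 w2 assume w: "w1 \<in> upper_half_plane" "w2 \<in> upper_half_plane"
    show "\<Theta> w1 w2 + \<Theta>' w1 w2 = (\<Sum>i<N + N2. ?j c c2 i * unary_theta_deriv (?j k k2 i) (?j m m2 i) (?j r r2 i) w1
        * unary_theta_deriv (?j k' k2' i) (?j m' m2' i) (?j r' r2' i) w2)"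
      unfolding sum_lessThan_append 1(2)[OF w] 2(2)[OF w] by (intro arg_cong2[where f = "(+)"] sum.cong) auto
  qed
qed

lemma comb_of_unary_theta_deriv_products_single:
  assumes "0 < k" "0 < m" "0 < k'" "0 < m'"
  shows "comb_of_unary_theta_deriv_products (\<lambda>w1 w2. c * (unary_theta_deriv k m r w1 * unary_theta_deriv k' m' r' w2))"
  unfolding comb_of_unary_theta_deriv_products_def
  by (intro exI[of _ "1 :: nat"] exI[of _ "\<lambda>_. c"] exI[of _ "\<lambda>_. k"] exI[of _ "\<lambda>_. m"] exI[of _ "\<lambda>_. r"]
      exI[of _ "\<lambda>_. k'"] exI[of _ "\<lambda>_. m'"] exI[of _ "\<lambda>_. r'"]) (use assms in simp)

lemma comb_of_unary_theta_deriv_products_sum: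
  assumes "finite S" "\<And>j. j \<in> S \<Longrightarrow> comb_of_unary_theta_deriv_products (\<Theta> j)"
  shows "comb_of_unary_theta_deriv_products (\<lambda>w1 w2. \<Sum>j\<in>S. \<Theta> j w1 w2)"
  using assms
proof (induction S)
  case empty
  show ?case unfolding comb_of_unary_theta_deriv_products_def by (intro exI[of _ "0 :: nat"]) simp
next
  case (insert j S)
  then show ?case
    using comb_of_unary_theta_deriv_products_add[of "\<Theta> j" "\<lambda>w1 w2. \<Sum>j\<in>S. \<Theta> j w1 w2"] by simp
qed

lemma comb_of_unary_theta_deriv_products_cmult:
  assumes "comb_of_unary_theta_deriv_products \<Theta>"
  shows "comb_of_unary_theta_deriv_products (\<lambda>w1 w2. a * \<Theta> w1 w2)"
proof -
  obtain N c k m r k' m' r' where 1: "\<forall>i<N. 0 < k i \<and> 0 < m i \<and> 0 < k' i \<and> 0 < m' i"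
    "\<And>w1 w2. w1 \<in> upper_half_plane \<Longrightarrow> w2 \<in> upper_half_plane \<Longrightarrow>
       \<Theta> w1 w2 = (\<Sum>i<(N::nat). c i * unary_theta_deriv (k i) (m i) (r i) w1 * unary_theta_deriv (k' i) (m' i) (r' i) w2)"
    using assms(1) unfolding comb_of_unary_theta_deriv_products_def by blast
  show ?thesis
    unfolding comb_of_unary_theta_deriv_products_def
    by (rule exI[of _ N], rule exI[of _ "\<lambda>i. a * c i"], rule exI[of _ k], rule exI[of _ m], rule exI[of _ r],
        rule exI[of _ k'], rule exI[of _ m'], rule exI[of _ r'])
       (use 1 in \<open>simp add: sum_distrib_left mult.assoc\<close>)
qed

lemma rank_two_theta_add:
  assumes "rank_two_theta \<Theta>" "rank_two_theta \<Theta>'"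
  shows "rank_two_theta (\<lambda>\<tau>. \<Theta> \<tau> + \<Theta>' \<tau>)"
proof -
  obtain N c Q \<alpha> where 1: "\<And>i. i < N \<Longrightarrow> pos_def_form (Q i)"
    "\<And>\<tau>. \<tau> \<in> upper_half_plane \<Longrightarrow> \<Theta> \<tau> = (\<Sum>i<(N::nat). c i * theta_series2 (Q i) (\<alpha> i) \<tau>)"
    using assms(1) unfolding rank_two_theta_def by blast
  obtain N2 c2 Q2 \<alpha>2 where 2: "\<And>i. i < N2 \<Longrightarrow> pos_def_form (Q2 i)"
    "\<And>\<tau>. \<tau> \<in> upper_half_plane \<Longrightarrow> \<Theta>' \<tau> = (\<Sum>i<(N2::nat). c2 i * theta_series2 (Q2 i) (\<alpha>2 i) \<tau>)"
    using assms(2) unfolding rank_two_theta_def by blast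
  let ?j = "\<lambda>f g i. if i < N then f i else g (i - N)"
  show ?thesis
    unfolding rank_two_theta_def
  proof (intro exI conjI allI impI ballI)
    fix i assume "i < N + N2"
    then show "pos_def_form (?j Q Q2 i)" using 1(1)[of i] 2(1)[of "i - N"] by auto
  next
    fix \<tau> assume t: "\<tau> \<in> upper_half_plane"
    show "\<Theta> \<tau> + \<Theta>' \<tau> = (\<Sum>i<N + N2. ?j c c2 i * theta_series2 (?j Q Q2 i) (?j \<alpha> \<alpha>2 i) \<tau>)"
      unfolding sum_lessThan_append 1(2)[OF t] 2(2)[OF t] by (intro arg_cong2[where f = "(+)"] sum.cong) auto
  qed
qed

lemma rank_two_theta_cmult:
  assumes "rank_two_theta \<Theta>"
  shows "rank_two_theta (\<lambda>\<tau>. a * \<Theta> \<tau>)"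
proof -
  obtain N c Q \<alpha> where 1: "\<forall>i<N. pos_def_form (Q i)"
    "\<And>\<tau>. \<tau> \<in> upper_half_plane \<Longrightarrow> \<Theta> \<tau> = (\<Sum>i<(N::nat). c i * theta_series2 (Q i) (\<alpha> i) \<tau>)"
    using assms(1) unfolding rank_two_theta_def by blast
  show ?thesis
    unfolding rank_two_theta_def
    by (rule exI[of _ N], rule exI[of _ "\<lambda>i. a * c i"], rule exI[of _ Q], rule exI[of _ \<alpha>])
       (use 1 in \<open>simp add: sum_distrib_left mult.assoc\<close>)
qed

lemma rank_two_theta_single: "pos_def_form Q \<Longrightarrow> rank_two_theta (theta_series2 Q \<alpha>)"
  unfolding rank_two_theta_def
  by (intro exI[of _ "1 :: nat"] exI[of _ "\<lambda>_. 1"] exI[of _ "\<lambda>_. Q"] exI[of _ "\<lambda>_. \<alpha>"]) simp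

text \<open>The representation claimed for the invariant, stripped of its power of q. It is closed
  under linear combinations and can therefore be checked on single false theta functions.\<close>

definition eichler_representable :: "(complex \<Rightarrow> complex) \<Rightarrow> bool" where
  "eichler_representable f \<longleftrightarrow> (\<exists>\<Theta>1 \<Theta>2. comb_of_unary_theta_deriv_products \<Theta>1 \<and> rank_two_theta \<Theta>2 \<and>
     (\<forall>\<tau>\<in>upper_half_plane. \<exists>I. eichler_integral \<Theta>1 \<tau> I \<and> f \<tau> = I + \<Theta>2 \<tau>))"

lemma eichler_representable_add:
  assumes "eichler_representable f" "eichler_representable g"
  shows "eichler_representable (\<lambda>\<tau>. f \<tau> + g \<tau>)"
proof -
  obtain \<Theta>1 \<Theta>2 where 1: "comb_of_unary_theta_deriv_products \<Theta>1" "rank_two_theta \<Theta>2"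
     "\<And>\<tau>. \<tau> \<in> upper_half_plane \<Longrightarrow> \<exists>I. eichler_integral \<Theta>1 \<tau> I \<and> f \<tau> = I + \<Theta>2 \<tau>"
    using assms(1) unfolding eichler_representable_def by blast
  obtain \<Theta>1' \<Theta>2' where 2: "comb_of_unary_theta_deriv_products \<Theta>1'" "rank_two_theta \<Theta>2'"
     "\<And>\<tau>. \<tau> \<in> upper_half_plane \<Longrightarrow> \<exists>I. eichler_integral \<Theta>1' \<tau> I \<and> g \<tau> = I + \<Theta>2' \<tau>"
    using assms(2) unfolding eichler_representable_def by blast
  have "\<exists>I. eichler_integral (\<lambda>w1 w2. \<Theta>1 w1 w2 + \<Theta>1' w1 w2) \<tau> I \<and> f \<tau> + g \<tau> = I + (\<Theta>2 \<tau> + \<Theta>2' \<tau>)"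
    if t: "\<tau> \<in> upper_half_plane" for \<tau>
  proof -
    obtain I I' where "eichler_integral \<Theta>1 \<tau> I" "f \<tau> = I + \<Theta>2 \<tau>" "eichler_integral \<Theta>1' \<tau> I'" "g \<tau> = I' + \<Theta>2' \<tau>"
      using 1(3)[OF t] 2(3)[OF t] by blast
    then show ?thesis by (intro exI[of _ "I + I'"]) (simp add: eichler_integral_add)
  qed
  then show ?thesis
    unfolding eichler_representable_def
    using comb_of_unary_theta_deriv_products_add[OF 1(1) 2(1)] rank_two_theta_add[OF 1(2) 2(2)] by blast
qed

lemma eichler_representable_cmult:
  assumes "eichler_representable f"
  shows "eichler_representable (\<lambda>\<tau>. c * f \<tau>)"
proof -
  obtain \<Theta>1 \<Theta>2 where 1: "comb_of_unary_theta_deriv_products \<Theta>1" "rank_two_theta \<Theta>2"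
     "\<And>\<tau>. \<tau> \<in> upper_half_plane \<Longrightarrow> \<exists>I. eichler_integral \<Theta>1 \<tau> I \<and> f \<tau> = I + \<Theta>2 \<tau>"
    using assms(1) unfolding eichler_representable_def by blast
  have "\<exists>I. eichler_integral (\<lambda>w1 w2. c * \<Theta>1 w1 w2) \<tau> I \<and> c * f \<tau> = I + c * \<Theta>2 \<tau>"
    if t: "\<tau> \<in> upper_half_plane" for \<tau>
  proof -
    obtain I where "eichler_integral \<Theta>1 \<tau> I" "f \<tau> = I + \<Theta>2 \<tau>"
      using 1(3)[OF t] by blast
    then show ?thesis by (intro exI[of _ "c * I"]) (simp add: eichler_integral_cmult distrib_left)
  qed
  then show ?thesis
    unfolding eichler_representable_def
    using comb_of_unary_theta_deriv_products_cmult[OF 1(1)] rank_two_theta_cmult[OF 1(2)] by blast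
qed

section \<open>Representation, growth and periodicity of the false theta functions\<close>

context unimodular_form begin

lemma eichler_kernel_comb: "comb_of_unary_theta_deriv_products (eichler_kernel u0 v0)"
  unfolding eichler_kernel_def[abs_def] using pos
  by (intro comb_of_unary_theta_deriv_products_sum comb_of_unary_theta_deriv_products_single) auto

text \<open>Writing u = 2 M (x + u0 / (2 M)), and likewise v with P, turns \<open>quad\<close> into
  a form with integral coefficients.\<close>

lemma theta_series2_eq:
  "theta_series2 (B * M, 2 * (M * P), A * P) (of_int u0 / of_int (2 * M), of_int v0 / of_int (2 * P)) \<tau>
     = (\<Sum>\<^sub>\<infinity>(x, y)\<in>UNIV. qpow \<tau> (quad M P A B (u0 + 2 * M * x) (v0 + 2 * P * y)))"
  unfolding theta_series2_def
proof (rule infsum_cong)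
  fix p :: "int \<times> int"
  obtain x y where p: "p = (x, y)" by (cases p)
  have 1: "of_int x + of_rat (of_int u0 / of_int (2 * M)) = of_int (u0 + 2 * M * x) / (2 * real_of_int M)"
    "of_int y + of_rat (of_int v0 / of_int (2 * P)) = of_int (v0 + 2 * P * y) / (2 * real_of_int P)"
    using pos by (simp_all add: of_rat_divide of_rat_mult field_simps)
  have "binary_form (B * M, 2 * (M * P), A * P) (of_int u / (2 * of_int M)) (of_int v / (2 * of_int P)) = quad M P A B u v" for u v
    using pos by (simp add: binary_form_def quad_def power2_eq_square field_simps)
  then show "(case p of (i, j) \<Rightarrow> qpow \<tau> (binary_form (B * M, 2 * (M * P), A * P)
        (of_int i + of_rat (fst (of_int u0 / of_int (2 * M), of_int v0 / of_int (2 * P))))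
        (of_int j + of_rat (snd (of_int u0 / of_int (2 * M), of_int v0 / of_int (2 * P))))))
    = (case p of (x, y) \<Rightarrow> qpow \<tau> (quad M P A B (u0 + 2 * M * x) (v0 + 2 * P * y)))"
    unfolding p prod.case fst_conv snd_conv 1 by (simp only:)
qed

text \<open>B times the form is M (B x + P y)^2 + P y^2, because A B = M P + 1.\<close>

lemma pos_def_form_quad: "pos_def_form (B * M, 2 * (M * P), A * P)"
  unfolding pos_def_form_def
proof (intro allI impI)
  fix x y :: real assume xy: "(x, y) \<noteq> (0, 0)"
  have "A * B = M * P + 1" using det by simp
  then have "real_of_int (A * B) = real_of_int (M * P + 1)" by (simp only:)
  then have AB: "real_of_int A * of_int B = of_int M * of_int P + 1" by simp
  have "of_int B * binary_form (B * M, 2 * (M * P), A * P) x y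
      = of_int M * (of_int B * x)\<^sup>2 + 2 * (of_int M * of_int P * of_int B) * x * y + (real_of_int A * of_int B) * of_int P * y\<^sup>2"
    by (simp add: binary_form_def power2_eq_square algebra_simps)
  also have "\<dots> = of_int M * (of_int B * x + of_int P * y)\<^sup>2 + of_int P * y\<^sup>2"
    unfolding AB by (simp add: power2_eq_square algebra_simps)
  also have "\<dots> > 0"
  proof (cases "y = 0")
    case True
    then show ?thesis using xy pos by simp
  next
    case False
    then show ?thesis using pos by (intro add_nonneg_pos) auto
  qed
  finally show "0 < binary_form (B * M, 2 * (M * P), A * P) x y"
    using pos by (simp add: zero_less_mult_iff)
qed

text \<open>This is 2 / pi times \<open>arctan_sum_identity\<close> with s = sqrt (M P). The first
  angle has the argument s + X, the second, from the form with exchanged variables, s + (1 + s^2) /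
  X, and X has the sign of u v.\<close>

lemma sgn_slope_angles:
  assumes "u \<noteq> 0" "v \<noteq> 0"
  shows "real_of_int (sgn u * sgn v) = 2 * (slope_angle M P (B * u + M * v) v / pi)
     + 2 * (slope_angle P M (A * v + P * u) u / pi) - 2 * arctan (sqrt (of_int M) * sqrt (of_int P)) / pi"
proof -
  define a b where "a = sqrt (real_of_int M)" and "b = sqrt (real_of_int P)"
  have ab: "a * a = of_int M" "b * b = of_int P" "0 < a" "0 < b" using pos by (simp_all add: a_def b_def)
  define U V where "U = real_of_int u" and "V = real_of_int v"
  have UV: "U \<noteq> 0" "V \<noteq> 0" using assms by (simp_all add: U_def V_def)
  define X where "X = b * of_int B * U / (a * V)"
  have X: "X \<noteq> 0" using UV ab pos by (simp add: X_def)
  have "A * B = M * P + 1" using det by simp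
  then have "real_of_int (A * B) = real_of_int (M * P + 1)" by (simp only:)
  then have AB: "real_of_int A * of_int B = (a * b)\<^sup>2 + 1" using ab by (simp add: power2_eq_square mult_ac)
  have 1: "slope_angle M P (B * u + M * v) v = arctan (a * b + X)"
  proof -
    have "a * b * (of_int B * U + a * a * V) / (a * a * V) = a * b + X"
      unfolding X_def using ab(3,4) UV by (simp add: field_simps)
    then show ?thesis unfolding slope_angle_def U_def V_def X_def a_def[symmetric] b_def[symmetric] using ab by simp
  qed
  have 2: "slope_angle P M (A * v + P * u) u = arctan (a * b + (1 + (a * b)\<^sup>2) / X)"
  proof -
    have B: "real_of_int B \<noteq> 0" using pos by simp
    have "(1 + (a * b)\<^sup>2) / X = of_int A * of_int B / X" using AB by simp
    also have "\<dots> = a * of_int A * V / (b * U)"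
      unfolding X_def using ab(3,4) UV B by (simp add: field_simps)
    finally have Y: "(1 + (a * b)\<^sup>2) / X = a * of_int A * V / (b * U)" .
    have "b * a * (of_int A * V + b * b * U) / (b * b * U) = a * b + (1 + (a * b)\<^sup>2) / X"
      unfolding Y using ab(3,4) UV by (simp add: field_simps)
    then show ?thesis unfolding slope_angle_def U_def V_def a_def[symmetric] b_def[symmetric] using ab by simp
  qed
  have s: "sgn X = real_of_int (sgn u * sgn v)"
  proof -
    have "sgn X = sgn U * sgn V"
      unfolding X_def using ab pos by (simp add: sgn_mult sgn_divide)
    then show ?thesis by (simp add: U_def V_def sgn_if)
  qed
  from arctan_sum_identity[OF X, of "a * b"] show ?thesis
    unfolding 1 2 s a_def[symmetric] b_def[symmetric]
    by (simp add: field_simps)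
qed

text \<open>The second kernel belongs to the swapped form, and \<open>quad_swap\<close> brings its
  exponents back. The hypotheses make \<open>sgn_slope_angles\<close> applicable at every lattice
  point; the constant term of that identity is the coefficient of the theta series.\<close>

lemma eichler_representable_false_theta:
  assumes u: "\<And>x. u0 + 2 * M * x \<noteq> 0" and v: "\<And>y. v0 + 2 * P * y \<noteq> 0"
  shows "eichler_representable (false_theta M P A B u0 v0)"
proof -
  interpret s: unimodular_form P M B A by (rule swapped)
  let ?\<Theta>1 = "\<lambda>w1 w2. 2 * eichler_kernel u0 v0 w1 w2 + 2 * s.eichler_kernel v0 u0 w1 w2"
  let ?T = "theta_series2 (B * M, 2 * (M * P), A * P) (of_int u0 / of_int (2 * M), of_int v0 / of_int (2 * P))"
  define k where "k = 2 * arctan (sqrt (of_int M) * sqrt (of_int P)) / pi"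
  let ?\<Theta>2 = "\<lambda>\<tau>. of_real (- k) * ?T \<tau>"
  let ?u = "\<lambda>x. u0 + 2 * M * x" and ?v = "\<lambda>y. v0 + 2 * P * y"
  have "\<exists>I. eichler_integral ?\<Theta>1 \<tau> I \<and> false_theta M P A B u0 v0 \<tau> = I + ?\<Theta>2 \<tau>"
    if "\<tau> \<in> upper_half_plane" for \<tau>
  proof -
    have tau: "0 < Im \<tau>" using that by simp
    let ?q = "\<lambda>x y. qpow \<tau> (quad M P A B (?u x) (?v y))"
    define C1 where "C1 = (\<lambda>x y. complex_of_real (slope_angle M P (B * ?u x + M * ?v y) (?v y) / pi))"
    define C2 where "C2 = (\<lambda>x y. complex_of_real (slope_angle P M (A * ?v y + P * ?u x) (?u x) / pi))"
    let ?I1 = "\<Sum>\<^sub>\<infinity>(x, y)\<in>UNIV. C1 x y * ?q x y" and ?I2 = "\<Sum>\<^sub>\<infinity>(x, y)\<in>UNIV. C2 x y * ?q x y"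
    have e1: "eichler_integral (eichler_kernel u0 v0) \<tau> ?I1"
      unfolding C1_def by (rule eichler_kernel_integral[OF tau])
    have "(\<Sum>\<^sub>\<infinity>(y, x)\<in>UNIV. of_real (slope_angle P M (A * ?v y + P * ?u x) (?u x) / pi) * qpow \<tau> (quad P M B A (?v y) (?u x))) = ?I2"
      by (rule infsum_reindex_bij_witness[of _ prod.swap prod.swap]) (auto simp: C2_def quad_swap[of M P A B])
    with s.eichler_kernel_integral[OF tau, of v0 u0]
    have e2: "eichler_integral (s.eichler_kernel v0 u0) \<tau> ?I2" by (simp only:)
    have b: "norm (C1 x y) \<le> 1" "norm (C2 x y) \<le> 1" for x y
      unfolding C1_def C2_def using abs_slope_angle_le by (simp_all only: norm_of_real abs_divide) simp_all
    have s1: "(\<lambda>(x, y). C1 x y * ?q x y) summable_on UNIV" "(\<lambda>(x, y). C2 x y * ?q x y) summable_on UNIV"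
      "(\<lambda>(x, y). 1 * ?q x y) summable_on UNIV"
      by (rule summable_theta[OF tau], simp add: b)+
    have pt: "of_int (sgn (?u x) * sgn (?v y)) = 2 * C1 x y + 2 * C2 x y - complex_of_real k" for x y
    proof -
      have "complex_of_real (real_of_int (sgn (?u x) * sgn (?v y))) = 2 * C1 x y + 2 * C2 x y - complex_of_real k"
        unfolding sgn_slope_angles[OF u v] C1_def C2_def k_def by simp
      then show ?thesis by simp
    qed
    have "false_theta M P A B u0 v0 \<tau> = (\<Sum>\<^sub>\<infinity>p\<in>UNIV. 2 * (case p of (x, y) \<Rightarrow> C1 x y * ?q x y)
        + (2 * (case p of (x, y) \<Rightarrow> C2 x y * ?q x y) + of_real (- k) * (case p of (x, y) \<Rightarrow> 1 * ?q x y)))"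
      unfolding false_theta_def
    proof (rule infsum_cong)
      fix p :: "int \<times> int"
      obtain x y where p: "p = (x, y)" by (cases p)
      have "(2 * a + 2 * b - c) * q = 2 * (a * q) + (2 * (b * q) + - c * (1 * q))" for a b c q :: complex
        by (simp add: algebra_simps)
      then show "(case p of (x, y) \<Rightarrow> of_int (sgn (?u x) * sgn (?v y)) * ?q x y)
        = 2 * (case p of (x, y) \<Rightarrow> C1 x y * ?q x y)
          + (2 * (case p of (x, y) \<Rightarrow> C2 x y * ?q x y) + of_real (- k) * (case p of (x, y) \<Rightarrow> 1 * ?q x y))"
        unfolding p prod.case pt of_real_minus .
    qed
    also have "\<dots> = 2 * ?I1 + (2 * ?I2 + of_real (- k) * (\<Sum>\<^sub>\<infinity>(x, y)\<in>UNIV. 1 * ?q x y))"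
      using s1 by (simp only: infsum_add summable_on_add summable_on_cmult_right infsum_cmult_right')
    also have "(\<Sum>\<^sub>\<infinity>(x, y)\<in>UNIV. 1 * ?q x y) = ?T \<tau>"
      unfolding theta_series2_eq by simp
    finally have "false_theta M P A B u0 v0 \<tau> = (2 * ?I1 + 2 * ?I2) + ?\<Theta>2 \<tau>" by (simp only: add.assoc)
    moreover have "eichler_integral ?\<Theta>1 \<tau> (2 * ?I1 + 2 * ?I2)"
      by (intro eichler_integral_add eichler_integral_cmult e1 e2)
    ultimately show ?thesis by blast
  qed
  moreover have "comb_of_unary_theta_deriv_products ?\<Theta>1"
    by (intro comb_of_unary_theta_deriv_products_add comb_of_unary_theta_deriv_products_cmult
        eichler_kernel_comb s.eichler_kernel_comb)
  moreover have "rank_two_theta ?\<Theta>2"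
    by (intro rank_two_theta_cmult rank_two_theta_single pos_def_form_quad)
  ultimately show ?thesis unfolding eichler_representable_def by blast
qed

lemma norm_sgn_le_1: "norm (of_int (sgn a * sgn b) :: complex) \<le> 1"
  by (auto simp: sgn_if)

text \<open>Each of the two one-variable Gaussian sums costs a factor 1 + 1 / Im \<tau>, whence the
  square.\<close>

lemma false_theta_bound:
  "\<exists>C\<ge>0. \<forall>\<tau>. 0 < Im \<tau> \<longrightarrow> norm (false_theta M P A B u0 v0 \<tau>) \<le> C * (1 + 1 / Im \<tau>)\<^sup>2"
proof -
  define a b where "a = 8 * (real_of_int M * of_int A) / pi" and "b = 8 * (real_of_int P * of_int B) / pi"
  have ab: "0 \<le> a" "0 \<le> b" using pos by (simp_all add: a_def b_def)
  have "norm (false_theta M P A B u0 v0 \<tau>) \<le> (2 + a) * (2 + b) * (1 + 1 / Im \<tau>)\<^sup>2" if t: "0 < Im \<tau>" for \<tau>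
  proof -
    let ?c = "2 * pi * Im \<tau>" and ?i = "1 / Im \<tau>"
    let ?e = "\<lambda>(x, y). exp (- ?c * quad M P A B (u0 + 2 * M * x) (v0 + 2 * P * y))"
    have c: "0 < ?c" using t by simp
    note maj = theta_majorant[OF c, of u0 v0]
    have "norm (false_theta M P A B u0 v0 \<tau>) \<le> infsum ?e UNIV"
      unfolding false_theta_def
    proof (rule norm_infsum_le[OF has_sum_infsum has_sum_infsum[OF maj(1)]])
      show "(\<lambda>(x, y). of_int (sgn (u0 + 2 * M * x) * sgn (v0 + 2 * P * y)) * qpow \<tau> (quad M P A B (u0 + 2 * M * x) (v0 + 2 * P * y))) summable_on UNIV"
        by (rule summable_theta[OF t norm_sgn_le_1])
      fix p :: "int \<times> int"
      obtain x y where p: "p = (x, y)" by (cases p)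
      show "norm (case p of (x, y) \<Rightarrow> of_int (sgn (u0 + 2 * M * x) * sgn (v0 + 2 * P * y)) * qpow \<tau> (quad M P A B (u0 + 2 * M * x) (v0 + 2 * P * y))) \<le> ?e p"
        unfolding p prod.case norm_mult norm_qpow using mult_right_mono[OF norm_sgn_le_1] by simp
    qed
    also have "\<dots> \<le> (2 + 2 / (?c / (8 * (of_int M * of_int A)))) * (2 + 2 / (?c / (8 * (of_int P * of_int B))))"
      by (rule maj(2))
    also have "\<dots> = (2 + a * ?i) * (2 + b * ?i)" using t pos by (simp add: a_def b_def field_simps)
    also have "\<dots> \<le> ((2 + a) * (1 + ?i)) * ((2 + b) * (1 + ?i))"
      using t ab by (intro mult_mono) (auto simp: algebra_simps)
    also have "\<dots> = (2 + a) * (2 + b) * (1 + ?i)\<^sup>2" by (simp add: power2_eq_square algebra_simps)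
    finally show ?thesis .
  qed
  then show ?thesis using ab by (intro exI[of _ "(2 + a) * (2 + b)"]) auto
qed

lemma quad_nonneg: "0 \<le> quad M P A B u v"
  using quad_lower[of u v] pos by (rule_tac order.trans[rotated]) auto

lemma false_theta_holomorphic: "false_theta M P A B u0 v0 holomorphic_on upper_half_plane"
  unfolding false_theta_def[abs_def]
proof (rule holomorphic_on_infsum)
  show "open upper_half_plane" by (rule open_halfspace_Im_gt)
  fix z assume "z \<in> upper_half_plane"
  then have z: "0 < Im z" by simp
  let ?M = "\<lambda>(x, y). exp (- (2 * pi * (Im z / 2)) * quad M P A B (u0 + 2 * M * x) (v0 + 2 * P * y))"
  have zr: "Im z / 2 \<le> Im x" if "x \<in> cball z (Im z / 2)" for x
  proof -
    have "norm (x - z) \<le> Im z / 2" using that by (simp add: dist_norm norm_minus_commute)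
    moreover have "\<bar>Im (x - z)\<bar> \<le> norm (x - z)" by (rule abs_Im_le_cmod)
    ultimately show ?thesis by auto
  qed
  show "\<exists>r M'. 0 < r \<and> cball z r \<subseteq> upper_half_plane \<and> M' summable_on UNIV \<and>
      (\<forall>i\<in>UNIV. \<forall>t\<in>cball z r. norm (case i of (x, y) \<Rightarrow> of_int (sgn (u0 + 2 * M * x) * sgn (v0 + 2 * P * y)) *
         qpow t (quad M P A B (u0 + 2 * M * x) (v0 + 2 * P * y))) \<le> M' i)"
  proof (intro exI conjI ballI)
    show "0 < Im z / 2" using z by simp
    show "cball z (Im z / 2) \<subseteq> upper_half_plane" using zr z by force
    show "?M summable_on UNIV" using z by (intro theta_majorant(1)) simp
    fix i :: "int \<times> int" and t assume t: "t \<in> cball z (Im z / 2)"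
    obtain x y where i: "i = (x, y)" by (cases i)
    let ?q = "quad M P A B (u0 + 2 * M * x) (v0 + 2 * P * y)"
    have "norm (of_int (sgn (u0 + 2 * M * x) * sgn (v0 + 2 * P * y)) :: complex) * exp (- (2 * pi * Im t * ?q))
      \<le> 1 * exp (- (2 * pi * (Im z / 2)) * ?q)"
    proof (intro mult_mono norm_sgn_le_1)
      have "2 * pi * (Im z / 2) * ?q \<le> 2 * pi * Im t * ?q"
        using zr[OF t] quad_nonneg by (intro mult_right_mono mult_left_mono) auto
      then show "exp (- (2 * pi * Im t * ?q)) \<le> exp (- (2 * pi * (Im z / 2)) * ?q)" by simp
    qed auto
    then show "norm (case i of (x, y) \<Rightarrow> of_int (sgn (u0 + 2 * M * x) * sgn (v0 + 2 * P * y)) *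
         qpow t (quad M P A B (u0 + 2 * M * x) (v0 + 2 * P * y))) \<le> ?M i"
      unfolding i prod.case norm_mult norm_qpow by simp
  qed
next
  fix i :: "int \<times> int"
  show "(\<lambda>t. case i of (x, y) \<Rightarrow> of_int (sgn (u0 + 2 * M * x) * sgn (v0 + 2 * P * y)) *
      qpow t (quad M P A B (u0 + 2 * M * x) (v0 + 2 * P * y))) holomorphic_on upper_half_plane"
    unfolding qpow_def by (cases i) (auto intro!: holomorphic_intros)
qed

text \<open>The number 4 M P clears the denominators of \<open>quad\<close>. Being a multiple of 4,
  it also serves as level for the form of weight three.\<close>

lemma false_theta_periodic:
  "false_theta M P A B u0 v0 (\<tau> + of_int (4 * M * P * j)) = false_theta M P A B u0 v0 \<tau>"
proof -
  have "qpow (\<tau> + of_int (4 * M * P * j)) (quad M P A B u v) = qpow \<tau> (quad M P A B u v)" for u v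
  proof -
    define n where "n = j * (B * P * u\<^sup>2 + 2 * M * P * u * v + A * M * v\<^sup>2)"
    have "of_int (4 * M * P * j) * quad M P A B u v = of_int n"
      using pos by (simp add: quad_def n_def field_simps power2_eq_square)
    then have n: "of_int (4 * M * P * j) * complex_of_real (quad M P A B u v) = of_int n"
      by (metis of_real_mult of_real_of_int_eq)
    have "2 * of_real pi * \<i> * (\<tau> + of_int (4 * M * P * j)) * of_real (quad M P A B u v)
      = 2 * of_real pi * \<i> * \<tau> * of_real (quad M P A B u v)
        + 2 * of_real pi * \<i> * (of_int (4 * M * P * j) * of_real (quad M P A B u v))"
      by (simp only: distrib_left distrib_right mult.assoc)
    also have "\<dots> = 2 * of_real pi * \<i> * \<tau> * of_real (quad M P A B u v) + of_int n * (2 * of_real pi * \<i>)"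
      unfolding n by simp
    finally show ?thesis
      unfolding qpow_def using exp_integer_2pi[of "of_int n"] by (simp add: exp_add mult_ac)
  qed
  then show ?thesis unfolding false_theta_def by simp
qed

end

no_notation fps_nth (infixl "$" 75)

subsection \<open>The linking matrix of the H-graph\<close>

lemma UNIV_6: "(UNIV :: 6 set) = {1, 2, 3, 4, 5, 6}"
proof -
  have "distinct [1, 2, 3, 4, 5, 6 :: 6]" by simp
  then have "card {1, 2, 3, 4, 5, 6 :: 6} = 6" using distinct_card by fastforce
  then have "card {1, 2, 3, 4, 5, 6 :: 6} = card (UNIV :: 6 set)" by simp
  then show ?thesis by (intro card_subset_eq[symmetric]) auto
qed

lemma sum_6: "sum f (UNIV :: 6 set) = f 1 + f 2 + f 3 + f 4 + f 5 + (f 6 :: 'a :: comm_monoid_add)"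
  unfolding UNIV_6 by (simp add: add.assoc)

lemma prod_6: "prod f (UNIV :: 6 set) = f 1 * f 2 * f 3 * f 4 * f 5 * (f 6 :: 'a :: comm_monoid_mult)"
  unfolding UNIV_6 by (simp add: mult.assoc)

lemma all_6: "(\<forall>j::6. Q j) \<longleftrightarrow> Q 1 \<and> Q 2 \<and> Q 3 \<and> Q 4 \<and> Q 5 \<and> Q 6"
  using UNIV_6 by (metis UNIV_I insertE singletonD)

lemma H_edges_iff [simp]:
  fixes k :: 6
  shows "{1, k} \<in> H_edges \<longleftrightarrow> k \<in> {2, 3, 4}" "{2, k} \<in> H_edges \<longleftrightarrow> k \<in> {1}"
    "{3, k} \<in> H_edges \<longleftrightarrow> k \<in> {1}" "{4, k} \<in> H_edges \<longleftrightarrow> k \<in> {1, 5, 6}"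
    "{5, k} \<in> H_edges \<longleftrightarrow> k \<in> {4}" "{6, k} \<in> H_edges \<longleftrightarrow> k \<in> {4}"
  unfolding H_edges_def by (auto simp: doubleton_eq_iff)

lemma H_deg_eq [simp]:
  "H_deg 1 = 3" "H_deg 2 = 1" "H_deg 3 = 1" "H_deg 4 = 3" "H_deg 5 = 1" "H_deg 6 = 1"
  unfolding H_deg_def H_edges_iff by (simp_all only: Collect_mem_eq) simp_all

lemma H_linking_mult:
  fixes x :: "int^6"
  shows "(H_linking m *v x) $ 1 = m 1 * x $ 1 - x $ 2 - x $ 3 - x $ 4"
    "(H_linking m *v x) $ 2 = m 2 * x $ 2 - x $ 1" "(H_linking m *v x) $ 3 = m 3 * x $ 3 - x $ 1"
    "(H_linking m *v x) $ 4 = m 4 * x $ 4 - x $ 1 - x $ 5 - x $ 6"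
    "(H_linking m *v x) $ 5 = m 5 * x $ 5 - x $ 4" "(H_linking m *v x) $ 6 = m 6 * x $ 6 - x $ 4"
  unfolding matrix_vector_mult_def H_linking_def by (simp_all add: sum_6)

lemma real_H_linking_mult:
  fixes x :: "real^6"
  shows "(real_mat (H_linking m) *v x) $ 1 = of_int (m 1) * x $ 1 - x $ 2 - x $ 3 - x $ 4"
    "(real_mat (H_linking m) *v x) $ 2 = of_int (m 2) * x $ 2 - x $ 1"
    "(real_mat (H_linking m) *v x) $ 3 = of_int (m 3) * x $ 3 - x $ 1"
    "(real_mat (H_linking m) *v x) $ 4 = of_int (m 4) * x $ 4 - x $ 1 - x $ 5 - x $ 6"
    "(real_mat (H_linking m) *v x) $ 5 = of_int (m 5) * x $ 5 - x $ 4"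
    "(real_mat (H_linking m) *v x) $ 6 = of_int (m 6) * x $ 6 - x $ 4"
  unfolding matrix_vector_mult_def H_linking_def real_mat_def by (simp_all add: sum_6)

definition vec6 :: "'a \<Rightarrow> 'a \<Rightarrow> 'a \<Rightarrow> 'a \<Rightarrow> 'a \<Rightarrow> 'a \<Rightarrow> 'a^6" where
  "vec6 a b c d e f = (\<chi> j. if j = 1 then a else if j = 2 then b else if j = 3 then c
     else if j = 4 then d else if j = 5 then e else f)"

lemma vec6_nth [simp]:
  "vec6 a b c d e f $ 1 = a" "vec6 a b c d e f $ 2 = b" "vec6 a b c d e f $ 3 = c"
  "vec6 a b c d e f $ 4 = d" "vec6 a b c d e f $ 5 = e" "vec6 a b c d e f $ 6 = f"
  by (simp_all add: vec6_def)

lemma vec_eq_6: "x = (y :: 'a^6) \<longleftrightarrow> x $ 1 = y $ 1 \<and> x $ 2 = y $ 2 \<and> x $ 3 = y $ 3 \<and> x $ 4 = y $ 4 \<and> x $ 5 = y $ 5 \<and> x $ 6 = y $ 6"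
  unfolding vec_eq_iff all_6 ..

lemma real_mat_mult: "real_mat (X ** Y) = real_mat X ** real_mat Y"
  by (simp add: real_mat_def matrix_matrix_mult_def vec_eq_iff)

lemma real_mat_mat_1: "real_mat (mat 1) = mat 1"
  by (simp add: real_mat_def mat_def vec_eq_iff)

lemma invertible_real_mat:
  assumes "invertible X" shows "invertible (real_mat X)"
proof -
  obtain Y where "X ** Y = mat 1" "Y ** X = mat 1" using assms by (auto simp: invertible_def)
  then have "real_mat X ** real_mat Y = mat 1" "real_mat Y ** real_mat X = mat 1"
    by (simp_all add: real_mat_mult[symmetric] real_mat_mat_1)
  then show ?thesis by (auto simp: invertible_def)
qed

lemma matrix_inv_mult:
  fixes X :: "real^'n^'n"
  assumes "invertible X" shows "X ** matrix_inv X = mat 1" "matrix_inv X ** X = mat 1"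
proof -
  have "X ** matrix_inv X = mat 1 \<and> matrix_inv X ** X = mat 1"
    unfolding matrix_inv_def by (rule someI_ex) (use assms in \<open>simp add: invertible_def\<close>)
  then show "X ** matrix_inv X = mat 1" "matrix_inv X ** X = mat 1" by auto
qed

text \<open>The minimum over the compact unit sphere is positive, and the form is homogeneous of
  degree two.\<close>

lemma pos_def_mat_lower:
  fixes X :: "real^'n^'n"
  assumes "pos_def_mat X"
  shows "\<exists>c>0. \<forall>x. c * (norm x)\<^sup>2 \<le> x \<bullet> (X *v x)"
proof -
  let ?S = "sphere (0 :: real^'n) 1"
  have cont: "continuous_on ?S (\<lambda>x. x \<bullet> (X *v x))"
    by (intro continuous_intros linear_continuous_on matrix_vector_mul_bounded_linear)
  have ne: "?S \<noteq> {}" by simp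
  obtain s where s: "s \<in> ?S" "\<And>x. x \<in> ?S \<Longrightarrow> s \<bullet> (X *v s) \<le> x \<bullet> (X *v x)"
    using continuous_attains_inf[OF compact_sphere ne cont] by blast
  have "s \<noteq> 0" using s by auto
  then have pos: "0 < s \<bullet> (X *v s)" using assms by (auto simp: pos_def_mat_def)
  have "s \<bullet> (X *v s) * (norm x)\<^sup>2 \<le> x \<bullet> (X *v x)" for x
  proof (cases "x = 0")
    case False
    define y where "y = x /\<^sub>R norm x"
    have "y \<in> ?S" using False by (simp add: y_def)
    then have "s \<bullet> (X *v s) \<le> y \<bullet> (X *v y)" by (rule s)
    moreover have x: "x = norm x *\<^sub>R y" using False by (simp add: y_def)
    have "x \<bullet> (X *v x) = (norm x)\<^sup>2 * (y \<bullet> (X *v y))"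
      by (subst (1 2) x) (simp add: matrix_vector_mult_scaleR power2_eq_square)
    ultimately show ?thesis by (simp add: mult.commute[of "(norm x)\<^sup>2"] mult_right_mono)
  qed simp
  with pos show ?thesis by blast
qed

text \<open>Substituting l = X x turns the inverse form at l into the form of X at x, while the norm
  of l is at most a constant times that of x.\<close>

lemma inverse_form_lower:
  fixes X :: "real^'n^'n"
  assumes "pos_def_mat X" "invertible X"
  shows "\<exists>c>0. \<forall>l. c * (norm l)\<^sup>2 \<le> l \<bullet> (matrix_inv X *v l)"
proof -
  obtain c where c: "0 < c" "\<And>x. c * (norm x)\<^sup>2 \<le> x \<bullet> (X *v x)" using pos_def_mat_lower[OF assms(1)] by blast
  obtain K where K: "0 < K" "\<And>x. norm (X *v x) \<le> norm x * K"
    using bounded_linear.pos_bounded[OF matrix_vector_mul_bounded_linear[of X]] by blast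
  have "c / K\<^sup>2 * (norm l)\<^sup>2 \<le> l \<bullet> (matrix_inv X *v l)" for l
  proof -
    define x where "x = matrix_inv X *v l"
    have l: "l = X *v x" unfolding x_def by (simp add: matrix_vector_mul_assoc matrix_inv_mult[OF assms(2)])
    have "(norm l)\<^sup>2 \<le> (norm x * K)\<^sup>2" unfolding l by (intro power_mono K) auto
    then have "c / K\<^sup>2 * (norm l)\<^sup>2 \<le> c / K\<^sup>2 * (norm x * K)\<^sup>2" using c(1) by (intro mult_left_mono) auto
    also have "\<dots> = c * (norm x)\<^sup>2" using K(1) by (simp add: power_mult_distrib)
    also have "\<dots> \<le> l \<bullet> x" using c(2)[of x] unfolding l[symmetric] by (simp add: inner_commute)
    finally show ?thesis unfolding x_def .
  qed
  then show ?thesis using c(1) K(1) by (intro exI[of _ "c / K\<^sup>2"]) auto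
qed

locale H_graph =
  fixes m :: "6 \<Rightarrow> int"
  assumes pos_def: "pos_def_mat (real_mat (H_linking m))"
    and unimodular: "invertible (H_linking m)"
    and reduced: "\<And>j. H_deg j = 1 \<Longrightarrow> m j \<noteq> 1"
begin

definition "M = m 2 * m 3"
definition "P = m 5 * m 6"
definition "A = m 1 * M - m 2 - m 3"
definition "B = m 4 * P - m 5 - m 6"

lemma form_pos:
  fixes x1 x2 x3 x4 x5 x6 :: int
  assumes "vec6 x1 x2 x3 x4 x5 x6 \<noteq> 0"
  shows "0 < x1 * (m 1 * x1 - x2 - x3 - x4) + x2 * (m 2 * x2 - x1) + x3 * (m 3 * x3 - x1)
    + x4 * (m 4 * x4 - x1 - x5 - x6) + x5 * (m 5 * x5 - x4) + x6 * (m 6 * x6 - x4)"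
proof -
  let ?x = "real_vec (vec6 x1 x2 x3 x4 x5 x6)"
  have "?x \<noteq> 0" using assms by (auto simp: real_vec_def vec_eq_iff)
  then have "0 < ?x \<bullet> (real_mat (H_linking m) *v ?x)" using pos_def by (simp add: pos_def_mat_def)
  also have "\<dots> = of_int (x1 * (m 1 * x1 - x2 - x3 - x4) + x2 * (m 2 * x2 - x1) + x3 * (m 3 * x3 - x1)
    + x4 * (m 4 * x4 - x1 - x5 - x6) + x5 * (m 5 * x5 - x4) + x6 * (m 6 * x6 - x4))"
    unfolding inner_vec_def sum_6 inner_real_def real_H_linking_mult by (simp add: real_vec_def)
  finally show ?thesis by (simp only: of_int_0_less_iff)
qed

lemma leaves_ge_2: "2 \<le> m 2" "2 \<le> m 3" "2 \<le> m 5" "2 \<le> m 6"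
proof -
  have "0 < m 2" using form_pos[of 0 1 0 0 0 0] by (simp add: vec_eq_6)
  moreover have "0 < m 3" using form_pos[of 0 0 1 0 0 0] by (simp add: vec_eq_6)
  moreover have "0 < m 5" using form_pos[of 0 0 0 0 1 0] by (simp add: vec_eq_6)
  moreover have "0 < m 6" using form_pos[of 0 0 0 0 0 1] by (simp add: vec_eq_6)
  moreover have "m 2 \<noteq> 1" "m 3 \<noteq> 1" "m 5 \<noteq> 1" "m 6 \<noteq> 1" using reduced by simp_all
  ultimately show "2 \<le> m 2" "2 \<le> m 3" "2 \<le> m 5" "2 \<le> m 6" by linarith+
qed

lemma M_pos: "0 < M" and P_pos: "0 < P"
  using leaves_ge_2 by (simp_all add: M_def P_def)

lemma A_pos: "0 < A"
proof -
  \<comment> \<open>The leaf entries M / m 2 and M / m 3 make the leaf components of L x vanish; the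
    component at vertex 1 is then A.\<close>
  have "vec6 M (m 3) (m 2) 0 0 0 \<noteq> 0" using M_pos by (simp add: vec_eq_6)
  from form_pos[OF this] have "0 < M * A"
    by (simp add: A_def M_def algebra_simps)
  then show ?thesis using M_pos by (simp add: zero_less_mult_iff)
qed

lemma B_pos: "0 < B"
proof -
  have "vec6 0 0 0 P (m 6) (m 5) \<noteq> 0" using P_pos by (simp add: vec_eq_6)
  from form_pos[OF this] have "0 < P * B"
    by (simp add: B_def P_def algebra_simps)
  then show ?thesis using P_pos by (simp add: zero_less_mult_iff)
qed

lemma det_pos: "0 < A * B - M * P"
proof -
  \<comment> \<open>The first column of the adjugate of L: its image has A B - M P at vertex 1 and 0
    elsewhere.\<close>
  have "vec6 (B * M) (B * m 3) (B * m 2) (M * P) (M * m 6) (M * m 5) \<noteq> 0"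
    using M_pos B_pos by (simp add: vec_eq_6)
  note form_pos[OF this]
  also have "B * M * (m 1 * (B * M) - B * m 3 - B * m 2 - M * P) + B * m 3 * (m 2 * (B * m 3) - B * M)
      + B * m 2 * (m 3 * (B * m 2) - B * M) + M * P * (m 4 * (M * P) - B * M - M * m 6 - M * m 5)
      + M * m 6 * (m 5 * (M * m 6) - M * P) + M * m 5 * (m 6 * (M * m 5) - M * P)
    = (B * M) * (A * B - M * P)"
  proof -
    have "m 4 * P - m 6 - m 5 = B" by (simp add: B_def)
    then have "m 4 * (M * P) - B * M - M * m 6 - M * m 5 = 0" by (simp add: algebra_simps flip: \<open>m 4 * P - m 6 - m 5 = B\<close>)
    moreover have "m 2 * (B * m 3) - B * M = 0" "m 3 * (B * m 2) - B * M = 0"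
      "m 5 * (M * m 6) - M * P = 0" "m 6 * (M * m 5) - M * P = 0" by (simp_all add: M_def P_def)
    moreover have "m 1 * (B * M) - B * m 3 - B * m 2 - M * P = A * B - M * P"
      by (simp add: A_def algebra_simps)
    ultimately show ?thesis by (simp only: mult_zero_right add_0_right)
  qed
  finally have "0 < (B * M) * (A * B - M * P)" .
  moreover have "0 < B * M" using M_pos B_pos by simp
  ultimately show ?thesis by (simp only: zero_less_mult_pos)
qed

text \<open>Multiplying by the integral inverse preserves divisibility. Through this lemma
  unimodularity yields coprimality and determinant 1 from explicit test vectors.\<close>

lemma dvd_of_dvd_linking:
  fixes x :: "int^6"
  assumes "\<And>j. p dvd (H_linking m *v x) $ j"
  shows "p dvd x $ j"
proof -
  obtain Y where Y: "Y ** H_linking m = mat 1" using unimodular by (auto simp: invertible_def)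
  have "x = Y *v (H_linking m *v x)" by (simp add: matrix_vector_mul_assoc Y)
  then have "x $ j = (Y *v (H_linking m *v x)) $ j" by (rule arg_cong)
  also have "\<dots> = (\<Sum>i\<in>UNIV. Y $ j $ i * (H_linking m *v x) $ i)"
    by (subst matrix_vector_mult_def) (simp only: vec_lambda_beta)
  also have "p dvd \<dots>" using assms by (intro dvd_sum dvd_mult)
  finally show ?thesis .
qed

text \<open>For the difference of two leaves at one node the contributions to the node cancel, so
  its image under L has only the two leaf weights, up to sign, as entries.\<close>

lemma leaves_no_common_divisor:
  "p dvd m 2 \<Longrightarrow> p dvd m 3 \<Longrightarrow> p dvd 1" "p dvd m 5 \<Longrightarrow> p dvd m 6 \<Longrightarrow> p dvd 1"
proof -
  assume p: "p dvd m 2" "p dvd m 3"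
  have "\<forall>j. p dvd (H_linking m *v vec6 0 1 (-1) 0 0 0) $ j"
    unfolding all_6 H_linking_mult using p by simp
  from dvd_of_dvd_linking[OF this[rule_format], of 2] show "p dvd 1" by simp
next
  assume p: "p dvd m 5" "p dvd m 6"
  have "\<forall>j. p dvd (H_linking m *v vec6 0 0 0 0 1 (-1)) $ j"
    unfolding all_6 H_linking_mult using p by simp
  from dvd_of_dvd_linking[OF this[rule_format], of 5] show "p dvd 1" by simp
qed

text \<open>
  The test vectors are the columns of the adjugate of \<open>L\<close> that belong to the leaves 2 and 3.
\<close>

lemma det_1: "A * B - M * P = 1"
proof (rule ccontr)
  assume "A * B - M * P \<noteq> 1"
  then have "\<not> is_unit (A * B - M * P)" using det_pos by auto
  then obtain p where p: "prime p" "p dvd A * B - M * P"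
    using det_pos prime_divisor_exists[of "A * B - M * P"] by auto
  have "\<forall>j. p dvd (H_linking m *v vec6 (B * m 3) (m 1 * B * m 3 - B - P * m 3) B (P * m 3) (m 3 * m 6) (m 3 * m 5)) $ j"
  proof -
    have "m 2 * (m 1 * B * m 3 - B - P * m 3) - B * m 3 = A * B - M * P"
      by (simp add: A_def M_def algebra_simps)
    moreover have "m 4 * (P * m 3) - B * m 3 - m 3 * m 6 - m 3 * m 5 = 0" by (simp add: B_def algebra_simps)
    moreover have "m 5 * (m 3 * m 6) - P * m 3 = 0" "m 6 * (m 3 * m 5) - P * m 3 = 0" by (simp_all add: P_def)
    moreover have "m 1 * (B * m 3) - (m 1 * B * m 3 - B - P * m 3) - B - P * m 3 = 0" by simp
    moreover have "m 3 * B - B * m 3 = 0" by simp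
    ultimately show ?thesis unfolding all_6 H_linking_mult vec6_nth using p(2) by (simp only: dvd_0_right simp_thms)
  qed
  note 1 = dvd_of_dvd_linking[OF this[rule_format]]
  have a: "p dvd m 3 * m 6" "p dvd m 3 * m 5" using 1[of 5] 1[of 6] by simp_all
  have "\<forall>j. p dvd (H_linking m *v vec6 (B * m 2) B (m 1 * B * m 2 - B - P * m 2) (P * m 2) (m 2 * m 6) (m 2 * m 5)) $ j"
  proof -
    have "m 3 * (m 1 * B * m 2 - B - P * m 2) - B * m 2 = A * B - M * P"
      by (simp add: A_def M_def algebra_simps)
    moreover have "m 4 * (P * m 2) - B * m 2 - m 2 * m 6 - m 2 * m 5 = 0" by (simp add: B_def algebra_simps)
    moreover have "m 5 * (m 2 * m 6) - P * m 2 = 0" "m 6 * (m 2 * m 5) - P * m 2 = 0" by (simp_all add: P_def)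
    moreover have "m 1 * (B * m 2) - B - (m 1 * B * m 2 - B - P * m 2) - P * m 2 = 0" by simp
    moreover have "m 2 * B - B * m 2 = 0" by simp
    ultimately show ?thesis unfolding all_6 H_linking_mult vec6_nth using p(2) by (simp only: dvd_0_right simp_thms)
  qed
  note 2 = dvd_of_dvd_linking[OF this[rule_format]]
  have b: "p dvd m 2 * m 6" "p dvd m 2 * m 5" using 2[of 5] 2[of 6] by simp_all
  have "\<not> p dvd 1" using p(1) by (meson not_prime_unit)
  \<comment> \<open>If p divides both m 2 and m 3, they share a divisor. Otherwise p misses one of
    them, and the products force it to divide both m 5 and m 6.\<close>
  then show False
    using a b leaves_no_common_divisor[of p] prime_dvd_mult_iff[OF p(1)] by blast
qed

text \<open>Equivalent to (a - 1) (b - 1) > 1, which for weights at least 2 fails only for the pair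
  2, 2; that pair is not coprime. The inequality is what lets a node entry determine the sign of u
  or v.\<close>

lemma leaf_sums: "m 2 + m 3 < M" "m 5 + m 6 < P"
proof -
  have *: "a + b < a * b" if "2 \<le> a" "2 \<le> b" "\<not> (a = 2 \<and> b = 2)" for a b :: int
  proof -
    have "1 < (a - 1) * (b - 1)"
    proof (cases "a = 2")
      case False
      then have "2 * 1 \<le> (a - 1) * (b - 1)" using that by (intro mult_mono) auto
      then show ?thesis by simp
    qed (use that in auto)
    then show ?thesis by (simp add: algebra_simps)
  qed
  show "m 2 + m 3 < M" unfolding M_def using leaves_ge_2 leaves_no_common_divisor(1)[of 2] by (intro *) auto
  show "m 5 + m 6 < P" unfolding P_def using leaves_ge_2 leaves_no_common_divisor(2)[of 2] by (intro *) auto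
qed

text \<open>Instead of inverting L, the solution of L x = l is written down. The leaf equations give
  x_j = (l_j + x_node) / m_j; what remains is A x1 - M x4 = U and B x4 - P x1 = V, of determinant 1,
  so Cramer's rule has no denominators. Leaf entries of square 1 make the remaining terms
  constant.\<close>

lemma inverse_form:
  fixes l :: "int^6"
  assumes leaves: "(l $ 2)\<^sup>2 = 1" "(l $ 3)\<^sup>2 = 1" "(l $ 5)\<^sup>2 = 1" "(l $ 6)\<^sup>2 = 1"
  defines "u \<equiv> M * l $ 1 + l $ 2 * m 3 + l $ 3 * m 2" and "v \<equiv> P * l $ 4 + l $ 5 * m 6 + l $ 6 * m 5"
  shows "real_vec l \<bullet> (matrix_inv (real_mat (H_linking m)) *v real_vec l)
    = of_int B * (of_int u)\<^sup>2 / of_int M + 2 * of_int u * of_int v + of_int A * (of_int v)\<^sup>2 / of_int P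
      + (1 / of_int (m 2) + 1 / of_int (m 3) + 1 / of_int (m 5) + 1 / of_int (m 6))"
proof -
  let ?L = "real_mat (H_linking m)"
  define a1 a2 a3 a4 a5 a6 where a: "a1 = real_of_int (m 1)" "a2 = real_of_int (m 2)" "a3 = real_of_int (m 3)"
    "a4 = real_of_int (m 4)" "a5 = real_of_int (m 5)" "a6 = real_of_int (m 6)"
  define l1 l2 l3 l4 l5 l6 where ld: "l1 = real_of_int (l $ 1)" "l2 = real_of_int (l $ 2)" "l3 = real_of_int (l $ 3)"
    "l4 = real_of_int (l $ 4)" "l5 = real_of_int (l $ 5)" "l6 = real_of_int (l $ 6)"
  define U V where UV: "U = real_of_int u" "V = real_of_int v"
  define b where "b = real_of_int B"
  define c where "c = real_of_int A"
  have nz: "a2 \<noteq> 0" "a3 \<noteq> 0" "a5 \<noteq> 0" "a6 \<noteq> 0" using leaves_ge_2 by (simp_all add: a)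
  have Me: "real_of_int M = a2 * a3" and Pe: "real_of_int P = a5 * a6" by (simp_all add: M_def P_def a)
  have c: "c = a1 * (a2 * a3) - a2 - a3" and b: "b = a4 * (a5 * a6) - a5 - a6"
    by (simp_all add: c_def b_def A_def B_def Me Pe a)
  have U: "U = a2 * a3 * l1 + l2 * a3 + l3 * a2" and V: "V = a5 * a6 * l4 + l5 * a6 + l6 * a5"
    by (simp_all add: UV u_def v_def Me Pe a ld)
  have "real_of_int (A * B - M * P) = 1" by (simp only: det_1 of_int_1)
  then have D: "c * b = a2 * a3 * (a5 * a6) + 1" by (simp add: c_def b_def Me Pe)
  define x1 where "x1 = b * U + a2 * a3 * V"
  define x4 where "x4 = a5 * a6 * U + c * V"
  define x where "x = vec6 x1 ((l2 + x1) / a2) ((l3 + x1) / a3) x4 ((l5 + x4) / a5) ((l6 + x4) / a6)"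
  have r1: "a2 * a3 * (a1 * x1 - (l2 + x1) / a2 - (l3 + x1) / a3 - x4) = a2 * a3 * l1"
  proof -
    have "a2 * a3 * (a1 * x1 - (l2 + x1) / a2 - (l3 + x1) / a3 - x4)
      = (a1 * (a2 * a3) - a2 - a3) * x1 - l2 * a3 - l3 * a2 - a2 * a3 * x4"
      using nz by (simp add: field_simps)
    also have "\<dots> = (c * b) * U - a2 * a3 * (a5 * a6) * U - l2 * a3 - l3 * a2"
      unfolding c[symmetric] x1_def x4_def by (simp add: algebra_simps)
    also have "\<dots> = a2 * a3 * l1" unfolding D U by (simp add: algebra_simps)
    finally show ?thesis .
  qed
  have r4: "a5 * a6 * (a4 * x4 - x1 - (l5 + x4) / a5 - (l6 + x4) / a6) = a5 * a6 * l4"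
  proof -
    have "a5 * a6 * (a4 * x4 - x1 - (l5 + x4) / a5 - (l6 + x4) / a6)
      = (a4 * (a5 * a6) - a5 - a6) * x4 - l5 * a6 - l6 * a5 - a5 * a6 * x1"
      using nz by (simp add: field_simps)
    also have "\<dots> = (c * b) * V - a2 * a3 * (a5 * a6) * V - l5 * a6 - l6 * a5"
      unfolding b[symmetric] x1_def x4_def by (simp add: algebra_simps)
    also have "\<dots> = a5 * a6 * l4" unfolding D V by (simp add: algebra_simps)
    finally show ?thesis .
  qed
  have "?L *v x = real_vec l"
    unfolding vec_eq_6 real_H_linking_mult x_def vec6_nth
    using r1 r4 nz by (simp add: real_vec_def a[symmetric] ld[symmetric])
  then have "matrix_inv ?L *v real_vec l = (matrix_inv ?L ** ?L) *v x"
    by (simp add: matrix_vector_mul_assoc[symmetric])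
  also have "\<dots> = x" by (simp add: matrix_inv_mult[OF invertible_real_mat[OF unimodular]])
  finally have "real_vec l \<bullet> (matrix_inv ?L *v real_vec l)
    = l1 * x1 + l2 * ((l2 + x1) / a2) + l3 * ((l3 + x1) / a3) + l4 * x4 + l5 * ((l5 + x4) / a5) + l6 * ((l6 + x4) / a6)"
    by (simp add: inner_vec_def sum_6 x_def real_vec_def ld)
  also have "\<dots> = (U / (a2 * a3)) * x1 + (V / (a5 * a6)) * x4 + (l2\<^sup>2 / a2 + l3\<^sup>2 / a3 + l5\<^sup>2 / a5 + l6\<^sup>2 / a6)"
    unfolding U V using nz by (simp add: field_simps power2_eq_square)
  also have "(U / (a2 * a3)) * x1 + (V / (a5 * a6)) * x4 = b * U\<^sup>2 / (a2 * a3) + 2 * U * V + c * V\<^sup>2 / (a5 * a6)"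
    unfolding x1_def x4_def using nz by (simp add: field_simps power2_eq_square)
  finally have main: "real_vec l \<bullet> (matrix_inv ?L *v real_vec l)
    = b * U\<^sup>2 / (a2 * a3) + 2 * U * V + c * V\<^sup>2 / (a5 * a6) + (l2\<^sup>2 / a2 + l3\<^sup>2 / a3 + l5\<^sup>2 / a5 + l6\<^sup>2 / a6)" .
  have "l2\<^sup>2 = 1" "l3\<^sup>2 = 1" "l5\<^sup>2 = 1" "l6\<^sup>2 = 1"
    using leaves unfolding ld by (simp_all only: of_int_power[symmetric] of_int_1)
  with main show ?thesis unfolding Me Pe UV[symmetric] b_def[symmetric] c_def[symmetric] a[symmetric] by (simp only:)
qed

end

subsection \<open>Principal value integrals over the unit circle\<close>

definition circ :: "real \<Rightarrow> complex" where
  "circ x = exp (2 * of_real pi * \<i> * of_real x)"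

lemma norm_circ [simp]: "norm (circ x) = 1"
  by (simp add: circ_def norm_exp_eq_Re)

lemma circ_nonzero [simp]: "circ x \<noteq> 0"
  by (simp add: circ_def)

lemma continuous_on_circ [continuous_intros]: "continuous_on S circ"
  unfolding circ_def by (intro continuous_intros)

lemma circ_reflect: "circ (1 - x) = inverse (circ x)"
proof -
  have "circ (1 - x) * circ x = exp (2 * of_real pi * \<i>)"
    unfolding circ_def exp_add[symmetric] by (simp add: algebra_simps)
  also have "\<dots> = 1" using exp_two_pi_i by simp
  finally show ?thesis by (metis inverse_unique mult.commute)
qed

definition cut_set :: "real \<Rightarrow> 6 \<Rightarrow> complex set" where
  "cut_set \<epsilon> j = {z. norm z = 1 \<and> (H_deg j \<le> 2 \<or> (\<epsilon> \<le> dist z 1 \<and> \<epsilon> \<le> dist z (-1)))}"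

definition cut_integral :: "real \<Rightarrow> 6 \<Rightarrow> (complex \<Rightarrow> complex) \<Rightarrow> complex" where
  "cut_integral \<epsilon> j g = contour_integral (circlepath 0 1)
     (\<lambda>z. if H_deg j \<le> 2 \<or> (\<epsilon> \<le> dist z 1 \<and> \<epsilon> \<le> dist z (-1)) then g z / z else 0)"

lemma cut_integral_eq:
  "cut_integral \<epsilon> j g = 2 * of_real pi * \<i> * integral {0..1} (\<lambda>x. if circ x \<in> cut_set \<epsilon> j then g (circ x) else 0)"
proof -
  have "cut_integral \<epsilon> j g = integral {0..1} (\<lambda>x. 2 * of_real pi * \<i> * (if circ x \<in> cut_set \<epsilon> j then g (circ x) else 0))"
    unfolding cut_integral_def contour_integral_integral vector_derivative_circlepath
    by (rule integral_cong) (auto simp: circlepath cut_set_def circ_def[symmetric])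
  then show ?thesis by simp
qed

lemma cut_integrable:
  fixes g :: "complex \<Rightarrow> complex"
  assumes "continuous_on (cut_set \<epsilon> j) g"
  shows "(\<lambda>x. if circ x \<in> cut_set \<epsilon> j then g (circ x) else 0) integrable_on {0..1}"
proof -
  let ?S = "{x \<in> {0..1}. circ x \<in> cut_set \<epsilon> j}"
  have "closed (cut_set \<epsilon> j)"
    unfolding cut_set_def
    by (intro closed_Collect_conj closed_Collect_disj closed_Collect_eq closed_Collect_le closed_Collect_const continuous_intros)
  then have "closed ({0..1} \<inter> circ -` cut_set \<epsilon> j)"
    by (intro continuous_closed_preimage continuous_intros) auto
  also have "{0..1} \<inter> circ -` cut_set \<epsilon> j = ?S" by auto
  finally have S: "compact ?S" by (auto simp: compact_eq_bounded_closed intro: bounded_subset[of "{0..1}"])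
  have "continuous_on ?S (\<lambda>x. g (circ x))"
    by (rule continuous_on_compose2[OF assms continuous_on_circ]) auto
  from borel_integrable_compact[OF S this]
  have "(\<lambda>x. indicator ?S x *\<^sub>R g (circ x)) integrable_on UNIV"
    using has_integral_integral_lborel by (auto simp: integrable_on_def)
  then have "(\<lambda>x. indicator ?S x *\<^sub>R g (circ x)) integrable_on {0..1}"
    by (rule integrable_on_subinterval) auto
  then show ?thesis
    by (rule integrable_eq) (auto simp: indicator_def)
qed

text \<open>The constant 7 stands for 2 pi.\<close>

lemma cut_integral_bound:
  assumes g: "continuous_on (cut_set \<epsilon> j) g" and b: "\<And>z. z \<in> cut_set \<epsilon> j \<Longrightarrow> norm (g z) \<le> b" "0 \<le> b"
  shows "norm (cut_integral \<epsilon> j g) \<le> 7 * b"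
proof -
  have "norm (integral {0..1} (\<lambda>x. if circ x \<in> cut_set \<epsilon> j then g (circ x) else 0)) \<le> b"
    using has_integral_bound_real[OF b(2) finite.emptyI integrable_integral[OF cut_integrable[OF g]]] b by auto
  then have "2 * pi * norm (integral {0..1} (\<lambda>x. if circ x \<in> cut_set \<epsilon> j then g (circ x) else 0)) \<le> 7 * b"
    using pi_less_4 pi_approx b by (intro mult_mono) auto
  then show ?thesis unfolding cut_integral_eq by (simp add: norm_mult)
qed

text \<open>Induction over the variables: those already integrated contribute numbers, the others
  still contribute kernels. As \<open>b\<close> bounds both the kernels and their integrals, one
  summable majorant justifies every exchange.\<close>

lemma cut_circle_integral_series:
  fixes c :: "int^6 \<Rightarrow> complex" and \<phi> :: "6 \<Rightarrow> int \<Rightarrow> complex \<Rightarrow> complex"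
  assumes \<phi>: "\<And>j k. continuous_on (cut_set \<epsilon> j) (\<phi> j k)"
      "\<And>j k z. z \<in> cut_set \<epsilon> j \<Longrightarrow> norm (\<phi> j k z) \<le> b j k"
    and D: "\<And>j k. norm (cut_integral \<epsilon> j (\<phi> j k)) \<le> b j k"
    and summ: "(\<lambda>l. norm (c l) * (\<Prod>j\<in>UNIV. b j (l $ j))) summable_on S"
    and F: "\<And>w. F w = (\<Sum>\<^sub>\<infinity>l\<in>S. c l * (\<Prod>j\<in>UNIV. \<phi> j (l $ j) (w j)))"
  shows "distinct js \<Longrightarrow> (\<And>j. j \<notin> set js \<Longrightarrow> w j \<in> cut_set \<epsilon> j) \<Longrightarrow>
    cut_circle_integral \<epsilon> js F w = (\<Sum>\<^sub>\<infinity>l\<in>S. c l *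
      (\<Prod>j\<in>UNIV. if j \<in> set js then cut_integral \<epsilon> j (\<phi> j (l $ j)) else \<phi> j (l $ j) (w j)))"
proof (induction js arbitrary: w)
  case Nil
  show ?case by (simp add: F)
next
  case (Cons j js)
  define R where "R = (\<lambda>l. c l * (\<Prod>i\<in>UNIV - {j}. if i \<in> set (j # js) then cut_integral \<epsilon> i (\<phi> i (l $ i)) else \<phi> i (l $ i) (w i)))"
  define \<psi> where "\<psi> = (\<lambda>k x. if circ x \<in> cut_set \<epsilon> j then \<phi> j k (circ x) else 0)"
  have b0: "0 \<le> b i k" for i k using D[of i k] norm_ge_zero order.trans by blast
  have split: "(\<Prod>i\<in>UNIV. f i) = f j * (\<Prod>i\<in>UNIV - {j}. f i)" for f :: "6 \<Rightarrow> 'z :: comm_monoid_mult"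
    by (rule prod.remove) auto
  have inner: "cut_circle_integral \<epsilon> js F (w(j := z)) = (\<Sum>\<^sub>\<infinity>l\<in>S. R l * \<phi> j (l $ j) z)"
    if z: "z \<in> cut_set \<epsilon> j" for z
  proof -
    have "cut_circle_integral \<epsilon> js F (w(j := z)) = (\<Sum>\<^sub>\<infinity>l\<in>S. c l *
      (\<Prod>i\<in>UNIV. if i \<in> set js then cut_integral \<epsilon> i (\<phi> i (l $ i)) else \<phi> i (l $ i) ((w(j := z)) i)))"
      using Cons.prems z by (intro Cons.IH) auto
    also have "\<dots> = (\<Sum>\<^sub>\<infinity>l\<in>S. R l * \<phi> j (l $ j) z)"
    proof (rule infsum_cong)
      fix l
      have "(\<Prod>i\<in>UNIV - {j}. if i \<in> set js then cut_integral \<epsilon> i (\<phi> i (l $ i)) else \<phi> i (l $ i) ((w(j := z)) i))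
        = (\<Prod>i\<in>UNIV - {j}. if i \<in> set (j # js) then cut_integral \<epsilon> i (\<phi> i (l $ i)) else \<phi> i (l $ i) (w i))"
        by (rule prod.cong) auto
      then show "c l * (\<Prod>i\<in>UNIV. if i \<in> set js then cut_integral \<epsilon> i (\<phi> i (l $ i)) else \<phi> i (l $ i) ((w(j := z)) i))
        = R l * \<phi> j (l $ j) z"
        unfolding R_def split using Cons.prems(1) by (simp add: mult_ac)
    qed
    finally show ?thesis .
  qed
  have Rb: "norm (R l) * b j (l $ j) \<le> norm (c l) * (\<Prod>i\<in>UNIV. b i (l $ i))" for l
  proof -
    have "norm (\<Prod>i\<in>UNIV - {j}. if i \<in> set (j # js) then cut_integral \<epsilon> i (\<phi> i (l $ i)) else \<phi> i (l $ i) (w i))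
      \<le> (\<Prod>i\<in>UNIV - {j}. b i (l $ i))"
      unfolding prod_norm[symmetric]
    proof (rule prod_mono)
      fix i assume "i \<in> UNIV - {j}"
      show "0 \<le> norm (if i \<in> set (j # js) then cut_integral \<epsilon> i (\<phi> i (l $ i)) else \<phi> i (l $ i) (w i)) \<and>
        norm (if i \<in> set (j # js) then cut_integral \<epsilon> i (\<phi> i (l $ i)) else \<phi> i (l $ i) (w i)) \<le> b i (l $ i)"
        using D \<phi>(2) Cons.prems(2)[of i] by (cases "i \<in> set (j # js)") auto
    qed
    then have "norm (R l) * b j (l $ j) \<le> (norm (c l) * (\<Prod>i\<in>UNIV - {j}. b i (l $ i))) * b j (l $ j)"
      unfolding R_def norm_mult by (intro mult_right_mono mult_left_mono b0) auto
    then show ?thesis unfolding split by (simp add: mult_ac)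
  qed
  have "((\<lambda>x. \<Sum>\<^sub>\<infinity>l\<in>S. R l * \<psi> (l $ j) x) has_integral (\<Sum>\<^sub>\<infinity>l\<in>S. integral {0..1} (\<lambda>x. R l * \<psi> (l $ j) x))) {0..1}"
  proof (rule has_integral_infsum[OF _ _ summ])
    fix l
    show "(\<lambda>x. R l * \<psi> (l $ j) x) integrable_on {0..1}"
      unfolding \<psi>_def by (intro integrable_on_mult_right cut_integrable \<phi>)
    fix x
    have "norm (\<psi> (l $ j) x) \<le> b j (l $ j)" unfolding \<psi>_def using \<phi>(2) b0 by auto
    then have "norm (R l * \<psi> (l $ j) x) \<le> norm (R l) * b j (l $ j)"
      unfolding norm_mult by (intro mult_left_mono) auto
    then show "norm (R l * \<psi> (l $ j) x) \<le> norm (c l) * (\<Prod>i\<in>UNIV. b i (l $ i))"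
      using Rb[of l] by linarith
  qed
  then have int: "integral {0..1} (\<lambda>x. \<Sum>\<^sub>\<infinity>l\<in>S. R l * \<psi> (l $ j) x) = (\<Sum>\<^sub>\<infinity>l\<in>S. R l * integral {0..1} (\<psi> (l $ j)))"
    by (simp add: integral_unique)
  have "cut_circle_integral \<epsilon> (j # js) F w = cut_integral \<epsilon> j (\<lambda>z. cut_circle_integral \<epsilon> js F (w(j := z)))"
    by (simp add: cut_integral_def)
  also have "\<dots> = 2 * of_real pi * \<i> * integral {0..1} (\<lambda>x. \<Sum>\<^sub>\<infinity>l\<in>S. R l * \<psi> (l $ j) x)"
    unfolding cut_integral_eq
    by (intro arg_cong2[where f = "(*)"] refl integral_cong) (simp add: inner \<psi>_def)
  also have "\<dots> = (\<Sum>\<^sub>\<infinity>l\<in>S. R l * (2 * of_real pi * \<i> * integral {0..1} (\<psi> (l $ j))))"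
    unfolding int by (subst infsum_cmult_right'[symmetric]) (simp add: mult_ac)
  also have "\<dots> = (\<Sum>\<^sub>\<infinity>l\<in>S. R l * cut_integral \<epsilon> j (\<phi> j (l $ j)))"
    unfolding cut_integral_eq \<psi>_def ..
  also have "\<dots> = (\<Sum>\<^sub>\<infinity>l\<in>S. c l *
      (\<Prod>i\<in>UNIV. if i \<in> set (j # js) then cut_integral \<epsilon> i (\<phi> i (l $ i)) else \<phi> i (l $ i) (w i)))"
    unfolding R_def split by (simp add: mult_ac)
  finally show ?case .
qed

definition circle_cut :: "real \<Rightarrow> complex set" where
  "circle_cut \<epsilon> = {z. norm z = 1 \<and> \<epsilon> \<le> dist z 1 \<and> \<epsilon> \<le> dist z (-1)}"

text \<open>Vertex 1 represents either node, since the cut depends only on the degree of the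
  vertex.\<close>

definition cut_moment :: "real \<Rightarrow> int \<Rightarrow> complex" where
  "cut_moment \<epsilon> k = cut_integral \<epsilon> 1 (\<lambda>z. z powi k)"

definition cut_pole_moment :: "real \<Rightarrow> int \<Rightarrow> complex" where
  "cut_pole_moment \<epsilon> k = cut_integral \<epsilon> 1 (\<lambda>z. inverse (z - inverse z) * z powi k)"

lemma cut_set_1: "cut_set \<epsilon> 1 = circle_cut \<epsilon>" "cut_set \<epsilon> 4 = circle_cut \<epsilon>"
  by (simp_all add: cut_set_def circle_cut_def)

lemma circle_cut_nonzero:
  assumes "z \<in> circle_cut \<epsilon>" "0 < \<epsilon>"
  shows "z \<noteq> 0" "z - inverse z \<noteq> 0" "norm (inverse (z - inverse z)) \<le> 1 / \<epsilon>\<^sup>2"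
proof -
  have n: "norm z = 1" "\<epsilon> \<le> dist z 1" "\<epsilon> \<le> dist z (-1)" using assms by (auto simp: circle_cut_def)
  show z: "z \<noteq> 0" using n by auto
  have e: "z - inverse z = (z - 1) * (z - (- 1)) / z" using z by (simp add: field_simps)
  have "\<epsilon>\<^sup>2 \<le> dist z 1 * dist z (-1)" unfolding power2_eq_square using n assms by (intro mult_mono) auto
  also have "\<dots> = norm (z - inverse z)" unfolding e norm_divide norm_mult n dist_norm by simp
  finally have l: "\<epsilon>\<^sup>2 \<le> norm (z - inverse z)" .
  moreover have "0 < \<epsilon>\<^sup>2" using assms by simp
  ultimately show "z - inverse z \<noteq> 0" by force
  show "norm (inverse (z - inverse z)) \<le> 1 / \<epsilon>\<^sup>2"
    unfolding norm_inverse divide_inverse mult_1 using l \<open>0 < \<epsilon>\<^sup>2\<close> by (rule le_imp_inverse_le)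
qed

lemma continuous_on_pole_kernel:
  assumes "0 < \<epsilon>"
  shows "continuous_on (circle_cut \<epsilon>) (\<lambda>z. inverse (z - inverse z) * z powi k)"
  using circle_cut_nonzero[OF _ assms] by (intro continuous_intros) auto

lemma norm_cut_moment: "norm (cut_moment \<epsilon> k) \<le> 7"
proof -
  have z: "z \<noteq> 0" "norm z = 1" if "z \<in> cut_set \<epsilon> 1" for z using that by (auto simp: cut_set_def)
  have "norm (cut_moment \<epsilon> k) \<le> 7 * 1"
    unfolding cut_moment_def
    by (rule cut_integral_bound) (use z in \<open>auto intro!: continuous_intros simp: norm_power_int\<close>)
  then show ?thesis by simp
qed

text \<open>
  The recursion removes the pole: \<open>z\<^bsup>k+2\<^esup> - z\<^bsup>k\<^esup> = (z - 1 / z) z\<^bsup>k+1\<^esup>\<close>. Together with the reflection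
  \<open>z \<mapsto> 1 / z\<close>, which fixes the value at \<open>k = 1\<close>, it determines all odd moments.
\<close>

lemma cut_pole_moment_step:
  assumes "0 < \<epsilon>"
  shows "cut_pole_moment \<epsilon> (k + 2) = cut_pole_moment \<epsilon> k + cut_moment \<epsilon> (k + 1)"
proof -
  let ?I = "\<lambda>g. integral {0..1} (\<lambda>x. if circ x \<in> cut_set \<epsilon> 1 then g (circ x) else 0)"
  let ?g = "\<lambda>k z. inverse (z - inverse z) * z powi k :: complex"
  have i1: "(\<lambda>x. if circ x \<in> cut_set \<epsilon> 1 then ?g k (circ x) else 0) integrable_on {0..1}"
    by (rule cut_integrable) (simp only: cut_set_1 continuous_on_pole_kernel[OF assms])
  have i2: "(\<lambda>x. if circ x \<in> cut_set \<epsilon> 1 then circ x powi (k + 1) else 0) integrable_on {0..1}"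
    by (rule cut_integrable) (auto intro!: continuous_intros simp: cut_set_def)
  have "?g (k + 2) z = ?g k z + z powi (k + 1)" if "z \<in> circle_cut \<epsilon>" for z
  proof -
    note nz = circle_cut_nonzero[OF that assms]
    have "z powi (k + 2) = z powi k * (z * z)" "z powi (k + 1) = z powi k * z"
      using nz by (simp_all add: power_int_add power2_eq_square)
    moreover have "z * z = 1 + (z - inverse z) * z" using nz by (simp add: field_simps)
    moreover have "inverse d * (p * (1 + d * x)) = inverse d * p + p * x" if "d \<noteq> 0" for d p x :: complex
      using that by (simp add: field_simps)
    ultimately show ?thesis using nz(2) by metis
  qed
  then have "?I (?g (k + 2)) = integral {0..1} (\<lambda>x. (if circ x \<in> cut_set \<epsilon> 1 then ?g k (circ x) else 0)
      + (if circ x \<in> cut_set \<epsilon> 1 then circ x powi (k + 1) else 0))"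
    by (intro integral_cong) (simp add: cut_set_1)
  also have "\<dots> = ?I (?g k) + ?I (\<lambda>z. z powi (k + 1))"
    by (rule Henstock_Kurzweil_Integration.integral_add[OF i1 i2])
  finally show ?thesis
    unfolding cut_pole_moment_def cut_moment_def cut_integral_eq by (simp add: distrib_left)
qed

lemma cut_pole_moment_uminus:
  assumes "0 < \<epsilon>"
  shows "cut_pole_moment \<epsilon> (- k) = - cut_pole_moment \<epsilon> k"
proof -
  let ?g = "\<lambda>k z. inverse (z - inverse z) * z powi k :: complex"
  let ?f = "\<lambda>k x. if circ x \<in> cut_set \<epsilon> 1 then ?g k (circ x) else 0"
  have int: "?f k integrable_on {0..1}" for k
    by (rule cut_integrable) (simp only: cut_set_1 continuous_on_pole_kernel[OF assms])
  have "((\<lambda>x. ?f k (- 1 * x + 1)) has_integral (1 / \<bar>- 1\<bar>) * integral {0..1} (?f k)) ((\<lambda>x. (x - 1) / (- 1)) ` {0..1})"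
    using has_integral_affinity01[OF integrable_integral[OF int], of "-1" 1] by simp
  moreover have "(\<lambda>x. (x - 1) / (- 1)) ` {0..1} = {0..1 :: real}"
    by (auto simp: image_iff intro!: bexI[of _ "1 - _"])
  ultimately have "((\<lambda>x. ?f k (- 1 * x + 1)) has_integral (1 / \<bar>- 1\<bar>) * integral {0..1} (?f k)) {0..1}"
    by (simp only:)
  moreover have "- 1 * x + 1 = 1 - x" "(1 :: complex) / \<bar>- 1\<bar> = 1" for x :: real by simp_all
  ultimately have "((\<lambda>x. ?f k (1 - x)) has_integral integral {0..1} (?f k)) {0..1}"
    unfolding mult_1 by (simp only: mult_1 cong: if_cong)
  moreover have "?f k (1 - x) = - ?f (- k) x" for x
  proof -
    define z where "z = circ x"
    have z: "z \<noteq> 0" "norm z = 1" by (simp_all add: z_def)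
    have "z * cnj z = 1" using complex_norm_square[of z] z(2) by simp
    then have iz: "inverse z = cnj z" by (rule inverse_unique)
    \<comment> \<open>On the unit circle inversion is conjugation, which preserves the distances to
      1 and -1; the cut is therefore symmetric.\<close>
    have "dist (inverse z) 1 = dist z 1" "dist (inverse z) (-1) = dist z (-1)"
      using complex_mod_cnj[of "z - 1"] complex_mod_cnj[of "z - (- 1)"] unfolding iz dist_norm by simp_all
    then have c: "inverse z \<in> cut_set \<epsilon> 1 \<longleftrightarrow> z \<in> cut_set \<epsilon> 1"
      using z by (simp add: cut_set_def norm_inverse)
    have "inverse (inverse z - inverse (inverse z)) * inverse z powi k = - (inverse (z - inverse z) * z powi (- k))"
    proof -
      have "inverse z - inverse (inverse z) = - (z - inverse z)" by simp
      moreover have "inverse z powi k = z powi (- k)" by (simp add: power_int_inverse power_int_minus)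
      ultimately show ?thesis by (simp only: inverse_minus_eq) simp
    qed
    then show ?thesis unfolding circ_reflect z_def[symmetric] c by simp
  qed
  ultimately have "((\<lambda>x. - ?f (- k) x) has_integral integral {0..1} (?f k)) {0..1}" by simp
  then have "integral {0..1} (\<lambda>x. - ?f (- k) x) = integral {0..1} (?f k)" by (rule integral_unique)
  then have "integral {0..1} (?f (- k)) = - integral {0..1} (?f k)"
    by (simp only: integral_neg equation_minus_iff minus_minus)
  then show ?thesis unfolding cut_pole_moment_def cut_integral_eq by simp
qed

lemma cut_pole_moment_odd:
  assumes "0 < \<epsilon>"
  shows "cut_pole_moment \<epsilon> (2 * int n + 1) = cut_moment \<epsilon> 0 / 2 + (\<Sum>i\<in>{1..n}. cut_moment \<epsilon> (2 * int i))"
proof (induction n)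
  case 0
  have "cut_pole_moment \<epsilon> 1 = - cut_pole_moment \<epsilon> 1 + cut_moment \<epsilon> 0"
    using cut_pole_moment_step[OF assms, of "-1"] cut_pole_moment_uminus[OF assms, of 1] by simp
  then have "2 * cut_pole_moment \<epsilon> 1 = cut_moment \<epsilon> 0" by (simp add: algebra_simps)
  then show ?case by (simp add: mult.commute)
next
  case (Suc n)
  have "cut_pole_moment \<epsilon> (2 * int (Suc n) + 1) = cut_pole_moment \<epsilon> (2 * int n + 1) + cut_moment \<epsilon> (2 * int (Suc n))"
    using cut_pole_moment_step[OF assms, of "2 * int n + 1"] by (simp add: algebra_simps)
  then show ?case by (simp add: Suc)
qed

text \<open>The bound is uniform in \<epsilon>, unlike any bound on the kernel: it comes from the
  finite sum of moments without pole. Its linear growth in k is harmless against Gaussian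
  coefficients.\<close>

lemma norm_cut_pole_moment:
  assumes "0 < \<epsilon>" "odd k"
  shows "norm (cut_pole_moment \<epsilon> k) \<le> 7 * (1 + \<bar>real_of_int k\<bar>)"
proof -
  have pos: "norm (cut_pole_moment \<epsilon> (2 * int n + 1)) \<le> 7 * (1 + \<bar>real_of_int (2 * int n + 1)\<bar>)" for n
  proof -
    have "norm (cut_pole_moment \<epsilon> (2 * int n + 1)) \<le> norm (cut_moment \<epsilon> 0 / 2) + norm (\<Sum>i\<in>{1..n}. cut_moment \<epsilon> (2 * int i))"
      unfolding cut_pole_moment_odd[OF assms(1)] by (rule norm_triangle_ineq)
    also have "norm (\<Sum>i\<in>{1..n}. cut_moment \<epsilon> (2 * int i)) \<le> (\<Sum>i\<in>{1..n}. 7)"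
      by (rule sum_norm_le) (rule norm_cut_moment)
    finally show ?thesis using norm_cut_moment[of \<epsilon> 0] by (simp add: norm_divide)
  qed
  from assms(2) obtain j where j: "k = 2 * j + 1" by (elim oddE)
  show ?thesis
  proof (cases "0 \<le> j")
    case True
    then show ?thesis using pos[of "nat j"] unfolding j by simp
  next
    case False
    then have k: "k = - (2 * int (nat (- j - 1)) + 1)" unfolding j by simp
    show ?thesis using pos[of "nat (- j - 1)"] unfolding k cut_pole_moment_uminus[OF assms(1)] norm_minus_cancel by simp
  qed
qed

lemma integral_circ_powi: "integral {0..1} (\<lambda>x. circ x powi k) = (if k = 0 then 1 else 0)"
proof (cases "k = 0")
  case False
  define c where "c = 2 * of_real pi * \<i> * of_int k"
  have c: "c \<noteq> 0" using False by (simp add: c_def)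
  have e: "circ x powi k = exp (c * of_real x)" for x
    unfolding circ_def c_def exp_power_int by (simp add: mult_ac)
  have "((\<lambda>x. exp (c * of_real x)) has_integral exp (c * of_real 1) / c - exp (c * of_real 0) / c) {0..1}"
  proof (rule fundamental_theorem_of_calculus)
    fix x :: real
    have "((\<lambda>z. exp (c * z) / c) has_field_derivative exp (c * of_real x)) (at (of_real x))"
      using c by (auto intro!: derivative_eq_intros)
    then have "((\<lambda>x. exp (c * of_real x) / c) has_vector_derivative exp (c * of_real x)) (at x)"
      by (rule has_vector_derivative_real_field)
    then show "((\<lambda>x. exp (c * of_real x) / c) has_vector_derivative exp (c * of_real x)) (at x within {0..1})"
      by (rule has_vector_derivative_at_within)
  qed simp
  moreover have "exp c = 1"
    unfolding c_def using exp_integer_2pi[of "of_int k"] by (simp add: mult_ac)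
  ultimately show ?thesis using False unfolding e by (simp add: integral_unique)
qed simp

lemma cut_moment_tendsto:
  "((\<lambda>\<epsilon>. cut_moment \<epsilon> k) \<longlongrightarrow> (if k = 0 then 2 * of_real pi * \<i> else 0)) (at_right 0)"
proof -
  let ?g = "\<lambda>x. if circ x \<noteq> 1 \<and> circ x \<noteq> -1 then circ x powi k else 0"
  have "{x \<in> {0..1}. circ x = 1 \<or> circ x = -1} \<subseteq> {0, 1/2, 1}"
  proof
    fix x assume x: "x \<in> {x \<in> {0..1}. circ x = 1 \<or> circ x = -1}"
    then have "circ x * circ x = 1" by auto
    then have "exp (2 * of_real pi * \<i> * of_real (2 * x)) = 1"
      unfolding circ_def exp_add[symmetric] by (simp add: algebra_simps)
    then obtain n :: int where "2 * pi * (2 * x) = of_int (2 * n) * pi"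
      unfolding exp_eq_1 by auto
    then have "2 * x = of_int n" by simp
    moreover have "0 \<le> 2 * x" "2 * x \<le> 2" using x by auto
    ultimately have "0 \<le> n" "n \<le> 2" by linarith+
    then have "n = 0 \<or> n = 1 \<or> n = 2" by auto
    with \<open>2 * x = of_int n\<close> show "x \<in> {0, 1/2, 1}" by auto
  qed
  then have fin: "finite {x \<in> {0..1}. circ x = 1 \<or> circ x = -1}" by (rule finite_subset) simp
  have "integral {0..1} (\<lambda>x. circ x powi k) = integral {0..1} ?g"
    by (rule integral_spike[OF negligible_finite[OF fin]]) auto
  then have ig: "integral {0..1} ?g = (if k = 0 then 1 else 0)" by (simp only: integral_circ_powi)
  have "((\<lambda>\<epsilon>. integral {0..1} (\<lambda>x. if circ x \<in> cut_set \<epsilon> 1 then circ x powi k else 0)) \<longlongrightarrow> integral {0..1} ?g) (at_right 0)"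
  proof (rule tendsto_at_right_sequentially[of 0 1])
    fix S :: "nat \<Rightarrow> real" assume S: "\<And>n. 0 < S n" "S \<longlonglongrightarrow> 0"
    show "(\<lambda>n. integral {0..1} (\<lambda>x. if circ x \<in> cut_set (S n) 1 then circ x powi k else 0)) \<longlonglongrightarrow> integral {0..1} ?g"
    proof (rule dominated_convergence(2)[where h = "\<lambda>_. 1"])
      show "(\<lambda>x. if circ x \<in> cut_set (S n) 1 then circ x powi k else 0) integrable_on {0..1}" for n
        by (rule cut_integrable) (auto intro!: continuous_intros simp: cut_set_def)
      show "norm (if circ x \<in> cut_set (S n) 1 then circ x powi k else 0) \<le> 1" for n x
        by (simp add: norm_power_int)
      show "(\<lambda>n. if circ x \<in> cut_set (S n) 1 then circ x powi k else 0) \<longlonglongrightarrow> ?g x" for x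
      proof (cases "circ x \<noteq> 1 \<and> circ x \<noteq> -1")
        case True
        then have "0 < min (dist (circ x) 1) (dist (circ x) (-1))" by simp
        from order_tendstoD(2)[OF S(2) this]
        have "\<forall>\<^sub>F n in sequentially. (if circ x \<in> cut_set (S n) 1 then circ x powi k else 0) = ?g x"
          by eventually_elim (use True in \<open>auto simp: cut_set_def\<close>)
        then show ?thesis by (rule tendsto_eventually)
      next
        case False
        then have "circ x \<notin> cut_set (S n) 1" for n
          using S(1)[of n] by (auto simp: cut_set_def)
        then show ?thesis using False by (simp only: if_False simp_thms tendsto_const)
      qed
    qed auto
  qed simp
  then have "((\<lambda>\<epsilon>. cut_moment \<epsilon> k) \<longlongrightarrow> 2 * of_real pi * \<i> * (if k = 0 then 1 else 0)) (at_right 0)"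
    unfolding cut_moment_def cut_integral_eq ig by (intro tendsto_intros)
  then show ?thesis by (simp split: if_splits)
qed

text \<open>Of the moments in \<open>cut_pole_moment_odd\<close> only the one of order 0 survives
  the limit, and it carries the factor 1/2; antisymmetry in k supplies the sign.\<close>

lemma cut_pole_moment_tendsto:
  assumes "odd k"
  shows "((\<lambda>\<epsilon>. cut_pole_moment \<epsilon> k) \<longlongrightarrow> of_real pi * \<i> * of_int (sgn k)) (at_right 0)"
proof -
  have ev: "\<forall>\<^sub>F \<epsilon> in at_right (0::real). 0 < \<epsilon>" by (rule eventually_at_right_less)
  have pos: "((\<lambda>\<epsilon>. cut_pole_moment \<epsilon> (2 * int n + 1)) \<longlongrightarrow> of_real pi * \<i>) (at_right 0)" for n
  proof -
    have "((\<lambda>\<epsilon>. cut_moment \<epsilon> 0 / 2 + (\<Sum>i\<in>{1..n}. cut_moment \<epsilon> (2 * int i)))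
      \<longlongrightarrow> (if (0 :: int) = 0 then 2 * of_real pi * \<i> else 0) / 2 + (\<Sum>i\<in>{1..n}. if 2 * int i = 0 then 2 * of_real pi * \<i> else 0)) (at_right 0)"
      by (intro tendsto_intros cut_moment_tendsto) simp
    also have "(\<Sum>i\<in>{1..n}. if 2 * int i = 0 then 2 * of_real pi * \<i> else 0) = 0"
      by (rule sum.neutral) auto
    finally have "((\<lambda>\<epsilon>. cut_moment \<epsilon> 0 / 2 + (\<Sum>i\<in>{1..n}. cut_moment \<epsilon> (2 * int i))) \<longlongrightarrow> of_real pi * \<i>) (at_right 0)"
      by simp
    moreover have "\<forall>\<^sub>F \<epsilon> in at_right 0. cut_moment \<epsilon> 0 / 2 + (\<Sum>i\<in>{1..n}. cut_moment \<epsilon> (2 * int i)) = cut_pole_moment \<epsilon> (2 * int n + 1)"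
      using ev by eventually_elim (simp only: cut_pole_moment_odd)
    ultimately show ?thesis by (rule Lim_transform_eventually)
  qed
  from assms obtain j where j: "k = 2 * j + 1" by (elim oddE)
  show ?thesis
  proof (cases "0 \<le> j")
    case True
    then show ?thesis using pos[of "nat j"] unfolding j by simp
  next
    case False
    define n where "n = nat (- j - 1)"
    have k: "k = - (2 * int n + 1)" using False unfolding j n_def by simp
    have "((\<lambda>\<epsilon>. - cut_pole_moment \<epsilon> (2 * int n + 1)) \<longlongrightarrow> - (of_real pi * \<i>)) (at_right 0)"
      by (intro tendsto_minus pos)
    moreover have "\<forall>\<^sub>F \<epsilon> in at_right 0. - cut_pole_moment \<epsilon> (2 * int n + 1) = cut_pole_moment \<epsilon> k"
      unfolding k using ev by eventually_elim (simp only: cut_pole_moment_uminus)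
    moreover have "of_real pi * \<i> * of_int (sgn k) = - (of_real pi * \<i>)" unfolding k by simp
    ultimately show ?thesis using Lim_transform_eventually by force
  qed
qed

lemma leaf_moment:
  assumes "H_deg j \<le> 2"
  shows "cut_integral \<epsilon> j (\<lambda>z. (z - inverse z) * z powi k) = 2 * of_real pi * \<i> * ((if k = - 1 then 1 else 0) - (if k = 1 then 1 else 0))"
proof -
  have c: "circ x \<in> cut_set \<epsilon> j" for x using assms by (simp add: cut_set_def)
  have "(circ x - inverse (circ x)) * circ x powi k = circ x powi (k + 1) - circ x powi (k - 1)" for x
    by (simp add: power_int_add power_int_diff field_simps)
  then have "integral {0..1} (\<lambda>x. if circ x \<in> cut_set \<epsilon> j then (circ x - inverse (circ x)) * circ x powi k else 0)
    = integral {0..1} (\<lambda>x. circ x powi (k + 1) - circ x powi (k - 1))"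
    using c by simp
  also have "\<dots> = integral {0..1} (\<lambda>x. circ x powi (k + 1)) - integral {0..1} (\<lambda>x. circ x powi (k - 1))"
    by (intro Henstock_Kurzweil_Integration.integral_diff integrable_continuous_real continuous_intros) auto
  also have "\<dots> = (if k = - 1 then 1 else 0) - (if k = 1 then 1 else 0)"
    unfolding integral_circ_powi by auto
  finally show ?thesis unfolding cut_integral_eq by simp
qed

subsection \<open>The invariant as a sum of false theta functions\<close>

lemma summable_on_prod_vec6:
  fixes f :: "6 \<Rightarrow> int \<Rightarrow> real"
  assumes "\<And>j. f j summable_on UNIV" "\<And>j k. 0 \<le> f j k"
  shows "(\<lambda>l :: int^6. \<Prod>j\<in>UNIV. f j (l $ j)) summable_on UNIV"
proof -
  have "Infinite_Set_Sum.abs_summable_on (f j) UNIV" for j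
  proof -
    have "(\<lambda>k. norm (f j k)) = f j" using assms(2) by auto
    then show ?thesis using assms(1)[of j] unfolding abs_summable_equivalent[symmetric] by simp
  qed
  then have "Infinite_Set_Sum.abs_summable_on (\<lambda>g. \<Prod>j\<in>UNIV. f j (g j)) (PiE UNIV (\<lambda>_. UNIV))"
    by (intro abs_summable_on_prod_PiE) auto
  then have "(\<lambda>g. \<Prod>j\<in>UNIV. f j (g j)) summable_on UNIV"
    unfolding abs_summable_equivalent[symmetric] PiE_UNIV_domain UNIV_I Pi_UNIV by (rule abs_summable_summable)
  moreover have "bij_betw (vec_nth :: int^6 \<Rightarrow> _) UNIV UNIV"
    by (rule bij_betw_byWitness[where f' = vec_lambda]) auto
  ultimately show ?thesis
    using summable_on_reindex_bij_betw[of vec_nth UNIV UNIV "\<lambda>g. \<Prod>j\<in>UNIV. f j (g j)"] by simp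
qed

lemma summable_on_gauss_linear:
  assumes "0 < a" "0 \<le> K"
  shows "(\<lambda>k::int. exp (- a * (of_int k)\<^sup>2) * (K * (1 + \<bar>real_of_int k\<bar>))) summable_on UNIV"
proof (rule has_sum_bound_nonneg)
  show "(\<lambda>k::int. K * exp (- a * (of_int k + 0)\<^sup>2 + 1 * \<bar>of_int k + 0\<bar>)) summable_on UNIV"
    by (intro summable_on_cmult_right summable_on_gauss_shift assms)
  fix k :: int
  have "1 + \<bar>real_of_int k\<bar> \<le> exp \<bar>real_of_int k\<bar>" by (rule exp_ge_add_one_self)
  then have "exp (- a * (of_int k)\<^sup>2) * (K * (1 + \<bar>real_of_int k\<bar>)) \<le> exp (- a * (of_int k)\<^sup>2) * (K * exp \<bar>real_of_int k\<bar>)"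
    using assms by (intro mult_left_mono) auto
  then show "exp (- a * (of_int k)\<^sup>2) * (K * (1 + \<bar>real_of_int k\<bar>)) \<le> K * exp (- a * (of_int k + 0)\<^sup>2 + 1 * \<bar>of_int k + 0\<bar>)"
    unfolding exp_add by (simp only: add_0_right mult_1 mult_ac)
qed (use assms in auto)

definition H_kernel :: "6 \<Rightarrow> int \<Rightarrow> complex \<Rightarrow> complex" where
  "H_kernel j k z = (z - inverse z) powi (2 - int (H_deg j)) * z powi k"

definition H_moment :: "6 \<Rightarrow> int \<Rightarrow> complex" where
  "H_moment j k = (if H_deg j = 1 then 2 * of_real pi * \<i> * ((if k = - 1 then 1 else 0) - (if k = 1 then 1 else 0))
     else of_real pi * \<i> * of_int (sgn k))"

lemma H_deg_cases: "H_deg j = 1 \<or> H_deg j = 3"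
proof -
  have "\<forall>j. H_deg j = 1 \<or> H_deg j = 3" unfolding all_6 by simp
  then show ?thesis by blast
qed

lemma H_kernel_leaf: "H_deg j = 1 \<Longrightarrow> H_kernel j k = (\<lambda>z. (z - inverse z) * z powi k)"
  by (simp add: H_kernel_def fun_eq_iff)

lemma H_kernel_node: "H_deg j = 3 \<Longrightarrow> H_kernel j k = (\<lambda>z. inverse (z - inverse z) * z powi k)"
  by (simp add: H_kernel_def fun_eq_iff power_int_minus)

lemma cut_set_node: "H_deg j = 3 \<Longrightarrow> cut_set \<epsilon> j = circle_cut \<epsilon>"
  by (simp add: cut_set_def circle_cut_def)

lemma cut_integral_node: "H_deg j = 3 \<Longrightarrow> cut_integral \<epsilon> j (H_kernel j k) = cut_pole_moment \<epsilon> k"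
  by (simp add: H_kernel_node cut_pole_moment_def cut_integral_def)

lemma H_kernel_continuous:
  assumes "0 < \<epsilon>"
  shows "continuous_on (cut_set \<epsilon> j) (H_kernel j k)"
  using H_deg_cases[of j]
proof
  assume j: "H_deg j = 1"
  have "z \<noteq> 0" if "z \<in> cut_set \<epsilon> j" for z using that by (auto simp: cut_set_def)
  then show ?thesis unfolding H_kernel_leaf[OF j] by (intro continuous_intros) auto
next
  assume j: "H_deg j = 3"
  show ?thesis unfolding H_kernel_node[OF j] cut_set_node[OF j] by (rule continuous_on_pole_kernel[OF assms])
qed

lemma H_kernel_bound:
  assumes "0 < \<epsilon>" "z \<in> cut_set \<epsilon> j"
  shows "norm (H_kernel j k z) \<le> 2 + 1 / \<epsilon>\<^sup>2"
  using H_deg_cases[of j]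
proof
  assume j: "H_deg j = 1"
  have z: "norm z = 1" using assms by (auto simp: cut_set_def)
  have "norm (z - inverse z) \<le> norm z + norm (inverse z)" by (rule norm_triangle_ineq4)
  also have "\<dots> = 2" using z by (simp add: norm_inverse)
  finally have "norm (H_kernel j k z) \<le> 2" unfolding H_kernel_leaf[OF j] using z by (simp add: norm_mult norm_power_int)
  then show ?thesis using assms by (simp add: add_increasing2)
next
  assume j: "H_deg j = 3"
  have z: "z \<in> circle_cut \<epsilon>" "norm z = 1" using assms j by (auto simp: cut_set_def circle_cut_def)
  have "norm (H_kernel j k z) \<le> 1 / \<epsilon>\<^sup>2"
    unfolding H_kernel_node[OF j] using circle_cut_nonzero(3)[OF z(1) assms(1)] z(2) by (simp add: norm_mult norm_power_int)
  then show ?thesis by simp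
qed

lemma norm_H_moment_cut:
  assumes "0 < \<epsilon>" "odd k"
  shows "norm (cut_integral \<epsilon> j (H_kernel j k)) \<le> 14 * (1 + \<bar>real_of_int k\<bar>)"
  using H_deg_cases[of j]
proof
  assume j: "H_deg j = 1"
  have "norm (cut_integral \<epsilon> j (H_kernel j k)) \<le> 2 * pi * 1"
    unfolding H_kernel_leaf[OF j] leaf_moment[of j, unfolded j, OF one_le_numeral] by (simp add: norm_mult)
  then show ?thesis using pi_less_4 by simp
next
  assume j: "H_deg j = 3"
  show ?thesis unfolding cut_integral_node[OF j] using norm_cut_pole_moment[OF assms] by simp
qed

lemma H_moment_tendsto:
  assumes "odd k"
  shows "((\<lambda>\<epsilon>. cut_integral \<epsilon> j (H_kernel j k)) \<longlongrightarrow> H_moment j k) (at_right 0)"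
  using H_deg_cases[of j]
proof
  assume j: "H_deg j = 1"
  show ?thesis unfolding H_kernel_leaf[OF j] leaf_moment[of j, unfolded j, OF one_le_numeral] H_moment_def using j by simp
next
  assume j: "H_deg j = 3"
  show ?thesis unfolding cut_integral_node[OF j] H_moment_def using j cut_pole_moment_tendsto[OF assms] by simp
qed

lemma norm_H_moment: "norm (H_moment j k) \<le> 14 * (1 + \<bar>real_of_int k\<bar>)"
proof -
  have "norm (H_moment j k) \<le> 2 * pi" by (simp add: H_moment_def norm_mult sgn_if)
  then show ?thesis using pi_less_4 by simp
qed

context H_graph begin

abbreviation "Linv \<equiv> matrix_inv (real_mat (H_linking m))"

definition zcoeff :: "complex \<Rightarrow> int^6 \<Rightarrow> complex" where
  "zcoeff \<tau> l = qpow \<tau> ((1/4) * (real_vec l \<bullet> (Linv *v real_vec l)))"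

definition odd_vecs :: "(int^6) set" where
  "odd_vecs = {l. \<forall>j. odd (l $ j)}"

text \<open>The lower bound for the inverse form dominates the coefficient by a product of six
  Gaussians, so the sum factorises over the vertices and absorbs the linear factors.\<close>

lemma summable_zcoeff:
  assumes tau: "0 < Im \<tau>" and K: "0 \<le> K"
  shows "(\<lambda>l. norm (zcoeff \<tau> l) * (\<Prod>j\<in>UNIV. K * (1 + \<bar>real_of_int (l $ j)\<bar>))) summable_on S"
proof -
  obtain c where c: "0 < c" "\<And>l. c * (norm l)\<^sup>2 \<le> l \<bullet> (Linv *v l)"
    using inverse_form_lower[OF pos_def invertible_real_mat[OF unimodular]] by blast
  define a where "a = 2 * pi * Im \<tau> / 4 * c"
  have a: "0 < a" using tau c by (simp add: a_def)
  have "(\<lambda>l :: int^6. \<Prod>j\<in>UNIV. exp (- a * (of_int (l $ j))\<^sup>2) * (K * (1 + \<bar>real_of_int (l $ j)\<bar>))) summable_on UNIV"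
    by (rule summable_on_prod_vec6[of "\<lambda>j k. exp (- a * (of_int k)\<^sup>2) * (K * (1 + \<bar>real_of_int k\<bar>))"])
       (use summable_on_gauss_linear[OF a K] K in auto)
  then have "(\<lambda>l. norm (zcoeff \<tau> l) * (\<Prod>j\<in>UNIV. K * (1 + \<bar>real_of_int (l $ j)\<bar>))) summable_on UNIV"
  proof (rule has_sum_bound_nonneg[rotated 2])
    fix l :: "int^6"
    have p: "0 \<le> (\<Prod>j\<in>UNIV. K * (1 + \<bar>real_of_int (l $ j)\<bar>))" using K by (intro prod_nonneg) auto
    then show "0 \<le> norm (zcoeff \<tau> l) * (\<Prod>j\<in>UNIV. K * (1 + \<bar>real_of_int (l $ j)\<bar>))" by simp
    have n: "(norm (real_vec l))\<^sup>2 = (\<Sum>j\<in>UNIV. (of_int (l $ j))\<^sup>2)"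
      unfolding power2_norm_eq_inner inner_vec_def by (simp add: real_vec_def power2_eq_square)
    have "norm (zcoeff \<tau> l) = exp (- (2 * pi * Im \<tau> / 4 * (real_vec l \<bullet> (Linv *v real_vec l))))"
      unfolding zcoeff_def norm_qpow by simp
    also have "\<dots> \<le> exp (- (a * (norm (real_vec l))\<^sup>2))"
      unfolding a_def using mult_left_mono[OF c(2)[of "real_vec l"], of "2 * pi * Im \<tau> / 4"] tau by (simp add: mult.assoc)
    also have "\<dots> = (\<Prod>j\<in>UNIV. exp (- a * (of_int (l $ j))\<^sup>2))"
      unfolding n by (simp add: exp_sum[symmetric] sum_distrib_left sum_negf)
    finally have "norm (zcoeff \<tau> l) \<le> (\<Prod>j\<in>UNIV. exp (- a * (of_int (l $ j))\<^sup>2))" .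
    then show "norm (zcoeff \<tau> l) * (\<Prod>j\<in>UNIV. K * (1 + \<bar>real_of_int (l $ j)\<bar>))
      \<le> (\<Prod>j\<in>UNIV. exp (- a * (of_int (l $ j))\<^sup>2) * (K * (1 + \<bar>real_of_int (l $ j)\<bar>)))"
      unfolding prod.distrib[of "\<lambda>j. exp (- a * (of_int (l $ j))\<^sup>2)" "\<lambda>j. K * (1 + \<bar>real_of_int (l $ j)\<bar>)"]
      using p by (rule mult_right_mono)
  qed
  then show ?thesis by (rule summable_on_subset_banach) auto
qed

lemma summable_moments:
  assumes tau: "0 < Im \<tau>"
  shows "(\<lambda>l. zcoeff \<tau> l * (\<Prod>j\<in>UNIV. H_moment j (l $ j))) summable_on S"
proof (rule abs_summable_summable, rule has_sum_bound_nonneg[OF _ _ summable_zcoeff[OF tau, of 14]])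
  fix l
  show "norm (zcoeff \<tau> l * (\<Prod>j\<in>UNIV. H_moment j (l $ j))) \<le> norm (zcoeff \<tau> l) * (\<Prod>j\<in>UNIV. 14 * (1 + \<bar>real_of_int (l $ j)\<bar>))"
    unfolding norm_mult prod_norm[symmetric] by (intro mult_left_mono prod_mono) (use norm_H_moment in auto)
qed auto

text \<open>All degrees of the H-graph are odd, and a unimodular L is onto over the integers, so the
  coset consists of all vectors with odd entries.\<close>

lemma odd_vecs_eq:
  assumes parity: "\<And>j. [\<delta> $ j = int (H_deg j)] (mod 2)"
  shows "{l. \<exists>n. l = 2 *s (H_linking m *v n) + \<delta>} = odd_vecs"
proof -
  have od: "odd (\<delta> $ j)" for j
    using parity[of j] H_deg_cases[of j] by (auto simp: cong_def even_iff_mod_2_eq_zero)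
  obtain Y where Y: "H_linking m ** Y = mat 1" using unimodular by (auto simp: invertible_def)
  show ?thesis
  proof (intro equalityI subsetI)
    fix l assume "l \<in> {l. \<exists>n. l = 2 *s (H_linking m *v n) + \<delta>}"
    then show "l \<in> odd_vecs" using od by (auto simp: odd_vecs_def)
  next
    fix l assume l: "l \<in> odd_vecs"
    define k where "k = (\<chi> j. (l $ j - \<delta> $ j) div 2)"
    have "2 * ((l $ j - \<delta> $ j) div 2) = l $ j - \<delta> $ j" for j
      using l od[of j] by (auto simp: odd_vecs_def)
    then have "l = 2 *s k + \<delta>" by (simp add: vec_eq_iff k_def)
    moreover have "k = H_linking m *v (Y *v k)" by (simp add: matrix_vector_mul_assoc Y)
    ultimately have "l = 2 *s (H_linking m *v (Y *v k)) + \<delta>" by simp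
    then show "l \<in> {l. \<exists>n. l = 2 *s (H_linking m *v n) + \<delta>}" by blast
  qed
qed

lemma PV_eq:
  assumes parity: "\<And>j. [\<delta> $ j = int (H_deg j)] (mod 2)" and tau: "0 < Im \<tau>"
  shows "PV_circle_integral (\<lambda>w. (\<Prod>j\<in>UNIV. (w j - inverse (w j)) powi (2 - int (H_deg j)))
      * Theta_L (H_linking m) \<delta> \<tau> w) = (\<Sum>\<^sub>\<infinity>l\<in>odd_vecs. zcoeff \<tau> l * (\<Prod>j\<in>UNIV. H_moment j (l $ j)))"
proof -
  let ?F = "\<lambda>w. (\<Prod>j\<in>UNIV. (w j - inverse (w j)) powi (2 - int (H_deg j))) * Theta_L (H_linking m) \<delta> \<tau> w"
  have F: "?F w = (\<Sum>\<^sub>\<infinity>l\<in>odd_vecs. zcoeff \<tau> l * (\<Prod>j\<in>UNIV. H_kernel j (l $ j) (w j)))" for w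
    unfolding Theta_L_def odd_vecs_eq[OF parity] infsum_cmult_right'[symmetric]
    by (rule infsum_cong) (simp add: zcoeff_def H_kernel_def prod.distrib mult_ac)
  have "((\<lambda>\<epsilon>. \<Sum>\<^sub>\<infinity>l\<in>odd_vecs. zcoeff \<tau> l * (\<Prod>j\<in>UNIV. cut_integral \<epsilon> j (H_kernel j (l $ j))))
    \<longlongrightarrow> (\<Sum>\<^sub>\<infinity>l\<in>odd_vecs. zcoeff \<tau> l * (\<Prod>j\<in>UNIV. H_moment j (l $ j)))) (at_right 0)"
  proof (rule tendsto_infsum)
    show "\<forall>\<^sub>F \<epsilon> in at_right 0. \<epsilon> \<in> {0::real<..}"
      using eventually_at_right_less[of 0] by simp
    show "(\<lambda>l. norm (zcoeff \<tau> l) * (\<Prod>j\<in>UNIV. 14 * (1 + \<bar>real_of_int (l $ j)\<bar>))) summable_on odd_vecs"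
      by (rule summable_zcoeff[OF tau]) simp
    fix l assume l: "l \<in> odd_vecs"
    then have o: "odd (l $ j)" for j by (auto simp: odd_vecs_def)
    show "((\<lambda>\<epsilon>. zcoeff \<tau> l * (\<Prod>j\<in>UNIV. cut_integral \<epsilon> j (H_kernel j (l $ j))))
      \<longlongrightarrow> zcoeff \<tau> l * (\<Prod>j\<in>UNIV. H_moment j (l $ j))) (at_right 0)"
      by (intro tendsto_intros H_moment_tendsto o)
    fix \<epsilon> :: real assume "\<epsilon> \<in> {0<..}"
    then show "norm (zcoeff \<tau> l * (\<Prod>j\<in>UNIV. cut_integral \<epsilon> j (H_kernel j (l $ j))))
      \<le> norm (zcoeff \<tau> l) * (\<Prod>j\<in>UNIV. 14 * (1 + \<bar>real_of_int (l $ j)\<bar>))"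
      unfolding norm_mult prod_norm[symmetric]
      by (intro mult_left_mono prod_mono) (use norm_H_moment_cut[OF _ o] in auto)
  qed simp
  moreover have "\<forall>\<^sub>F \<epsilon> in at_right 0. (\<Sum>\<^sub>\<infinity>l\<in>odd_vecs. zcoeff \<tau> l * (\<Prod>j\<in>UNIV. cut_integral \<epsilon> j (H_kernel j (l $ j))))
      = cut_circle_integral \<epsilon> [1, 2, 3, 4, 5, 6] ?F (\<lambda>_. 1)"
    using eventually_at_right_less[of "0 :: real"]
  proof eventually_elim
    case (elim \<epsilon>)
    \<comment> \<open>Chosen to bound the kernels, by 2 + 1 / \<epsilon>^2, and their integrals, by
      7 times as much, simultaneously. It is used only while \<epsilon> is fixed; the limit above
      uses the constant 14.\<close>
    define K where "K = 7 * (2 + 1 / \<epsilon>\<^sup>2)"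
    have "0 \<le> x \<Longrightarrow> 0 \<le> 7 * x \<and> x \<le> 7 * x" for x :: real by simp
    from this[of "2 + 1 / \<epsilon>\<^sup>2"] have K: "0 \<le> K" "2 + 1 / \<epsilon>\<^sup>2 \<le> K" unfolding K_def by simp_all
    have K1: "x \<le> K * (1 + \<bar>real_of_int k\<bar>)" if "x \<le> K" for x k
    proof -
      have "K * 1 \<le> K * (1 + \<bar>real_of_int k\<bar>)" using K by (intro mult_left_mono) auto
      with that show ?thesis by linarith
    qed
    have set: "j \<in> set [1, 2, 3, 4, 5, 6]" for j :: 6
      using UNIV_6 by (metis UNIV_I list.set(1) list.set(2))
    have "cut_circle_integral \<epsilon> [1, 2, 3, 4, 5, 6] ?F (\<lambda>_. 1) = (\<Sum>\<^sub>\<infinity>l\<in>odd_vecs. zcoeff \<tau> l *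
      (\<Prod>j\<in>UNIV. if j \<in> set [1, 2, 3, 4, 5, 6] then cut_integral \<epsilon> j (H_kernel j (l $ j)) else H_kernel j (l $ j) 1))"
    proof (rule cut_circle_integral_series[where b = "\<lambda>j k. K * (1 + \<bar>real_of_int k\<bar>)" and w = "\<lambda>_. 1"])
      show "continuous_on (cut_set \<epsilon> j) (H_kernel j k)" for j k by (rule H_kernel_continuous[OF elim])
      show "norm (H_kernel j k z) \<le> K * (1 + \<bar>real_of_int k\<bar>)" if "z \<in> cut_set \<epsilon> j" for j k z
        using H_kernel_bound[OF elim that] K by (intro K1) (rule order.trans)
      show "norm (cut_integral \<epsilon> j (H_kernel j k)) \<le> K * (1 + \<bar>real_of_int k\<bar>)" for j k
        unfolding K_def[symmetric]
        by (intro K1, unfold K_def, rule cut_integral_bound[OF H_kernel_continuous[OF elim] H_kernel_bound[OF elim]]) auto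
      show "(\<lambda>l. norm (zcoeff \<tau> l) * (\<Prod>j\<in>UNIV. K * (1 + \<bar>real_of_int (l $ j)\<bar>))) summable_on odd_vecs"
        by (rule summable_zcoeff[OF tau K(1)])
      show "w j \<in> cut_set \<epsilon> j" if "j \<notin> set [1, 2, 3, 4, 5, 6]" for j and w :: "6 \<Rightarrow> complex" using set that by blast
    qed (use F in simp_all)
    then show ?case using set by simp
  qed
  ultimately have "((\<lambda>\<epsilon>. cut_circle_integral \<epsilon> [1, 2, 3, 4, 5, 6] ?F (\<lambda>_. 1)) \<longlongrightarrow>
    (\<Sum>\<^sub>\<infinity>l\<in>odd_vecs. zcoeff \<tau> l * (\<Prod>j\<in>UNIV. H_moment j (l $ j)))) (at_right 0)"
    by (rule Lim_transform_eventually)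
  then show ?thesis
    unfolding PV_circle_integral_def by (intro tendsto_Lim) simp_all
qed

definition signs :: "(int \<times> int \<times> int \<times> int) set" where
  "signs = {-1, 1} \<times> {-1, 1} \<times> {-1, 1} \<times> {-1, 1}"

text \<open>The signs a, b, c, d are the entries at the leaves 2, 3, 5, 6. The offsets M and P, with
  steps 2 M and 2 P, come from the odd node entries 2 x + 1 and 2 y + 1. Each node contributes half
  of 2 pi \<i>, hence the factor 1/4.\<close>

definition zhat_series :: "complex \<Rightarrow> complex" where
  "zhat_series \<tau> = (\<Sum>(a, b, c, d)\<in>signs. of_int (a * b * c * d) / 4
     * false_theta M P A B (M + a * m 3 + b * m 2) (P + c * m 6 + d * m 5) \<tau>)"

text \<open>The value is N (2 x + 1) plus a perturbation of absolute value less than N, so the odd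
  multiple of N decides the sign and 0 is never reached.\<close>

lemma progression_sgn:
  assumes "a \<in> {-1, 1}" "b \<in> {-1, 1}" "s + t < N" "0 < s" "0 < t" "0 < (N :: int)"
  shows "sgn (N + a * s + b * t + 2 * N * x) = sgn (2 * x + 1)" "N + a * s + b * t + 2 * N * x \<noteq> 0"
proof -
  have e: "N + a * s + b * t + 2 * N * x = N * (2 * x + 1) + (a * s + b * t)" by (simp add: algebra_simps)
  have ab: "\<bar>a * s + b * t\<bar> < N" using assms by auto
  have "sgn (N + a * s + b * t + 2 * N * x) = sgn (2 * x + 1) \<and> N + a * s + b * t + 2 * N * x \<noteq> 0"
  proof (cases "0 \<le> x")
    case True
    then have "N * 1 \<le> N * (2 * x + 1)" using assms by (intro mult_left_mono) auto
    then show ?thesis unfolding e using ab True by (auto simp: sgn_if)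
  next
    case False
    then have "N * (2 * x + 1) \<le> N * (- 1)" using assms by (intro mult_left_mono) auto
    then show ?thesis unfolding e using ab False by (auto simp: sgn_if)
  qed
  then show "sgn (N + a * s + b * t + 2 * N * x) = sgn (2 * x + 1)" "N + a * s + b * t + 2 * N * x \<noteq> 0" by auto
qed

text \<open>The map \<kappa> enumerates the odd vectors at which no leaf moment vanishes. On them
  \<open>inverse_form\<close> splits the exponent into \<open>quad\<close> and a constant q / 4,
  which joins the prefactor to form \<open>Zhat_exponent\<close>.\<close>

lemma Zhat_eq:
  assumes parity: "\<And>j. [\<delta> $ j = int (H_deg j)] (mod 2)" and tau: "0 < Im \<tau>"
  shows "Zhat m \<delta> \<tau> = qpow \<tau> (Zhat_exponent m) * zhat_series \<tau>"
proof -
  define T where "T = (\<lambda>l. zcoeff \<tau> l * (\<Prod>j\<in>UNIV. H_moment j (l $ j)))"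
  define \<kappa> where "\<kappa> = (\<lambda>((a, b, c, d), (x, y)). vec6 (2 * x + 1) a b (2 * y + 1) c d :: int^6)"
  let ?I = "signs \<times> (UNIV :: (int \<times> int) set)"
  define q where "q = 1 / real_of_int (m 2) + 1 / of_int (m 3) + 1 / of_int (m 5) + 1 / of_int (m 6)"
  have inj: "inj_on \<kappa> ?I" by (auto simp: inj_on_def \<kappa>_def vec_eq_6)
  have img: "\<kappa> ` ?I = {l \<in> odd_vecs. l $ 2 \<in> {-1, 1} \<and> l $ 3 \<in> {-1, 1} \<and> l $ 5 \<in> {-1, 1} \<and> l $ 6 \<in> {-1, 1}}"
  proof (intro equalityI subsetI)
    fix l assume "l \<in> \<kappa> ` ?I"
    then show "l \<in> {l \<in> odd_vecs. l $ 2 \<in> {-1, 1} \<and> l $ 3 \<in> {-1, 1} \<and> l $ 5 \<in> {-1, 1} \<and> l $ 6 \<in> {-1, 1}}"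
      unfolding odd_vecs_def all_6 by (auto simp: \<kappa>_def signs_def)
  next
    fix l assume l: "l \<in> {l \<in> odd_vecs. l $ 2 \<in> {-1, 1} \<and> l $ 3 \<in> {-1, 1} \<and> l $ 5 \<in> {-1, 1} \<and> l $ 6 \<in> {-1, 1}}"
    then obtain x y where xy: "l $ 1 = 2 * x + 1" "l $ 4 = 2 * y + 1"
      by (auto simp: odd_vecs_def all_6 elim!: oddE)
    then have "l = \<kappa> ((l $ 2, l $ 3, l $ 5, l $ 6), (x, y))" by (simp add: \<kappa>_def vec_eq_6)
    moreover have "((l $ 2, l $ 3, l $ 5, l $ 6), (x, y)) \<in> ?I" using l by (simp only: signs_def mem_Sigma_iff mem_Collect_eq UNIV_I simp_thms)
    ultimately show "l \<in> \<kappa> ` ?I" by (rule image_eqI)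
  qed
  have term_eq: "qpow \<tau> e * T (\<kappa> ((a, b, c, d), (x, y))) / (2 * of_real pi * \<i>) ^ 6
    = qpow \<tau> (e + q / 4) * (of_int (a * b * c * d) / 4 * (of_int (sgn (M + a * m 3 + b * m 2 + 2 * M * x) * sgn (P + c * m 6 + d * m 5 + 2 * P * y))
        * qpow \<tau> (quad M P A B (M + a * m 3 + b * m 2 + 2 * M * x) (P + c * m 6 + d * m 5 + 2 * P * y))))"
    if s: "(a, b, c, d) \<in> signs" for a b c d x y e
  proof -
    define l where "l = \<kappa> ((a, b, c, d), (x, y))"
    define u v where "u = M + a * m 3 + b * m 2 + 2 * M * x" and "v = P + c * m 6 + d * m 5 + 2 * P * y"
    have pm: "a \<in> {-1, 1}" "b \<in> {-1, 1}" "c \<in> {-1, 1}" "d \<in> {-1, 1}" using s by (auto simp: signs_def)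
    have l: "l $ 1 = 2 * x + 1" "l $ 2 = a" "l $ 3 = b" "l $ 4 = 2 * y + 1" "l $ 5 = c" "l $ 6 = d"
      by (simp_all add: l_def \<kappa>_def)
    have sq: "(l $ 2)\<^sup>2 = 1" "(l $ 3)\<^sup>2 = 1" "(l $ 5)\<^sup>2 = 1" "(l $ 6)\<^sup>2 = 1"
      unfolding l using pm by auto
    have uv: "M * l $ 1 + l $ 2 * m 3 + l $ 3 * m 2 = u" "P * l $ 4 + l $ 5 * m 6 + l $ 6 * m 5 = v"
      unfolding l u_def v_def by (simp_all add: algebra_simps)
    have z: "zcoeff \<tau> l = qpow \<tau> (quad M P A B u v) * qpow \<tau> (q / 4)"
      unfolding zcoeff_def inverse_form[OF sq, unfolded uv] q_def qpow_add[symmetric] quad_def 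
      by (rule arg_cong[where f = "qpow \<tau>"]) (simp add: add_divide_distrib distrib_left mult_ac)
    have leaf: "H_moment j k = - (2 * of_real pi * \<i> * of_int k)" if "H_deg j = 1" "k \<in> {-1, 1}" for j k
      using that by (auto simp: H_moment_def)
    have su: "sgn u = sgn (2 * x + 1)" "sgn v = sgn (2 * y + 1)"
      unfolding u_def v_def using pm leaf_sums leaves_ge_2 M_pos P_pos by (auto intro!: progression_sgn(1))
    have node: "H_moment j k = 2 * of_real pi * \<i> * of_int (sgn k) / 2" if "H_deg j = 3" for j k
      using that by (simp add: H_moment_def)
    \<comment> \<open>Here w stands for 2 pi \<i>. The six factors match the normalisation of the
      integral, and the four signs of the leaf moments cancel.\<close>
    have ring: "(w * s / 2) * (- (w * a')) * (- (w * b')) * (w * t / 2) * (- (w * c')) * (- (w * d'))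
      = w ^ 6 * (a' * b' * c' * d' / 4 * (s * t))" for w s t a' b' c' d' :: complex
      by (simp add: eval_nat_numeral mult_ac)
    have deg: "H_deg 1 = 3" "H_deg 2 = 1" "H_deg 3 = 1" "H_deg 4 = 3" "H_deg 5 = 1" "H_deg 6 = 1" by simp_all
    have mo: "(\<Prod>j\<in>UNIV. H_moment j (l $ j)) = (2 * of_real pi * \<i>) ^ 6 * (of_int (a * b * c * d) / 4 * of_int (sgn u * sgn v))"
      unfolding prod_6 l su of_int_mult node[OF deg(1)] node[OF deg(4)]
        leaf[OF deg(2) pm(1)] leaf[OF deg(3) pm(2)] leaf[OF deg(5) pm(3)] leaf[OF deg(6) pm(4)]
      by (rule ring)
    have "qpow \<tau> e * T l / (2 * of_real pi * \<i>) ^ 6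
      = qpow \<tau> (e + q / 4) * (of_int (a * b * c * d) / 4 * (of_int (sgn u * sgn v) * qpow \<tau> (quad M P A B u v)))"
      unfolding T_def z mo qpow_add by (simp add: mult_ac)
    then show ?thesis unfolding l_def u_def v_def .
  qed
  define e where "e = (- 3 * 6 + of_int (trace (H_linking m))) / (4 :: real)"
  let ?c = "\<lambda>l. qpow \<tau> e * T l / (2 * of_real pi * \<i>) ^ 6"
  have leaves: "{j. H_deg j = 1} = {2, 3, 5, 6}"
  proof -
    have "\<forall>j. H_deg j = 1 \<longleftrightarrow> j \<in> {2, 3, 5, 6}" unfolding all_6 by simp
    then show ?thesis by blast
  qed
  have ex: "Zhat_exponent m = e + q / 4"
    unfolding Zhat_exponent_def e_def q_def leaves by simp
  have T: "T summable_on S" for S unfolding T_def by (rule summable_moments[OF tau])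
  then have cs: "?c summable_on S" for S
    using summable_on_cmult_right[OF T, of "qpow \<tau> e / (2 * of_real pi * \<i>) ^ 6" S] by simp
  have "Zhat m \<delta> \<tau> = qpow \<tau> e / (2 * of_real pi * \<i>) ^ 6 * infsum T odd_vecs"
    unfolding Zhat_def PV_eq[OF parity tau] T_def e_def by simp
  also have "\<dots> = infsum ?c odd_vecs"
    by (subst infsum_cmult_right'[symmetric]) simp
  also have "\<dots> = infsum ?c (\<kappa> ` ?I)"
  proof (rule infsum_cong_neutral)
    fix l assume "l \<in> odd_vecs - \<kappa> ` ?I"
    then have "\<not> (l $ 2 \<in> {-1, 1} \<and> l $ 3 \<in> {-1, 1} \<and> l $ 5 \<in> {-1, 1} \<and> l $ 6 \<in> {-1, 1})" unfolding img by blast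
    then have "\<exists>j. H_deg j = 1 \<and> l $ j \<notin> {-1, 1}"
      by (auto intro: exI[of _ 2] exI[of _ 3] exI[of _ 5] exI[of _ 6])
    then have "\<exists>j. H_moment j (l $ j) = 0" by (auto simp: H_moment_def)
    then have "T l = 0" unfolding T_def by auto
    then show "?c l = 0" by simp
  qed (auto simp: img)
  also have "\<dots> = infsum (?c \<circ> \<kappa>) ?I" by (rule infsum_reindex[OF inj])
  also have "\<dots> = (\<Sum>\<^sub>\<infinity>s\<in>signs. \<Sum>\<^sub>\<infinity>p\<in>UNIV. ?c (\<kappa> (s, p)))"
  proof -
    have "(?c \<circ> \<kappa>) summable_on ?I" using summable_on_reindex[OF inj, of ?c] cs by blast
    from infsum_Sigma_banach[OF this] show ?thesis by simp
  qed
  also have "\<dots> = (\<Sum>s\<in>signs. \<Sum>\<^sub>\<infinity>p\<in>UNIV. ?c (\<kappa> (s, p)))" by (simp add: signs_def)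
  also have "\<dots> = (\<Sum>(a, b, c, d)\<in>signs. qpow \<tau> (Zhat_exponent m) * (of_int (a * b * c * d) / 4
     * false_theta M P A B (M + a * m 3 + b * m 2) (P + c * m 6 + d * m 5) \<tau>))"
  proof (rule sum.cong)
    fix s assume s: "s \<in> signs"
    obtain a b c d where abcd: "s = (a, b, c, d)" by (cases s)
    show "(\<Sum>\<^sub>\<infinity>p\<in>UNIV. ?c (\<kappa> (s, p))) = (case s of (a, b, c, d) \<Rightarrow> qpow \<tau> (Zhat_exponent m) * (of_int (a * b * c * d) / 4
     * false_theta M P A B (M + a * m 3 + b * m 2) (P + c * m 6 + d * m 5) \<tau>))"
      unfolding abcd prod.case false_theta_def infsum_cmult_right'[symmetric]
    proof (rule infsum_cong)
      fix p :: "int \<times> int"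
      obtain x y where p: "p = (x, y)" by (cases p)
      show "?c (\<kappa> ((a, b, c, d), p)) = qpow \<tau> (Zhat_exponent m) * (of_int (a * b * c * d) / 4 * (case p of (x, y) \<Rightarrow>
         of_int (sgn (M + a * m 3 + b * m 2 + 2 * M * x) * sgn (P + c * m 6 + d * m 5 + 2 * P * y))
         * qpow \<tau> (quad M P A B (M + a * m 3 + b * m 2 + 2 * M * x) (P + c * m 6 + d * m 5 + 2 * P * y))))"
        unfolding p prod.case ex by (rule term_eq[OF s[unfolded abcd]])
    qed
  qed simp
  also have "\<dots> = qpow \<tau> (Zhat_exponent m) * zhat_series \<tau>"
    unfolding zhat_series_def sum_distrib_left by (simp add: case_prod_unfold)
  finally show ?thesis .
qed

sublocale unimodular_form M P A B
  by unfold_locales (use M_pos P_pos A_pos B_pos det_1 in auto)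

lemma zhat_series_representable: "eichler_representable zhat_series"
proof -
  have "eichler_representable (\<lambda>\<tau>. \<Sum>s\<in>S. (\<lambda>(a, b, c, d). of_int (a * b * c * d) / 4
     * false_theta M P A B (M + a * m 3 + b * m 2) (P + c * m 6 + d * m 5) \<tau>) s)"
    if "finite S" "S \<subseteq> signs" for S
    using that
  proof (induction S)
    case empty
    \<comment> \<open>The zero function is obtained as 0 times an arbitrary representable false
      theta function.\<close>
    have "eichler_representable (\<lambda>\<tau>. 0 * false_theta M P A B (M + 1 * m 3 + 1 * m 2) (P + 1 * m 6 + 1 * m 5) \<tau>)"
      by (intro eichler_representable_cmult eichler_representable_false_theta progression_sgn(2))
         (use leaf_sums leaves_ge_2 M_pos P_pos in auto)
    then show ?case by simp
  next
    case (insert s S)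
    obtain a b c d where s: "s = (a, b, c, d)" by (cases s)
    then have "a \<in> {-1, 1}" "b \<in> {-1, 1}" "c \<in> {-1, 1}" "d \<in> {-1, 1}" using insert.prems by (auto simp: signs_def)
    then have "eichler_representable (false_theta M P A B (M + a * m 3 + b * m 2) (P + c * m 6 + d * m 5))"
      by (intro eichler_representable_false_theta progression_sgn(2))
         (use leaf_sums leaves_ge_2 M_pos P_pos in auto)
    then show ?case
      unfolding sum.insert[OF insert(1,2)] unfolding s prod.case
      using insert by (intro eichler_representable_add eichler_representable_cmult) auto
  qed
  from this[of signs] show ?thesis
    unfolding zhat_series_def[abs_def] by (simp add: signs_def)
qed

lemma zhat_series_completion: "\<exists>F. is_completion 1 zhat_series F"
proof -
  define g where "g = (\<lambda>(a, b, c, d) \<tau>. of_int (a * b * c * d) / 4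
     * false_theta M P A B (M + a * m 3 + b * m 2) (P + c * m 6 + d * m 5) \<tau>)"
  have g: "zhat_series \<tau> = (\<Sum>s\<in>signs. g s \<tau>)" for \<tau>
    unfolding zhat_series_def g_def by (rule sum.cong) (auto split: prod.split)
  have "\<exists>C\<ge>0. \<forall>\<tau>. 0 < Im \<tau> \<longrightarrow> norm (g s \<tau>) \<le> C * (1 + 1 / Im \<tau>)\<^sup>2" for s
  proof -
    obtain a b c d where s: "s = (a, b, c, d)" by (cases s)
    obtain C where C: "C \<ge> 0" "\<And>\<tau>. 0 < Im \<tau> \<Longrightarrow>
      norm (false_theta M P A B (M + a * m 3 + b * m 2) (P + c * m 6 + d * m 5) \<tau>) \<le> C * (1 + 1 / Im \<tau>)\<^sup>2"
      using false_theta_bound by blast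
    define K where "K = norm (of_int (a * b * c * d) / 4 :: complex)"
    have "norm (g s \<tau>) \<le> (K * C) * (1 + 1 / Im \<tau>)\<^sup>2" if "0 < Im \<tau>" for \<tau>
      unfolding s g_def prod.case norm_mult[of "of_int (a * b * c * d) / 4"] K_def[symmetric] mult.assoc[of K]
      by (rule mult_left_mono[OF C(2)[OF that]]) (simp add: K_def)
    moreover have "0 \<le> K * C" using C(1) by (simp add: K_def)
    ultimately show ?thesis by blast
  qed
  then have "\<exists>C. \<forall>s. 0 \<le> C s \<and> (\<forall>\<tau>. 0 < Im \<tau> \<longrightarrow> norm (g s \<tau>) \<le> C s * (1 + 1 / Im \<tau>)\<^sup>2)"
    by (intro choice) blast
  then obtain C where C: "\<And>s. 0 \<le> C s" "\<And>s \<tau>. 0 < Im \<tau> \<Longrightarrow> norm (g s \<tau>) \<le> C s * (1 + 1 / Im \<tau>)\<^sup>2"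
    by blast
  \<comment> \<open>The level is the common period of all the false theta functions in the sum, and
    a multiple of 4.\<close>
  interpret p: poincare_data "4 * M * P" zhat_series "sum C signs"
  proof
    show "zhat_series holomorphic_on upper_half_plane"
      unfolding zhat_series_def[abs_def] case_prod_unfold
      by (intro holomorphic_intros false_theta_holomorphic)
    show "zhat_series (\<tau> + of_int (4 * M * P * j)) = zhat_series \<tau>" for \<tau> j
      unfolding zhat_series_def false_theta_periodic ..
    show "norm (zhat_series \<tau>) \<le> sum C signs * (1 + 1 / Im \<tau>)\<^sup>2" if "0 < Im \<tau>" for \<tau>
      unfolding g sum_distrib_right by (rule sum_norm_le) (rule C(2)[OF that])
    show "0 \<le> sum C signs" by (intro sum_nonneg C)
    show "0 < 4 * M * P" using M_pos P_pos by simp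
    show "4 dvd 4 * M * P" by simp
  qed
  show ?thesis by (rule p.completion_exists)
qed

end

lemma is_completion_cong:
  assumes "is_completion k f F" "\<And>\<tau>. 0 < Im \<tau> \<Longrightarrow> f \<tau> = g \<tau>"
  shows "is_completion k g F"
  using assms unfolding is_completion_def by simp

theorem theorem1p3:
  fixes m :: "6 \<Rightarrow> int" and \<delta> :: "int^6"
  assumes pos_def: "pos_def_mat (real_mat (H_linking m))"
    and unimodular: "invertible (H_linking m)"
    and reduced: "\<And>j. H_deg j = 1 \<Longrightarrow> m j \<noteq> 1"
    and parity: "\<And>j. [\<delta> $ j = int (H_deg j)] (mod 2)"
  shows "(\<exists>\<Theta>1 \<Theta>2. comb_of_unary_theta_deriv_products \<Theta>1 \<and> rank_two_theta \<Theta>2 \<and>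
            (\<forall>\<tau>\<in>upper_half_plane. \<exists>I.
               has_iterated_integral
                 (\<lambda>w1 w2. \<Theta>1 w1 w2 / (csqrt (\<i> * (w1 - \<tau>)) * csqrt (\<i> * (w2 - \<tau>)))) \<tau> I \<and>
               Zhat m \<delta> \<tau> = qpow \<tau> (Zhat_exponent m) * (I + \<Theta>2 \<tau>)))
       \<and> (\<exists>F. is_completion 1 (\<lambda>\<tau>. qpow \<tau> (- Zhat_exponent m) * Zhat m \<delta> \<tau>) F)"
proof -
  interpret H_graph m
    using pos_def unimodular reduced by unfold_locales
  note Z = Zhat_eq[OF parity]
  obtain \<Theta>1 \<Theta>2 where \<Theta>: "comb_of_unary_theta_deriv_products \<Theta>1" "rank_two_theta \<Theta>2"
    "\<And>\<tau>. \<tau> \<in> upper_half_plane \<Longrightarrow> \<exists>I. eichler_integral \<Theta>1 \<tau> I \<and> zhat_series \<tau> = I + \<Theta>2 \<tau>"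
    using zhat_series_representable unfolding eichler_representable_def by blast
  have "\<exists>I. has_iterated_integral
                 (\<lambda>w1 w2. \<Theta>1 w1 w2 / (csqrt (\<i> * (w1 - \<tau>)) * csqrt (\<i> * (w2 - \<tau>)))) \<tau> I \<and>
               Zhat m \<delta> \<tau> = qpow \<tau> (Zhat_exponent m) * (I + \<Theta>2 \<tau>)" if "\<tau> \<in> upper_half_plane" for \<tau>
    using \<Theta>(3)[OF that] Z[of \<tau>] that unfolding eichler_integral_def by auto
  moreover have "\<exists>F. is_completion 1 (\<lambda>\<tau>. qpow \<tau> (- Zhat_exponent m) * Zhat m \<delta> \<tau>) F"
  proof -
    have "qpow \<tau> (- Zhat_exponent m) * Zhat m \<delta> \<tau> = zhat_series \<tau>" if "0 < Im \<tau>" for \<tau>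
    proof -
      have "qpow \<tau> (- x) * qpow \<tau> x = 1" for x unfolding qpow_add[symmetric] by (simp add: qpow_def)
      then show ?thesis unfolding Z[OF that] mult.assoc[symmetric] by simp
    qed
    note eq = this
    obtain F where "is_completion 1 zhat_series F" using zhat_series_completion by blast
    then have "is_completion 1 (\<lambda>\<tau>. qpow \<tau> (- Zhat_exponent m) * Zhat m \<delta> \<tau>) F"
      by (rule is_completion_cong) (rule eq[symmetric])
    then show ?thesis by blast
  qed
  ultimately show ?thesis using \<Theta>(1,2) by blast
qed

end
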